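(* Assume that the Möbius disjointness conjecture is true, i.e. assume that for every compact topological space $X$ and every continuous map $T:X\to X$ such that the topological entropy of $(X,T)$ is zero, one has $\frac1N\sum_{n\le N}\mu(n)f(T^nx)\to 0$ as $N\to\infty$ for all $f\in C(X)$ and all $x\in X$. Then for every unital exact C$^*$-algebra $\mathfrak{A}$ and every injective endomorphism $\alpha$ of $\mathfrak{A}$ whose Voiculescu–Brown entropy satisfies $ht(\alpha)=0$, the Möbius function $\mu$ is linearly disjoint from $(\mathfrak{A},\alpha)$.
   Context: $\mu$ is the Möbius function: $\mu(1)=1$, $\mu(n)=0$ if $n$ is not square-free, and $\mu(n)=(-1)^t$ if $n$ is a product of $t$ distinct primes. An endomorphism of a C$^*$-algebra means a $*$-endomorphism. For a C$^*$-algebra $\mathfrak{A}$ and an endomorphism $\alpha$ of $\mathfrak{A}$, $\mu$ is linearly disjoint from $(\mathfrak{A},\alpha)$ if $\frac1N\sum_{n=1}^N\mu(n)\rho(\alpha^n(A))\to0$ as $N\to\infty$ for every state $\rho$ on $\mathfrak{A}$ and every $A\in\mathfrak{A}$. Voiculescu–Brown entropy: let $\mathfrak{A}$ be exact (equivalently, nuclearly embeddable), $\alpha$ an automorphism or endomorphism of $\mathfrak{A}$, and $\pi:\mathfrak{A}\to\mathcal{B}(\mathcal{H})$ a faithful $*$-representation. For a finite set $\Omega\subset\mathfrak{A}$ and $\delta>0$ let $CPA(\pi,\Omega,\delta)$ be the collection of triples $(\varphi,\psi,\mathfrak{B})$ where $\mathfrak{B}$ is a finite-dimensional C$^*$-algebra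 and $\varphi:\mathfrak{A}\to\mathfrak{B}$, $\psi:\mathfrak{B}\to\mathcal{B}(\mathcal{H})$ are contractive completely positive maps with $\|(\psi\circ\varphi)(a)-\pi(a)\|<\delta$ for all $a\in\Omega$. Let $rcp(\Omega,\delta)$ be the infimum of $\operatorname{rank}\mathfrak{B}$ over all such triples, where rank is the dimension of a maximal abelian C$^*$-subalgebra. Set $ht(\alpha,\Omega,\delta)=\limsup_{n\to\infty}\frac1n\log rcp(\Omega\cup\alpha\Omega\cup\cdots\cup\alpha^{n-1}\Omega,\delta)$, $ht(\alpha,\Omega)=\sup_{\delta>0}ht(\alpha,\Omega,\delta)$, and $ht(\alpha)=\sup_\Omega ht(\alpha,\Omega)$, the last supremum over all finite $\Omega\subset\mathfrak{A}$. (This does not depend on $\pi$.) *)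

theory Defs
  imports
    "HOL-Analysis.Analysis"
    "HOL-Computational_Algebra.Squarefree"
    "HOL-Library.Function_Algebras"
    "HOL-Library.Extended_Nat"
begin

section \<open>The Moebius function and the Moebius disjointness conjecture\<close>

definition moebius_mu :: "nat \<Rightarrow> int" where
  "moebius_mu n = (if squarefree n then (-1) ^ card (prime_factors n) else 0)"

definition open_cover :: "'x topology \<Rightarrow> 'x set set \<Rightarrow> bool" where
  "open_cover X \<U> \<longleftrightarrow> (\<forall>U\<in>\<U>. openin X U) \<and> \<Union>\<U> = topspace X"

text \<open>The join of the covers \<open>T\<^sup>-\<^sup>i \<U>\<close>, \<open>i < n\<close>.\<close>

definition iterated_join :: "'x topology \<Rightarrow> ('x \<Rightarrow> 'x) \<Rightarrow> 'x set set \<Rightarrow> nat \<Rightarrow> 'x set set" where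
  "iterated_join X T \<U> n =
     {{x \<in> topspace X. \<forall>i<n. (T ^^ i) x \<in> u i} | u. \<forall>i<n. u i \<in> \<U>}"

definition subcover_number :: "'x topology \<Rightarrow> 'x set set \<Rightarrow> nat" where
  "subcover_number X \<U> =
     (LEAST k. \<exists>\<V>\<subseteq>\<U>. finite \<V> \<and> card \<V> = k \<and> topspace X \<subseteq> \<Union>\<V>)"

text \<open>Adler--Konheim--McAndrew entropy of a continuous self-map of a compact space.  The upper
  limit is a limit, by subadditivity.\<close>

definition topological_entropy :: "'x topology \<Rightarrow> ('x \<Rightarrow> 'x) \<Rightarrow> ereal" where
  "topological_entropy X T =
     (SUP \<U>\<in>{\<U>. open_cover X \<U>}.
        limsup (\<lambda>n. ereal (ln (real (subcover_number X (iterated_join X T \<U> n))) / real n)))"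

text \<open>HOL cannot quantify over all types inside a formula, so the conjecture is indexed by the
  type in which the points of \<open>X\<close> live.  The lemma \<open>moebius_disjointness_universal\<close> below shows
  that the instance for the type \<^typ>\<open>nat \<Rightarrow> complex\<close> implies all the others.\<close>

definition moebius_disjointness_conjecture :: "'x itself \<Rightarrow> bool" where
  "moebius_disjointness_conjecture _ \<longleftrightarrow>
     (\<forall>(X :: 'x topology) T.
        compact_space X \<and> continuous_map X X T \<and> topological_entropy X T = 0 \<longrightarrow>
        (\<forall>f :: 'x \<Rightarrow> complex. continuous_map X euclidean f \<longrightarrow>
          (\<forall>x\<in>topspace X.
            (\<lambda>N. (\<Sum>n=1..N. of_int (moebius_mu n) * f ((T ^^ n) x)) / of_nat N)
              \<longlonglongrightarrow> 0)))"

lemma continuous_map_funpow: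
  assumes "continuous_map X X T"
  shows "continuous_map X X (T ^^ i)"
proof (induction i)
  case 0
  show ?case by (simp add: id_def)
next
  case (Suc i)
  then show ?case using continuous_map_compose[OF Suc assms] by (simp add: o_def)
qed

lemma subcover_of_join_exists:
  assumes "compact_space X" "continuous_map X X T" "open_cover X \<U>"
  obtains \<V> where "\<V> \<subseteq> iterated_join X T \<U> n" "finite \<V>" "topspace X \<subseteq> \<Union>\<V>"
    "card \<V> = subcover_number X (iterated_join X T \<U> n)"
proof -
  let ?J = "iterated_join X T \<U> n"
  let ?P = "\<lambda>k. \<exists>\<V>\<subseteq>?J. finite \<V> \<and> card \<V> = k \<and> topspace X \<subseteq> \<Union>\<V>"
  have "openin X W" if "W \<in> ?J" for W
  proof -
    from that obtain u where u: "\<forall>i<n. u i \<in> \<U>"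
      and W: "W = {x \<in> topspace X. \<forall>i<n. (T ^^ i) x \<in> u i}"
      unfolding iterated_join_def by blast
    have "openin X {x \<in> topspace X. (T ^^ i) x \<in> u i}" if "i < n" for i
      using that u assms(3) unfolding open_cover_def
      by (intro openin_continuous_map_preimage[OF continuous_map_funpow[OF assms(2)]]) auto
    then have "openin X ((\<Inter>i\<in>{..<n}. {x \<in> topspace X. (T ^^ i) x \<in> u i}) \<inter> topspace X)"
      by (intro openin_INT) auto
    moreover have "(\<Inter>i\<in>{..<n}. {x \<in> topspace X. (T ^^ i) x \<in> u i}) \<inter> topspace X = W"
      using W by auto
    ultimately show ?thesis by simp
  qed
  moreover have "topspace X \<subseteq> \<Union>?J"
  proof
    fix x assume x: "x \<in> topspace X"
    have "\<exists>U\<in>\<U>. (T ^^ i) x \<in> U" for i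
      using continuous_map_funspace[OF continuous_map_funpow[OF assms(2)], of i] x assms(3)
      unfolding open_cover_def by (auto simp: Pi_iff)
    then obtain u where "\<And>i. u i \<in> \<U>" "\<And>i. (T ^^ i) x \<in> u i" by metis
    with x show "x \<in> \<Union>?J" unfolding iterated_join_def by blast
  qed
  ultimately have "\<exists>\<F>. finite \<F> \<and> \<F> \<subseteq> ?J \<and> topspace X \<subseteq> \<Union>\<F>"
    using assms(1) unfolding compact_space_def compactin_def by blast
  then have "\<exists>k. ?P k" by blast
  from LeastI_ex[OF this] show thesis
    using that unfolding subcover_number_def by blast
qed

lemma subcover_number_le:
  assumes "\<V> \<subseteq> \<U>" "finite \<V>" "topspace X \<subseteq> \<Union>\<V>"
  shows "subcover_number X \<U> \<le> card \<V>"
  unfolding subcover_number_def using assms by (intro Least_le) blast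

lemma ln_real_nat_nonneg: "0 \<le> ln (real k)"
  by (cases "k = 0") auto

lemma topological_entropy_nonneg: "0 \<le> topological_entropy X T"
proof -
  have "open_cover X {topspace X}" by (simp add: open_cover_def)
  then have "limsup (\<lambda>n. ereal (ln (real (subcover_number X
      (iterated_join X T {topspace X} n))) / real n)) \<le> topological_entropy X T"
    unfolding topological_entropy_def by (intro SUP_upper) simp
  moreover have "0 \<le> limsup (\<lambda>n. ereal (ln (real (subcover_number X
      (iterated_join X T {topspace X} n))) / real n))"
    by (intro le_Limsup always_eventually allI) (auto simp: ln_real_nat_nonneg)
  ultimately show ?thesis by order
qed

lemma topological_entropy_factor:
  assumes X: "compact_space X" "continuous_map X X T"
    and \<Phi>: "continuous_map X Y \<Phi>" "\<Phi> ` topspace X = topspace Y"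
    and comm: "\<And>x. x \<in> topspace X \<Longrightarrow> \<Phi> (T x) = S (\<Phi> x)"
  shows "topological_entropy Y S \<le> topological_entropy X T"
proof -
  have iter: "\<Phi> ((T ^^ i) x) = (S ^^ i) (\<Phi> x)" if "x \<in> topspace X" for i x
  proof (induction i)
    case (Suc i)
    have "(T ^^ i) x \<in> topspace X"
      using continuous_map_funspace[OF continuous_map_funpow[OF X(2)], of i] that by (auto simp: Pi_iff)
    then show ?case using Suc comm by simp
  qed simp
  show ?thesis
    unfolding topological_entropy_def
  proof (intro SUP_mono)
    fix \<V> assume "\<V> \<in> {\<V>. open_cover Y \<V>}"
    then have \<V>: "open_cover Y \<V>" by simp
    define pull where "pull V = {x \<in> topspace X. \<Phi> x \<in> V}" for V
    define \<U> where "\<U> = pull ` \<V>"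
    have "\<Phi> x \<in> \<Union>\<V>" if "x \<in> topspace X" for x
      using \<V> imageI[OF that, of \<Phi>] \<Phi>(2) unfolding open_cover_def by simp
    then have "\<Union>\<U> = topspace X" unfolding \<U>_def pull_def by auto
    moreover have "openin X (pull V)" if "V \<in> \<V>" for V
      using \<V> that openin_continuous_map_preimage[OF \<Phi>(1)] unfolding open_cover_def pull_def by blast
    ultimately have \<U>: "open_cover X \<U>" unfolding open_cover_def \<U>_def by auto
    have le: "subcover_number Y (iterated_join Y S \<V> n) \<le> subcover_number X (iterated_join X T \<U> n)"
      for n
    proof -
      obtain \<W> where \<W>: "\<W> \<subseteq> iterated_join X T \<U> n" "finite \<W>" "topspace X \<subseteq> \<Union>\<W>"
        "card \<W> = subcover_number X (iterated_join X T \<U> n)"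
        using subcover_of_join_exists[OF X \<U>] .
      have "\<exists>Z\<in>iterated_join Y S \<V> n. \<Phi> ` W \<subseteq> Z" if "W \<in> \<W>" for W
      proof -
        from that \<W>(1) obtain u where u: "\<forall>i<n. u i \<in> \<U>"
          and W: "W = {x \<in> topspace X. \<forall>i<n. (T ^^ i) x \<in> u i}"
          unfolding iterated_join_def by blast
        from u have "\<forall>i<n. \<exists>V. V \<in> \<V> \<and> u i = pull V" unfolding \<U>_def by blast
        then obtain v where v: "\<forall>i<n. v i \<in> \<V> \<and> u i = pull (v i)" by metis
        have "\<Phi> ` W \<subseteq> {y \<in> topspace Y. \<forall>i<n. (S ^^ i) y \<in> v i}"
          using W v \<Phi>(2) iter unfolding pull_def by auto
        moreover have "{y \<in> topspace Y. \<forall>i<n. (S ^^ i) y \<in> v i} \<in> iterated_join Y S \<V> n"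
          using v unfolding iterated_join_def by blast
        ultimately show ?thesis by blast
      qed
      then have "\<exists>z. \<forall>W\<in>\<W>. z W \<in> iterated_join Y S \<V> n \<and> \<Phi> ` W \<subseteq> z W"
        by (intro bchoice) blast
      then obtain z where z: "z ` \<W> \<subseteq> iterated_join Y S \<V> n" "\<And>W. W \<in> \<W> \<Longrightarrow> \<Phi> ` W \<subseteq> z W"
        by blast
      have "topspace Y \<subseteq> \<Union>(z ` \<W>)"
      proof
        fix y assume "y \<in> topspace Y"
        then obtain x where "x \<in> topspace X" "y = \<Phi> x" using \<Phi>(2) by blast
        with \<W>(3) obtain W where "W \<in> \<W>" "x \<in> W" by blast
        with z(2)[of W] \<open>y = \<Phi> x\<close> show "y \<in> \<Union>(z ` \<W>)" by blast
      qed
      then have "subcover_number Y (iterated_join Y S \<V> n) \<le> card (z ` \<W>)"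
        by (intro subcover_number_le z(1) finite_imageI \<W>(2))
      also have "\<dots> \<le> card \<W>" using \<W>(2) by (rule card_image_le)
      finally show ?thesis using \<W>(4) by simp
    qed
    have "ln (real (subcover_number Y (iterated_join Y S \<V> n))) / real n
        \<le> ln (real (subcover_number X (iterated_join X T \<U> n))) / real n" for n
    proof (cases "subcover_number Y (iterated_join Y S \<V> n) = 0")
      case True
      then show ?thesis by (simp add: ln_real_nat_nonneg)
    next
      case False
      with le[of n] show ?thesis by (intro divide_right_mono) auto
    qed
    then have "limsup (\<lambda>n. ereal (ln (real (subcover_number Y (iterated_join Y S \<V> n))) / real n))
        \<le> limsup (\<lambda>n. ereal (ln (real (subcover_number X (iterated_join X T \<U> n))) / real n))"
      by (intro Limsup_mono always_eventually allI) simp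
    with \<U> show "\<exists>\<U>\<in>{\<U>. open_cover X \<U>}.
        limsup (\<lambda>n. ereal (ln (real (subcover_number Y (iterated_join Y S \<V> n))) / real n))
        \<le> limsup (\<lambda>n. ereal (ln (real (subcover_number X (iterated_join X T \<U> n))) / real n))"
      by blast
  qed
qed

text \<open>Given \<open>f\<close>, pass to the factor \<open>x \<mapsto> (f (T\<^sup>n x))\<^sub>n\<close> with the shift.\<close>

lemma moebius_disjointness_universal:
  assumes "moebius_disjointness_conjecture TYPE(nat \<Rightarrow> complex)"
  shows "moebius_disjointness_conjecture TYPE('x)"
  unfolding moebius_disjointness_conjecture_def
proof (intro allI impI ballI, elim conjE)
  fix X :: "'x topology" and T and f :: "'x \<Rightarrow> complex" and x
  assume X: "compact_space X" "continuous_map X X T" and entropy: "topological_entropy X T = 0"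
    and f: "continuous_map X euclidean f" and x: "x \<in> topspace X"
  define \<Phi> where "\<Phi> = (\<lambda>y n. f ((T ^^ n) y))"
  define S where "S = (\<lambda>(s :: nat \<Rightarrow> complex) n. s (Suc n))"
  define P where "P = product_topology (\<lambda>_ :: nat. euclidean :: complex topology) UNIV"
  define Y where "Y = subtopology P (\<Phi> ` topspace X)"
  have "continuous_map X euclidean (\<lambda>y. f ((T ^^ n) y))" for n
    using continuous_map_compose[OF continuous_map_funpow[OF X(2)] f, of n] by (simp add: o_def)
  then have \<Phi>P: "continuous_map X P \<Phi>"
    unfolding P_def \<Phi>_def by (simp add: continuous_map_componentwise_UNIV)
  then have \<Phi>: "continuous_map X Y \<Phi>"
    unfolding Y_def by (simp add: continuous_map_in_subtopology)
  have top: "topspace Y = \<Phi> ` topspace X"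
    unfolding Y_def P_def by simp
  have comm: "\<Phi> (T y) = S (\<Phi> y)" for y
    unfolding \<Phi>_def S_def by (simp add: fun_eq_iff funpow_Suc_right del: funpow.simps)
  have "compactin P (\<Phi> ` topspace X)"
    using image_compactin[OF _ \<Phi>P] X(1) by (simp add: compact_space_def)
  then have "compact_space Y" unfolding Y_def by (rule compact_space_subtopology)
  moreover have coord: "continuous_map P euclidean (\<lambda>s. s n)" for n
    unfolding P_def by (metis UNIV_I continuous_map_product_projection)
  have "continuous_map P P S"
    unfolding S_def using coord by (subst (2) P_def) (simp add: continuous_map_componentwise_UNIV)
  moreover have "S \<in> topspace Y \<rightarrow> topspace Y"
  proof
    fix s assume "s \<in> topspace Y"
    then obtain y where "y \<in> topspace X" "s = \<Phi> y" using top by blast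
    moreover have "T y \<in> topspace X"
      using continuous_map_funspace[OF X(2)] \<open>y \<in> topspace X\<close> by (auto simp: Pi_iff)
    ultimately show "S s \<in> topspace Y" using comm top by (metis image_eqI)
  qed
  ultimately have Y: "compact_space Y" "continuous_map Y Y S"
    using top unfolding Y_def
    by (auto simp: continuous_map_in_subtopology continuous_map_from_subtopology)
  have "topological_entropy Y S \<le> 0"
    using topological_entropy_factor[OF X \<Phi> top[symmetric] comm] entropy by simp
  then have ent: "topological_entropy Y S = 0"
    using topological_entropy_nonneg[of Y S] by order
  have g: "continuous_map Y euclidean (\<lambda>s. s 0)"
    unfolding Y_def by (rule continuous_map_from_subtopology[OF coord])
  have Sn: "(S ^^ n) s m = s (n + m)" for n s m
  proof (induction n arbitrary: m)
    case (Suc n)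
    have "(S ^^ Suc n) s m = (S ^^ n) s (Suc m)"
      unfolding funpow.simps o_apply by (subst S_def) (rule refl)
    with Suc show ?case by simp
  qed simp
  have "(\<lambda>N. (\<Sum>n=1..N. of_int (moebius_mu n) * (S ^^ n) (\<Phi> x) 0) / of_nat N) \<longlonglongrightarrow> 0"
    using assms Y ent g x top unfolding moebius_disjointness_conjecture_def by blast
  then show "(\<lambda>N. (\<Sum>n=1..N. of_int (moebius_mu n) * f ((T ^^ n) x)) / of_nat N) \<longlonglongrightarrow> 0"
    by (simp add: Sn \<Phi>_def)
qed

section \<open>C*-algebras\<close>

text \<open>A C*-algebra is a set \<open>elems\<close> in an ambient additive group on which \<open>scl\<close> is a complex
  vector space structure; it need not be the whole type.  Addition is that of the ambient type.
  Explicit carriers are needed because the rank in the definition of entropy is minimised over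
  all finite-dimensional C*-algebras.\<close>

record 'a star_struct =
  elems :: "'a set"
  scl :: "complex \<Rightarrow> 'a \<Rightarrow> 'a"
  mul :: "'a \<Rightarrow> 'a \<Rightarrow> 'a"
  adj :: "'a \<Rightarrow> 'a"
  nrm :: "'a \<Rightarrow> real"

locale cstar_algebra = vector_space "scl A" for A :: "'a::ab_group_add star_struct" +
  assumes subspace_elems: "subspace (elems A)"
    and mul_closed: "\<lbrakk>x \<in> elems A; y \<in> elems A\<rbrakk> \<Longrightarrow> mul A x y \<in> elems A"
    and mul_assoc: "\<lbrakk>x \<in> elems A; y \<in> elems A; z \<in> elems A\<rbrakk> \<Longrightarrow>
      mul A (mul A x y) z = mul A x (mul A y z)"
    and mul_add_left: "\<lbrakk>x \<in> elems A; y \<in> elems A; z \<in> elems A\<rbrakk> \<Longrightarrow>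
      mul A (x + y) z = mul A x z + mul A y z"
    and mul_add_right: "\<lbrakk>x \<in> elems A; y \<in> elems A; z \<in> elems A\<rbrakk> \<Longrightarrow>
      mul A x (y + z) = mul A x y + mul A x z"
    and mul_scl_left: "\<lbrakk>x \<in> elems A; y \<in> elems A\<rbrakk> \<Longrightarrow>
      mul A (scl A c x) y = scl A c (mul A x y)"
    and mul_scl_right: "\<lbrakk>x \<in> elems A; y \<in> elems A\<rbrakk> \<Longrightarrow>
      mul A x (scl A c y) = scl A c (mul A x y)"
    and adj_closed: "x \<in> elems A \<Longrightarrow> adj A x \<in> elems A"
    and adj_adj: "x \<in> elems A \<Longrightarrow> adj A (adj A x) = x"
    and adj_add: "\<lbrakk>x \<in> elems A; y \<in> elems A\<rbrakk> \<Longrightarrow> adj A (x + y) = adj A x + adj A y"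
    and adj_scl: "x \<in> elems A \<Longrightarrow> adj A (scl A c x) = scl A (cnj c) (adj A x)"
    and adj_mul: "\<lbrakk>x \<in> elems A; y \<in> elems A\<rbrakk> \<Longrightarrow>
      adj A (mul A x y) = mul A (adj A y) (adj A x)"
    and nrm_eq_0: "x \<in> elems A \<Longrightarrow> nrm A x = 0 \<longleftrightarrow> x = 0"
    and nrm_triangle: "\<lbrakk>x \<in> elems A; y \<in> elems A\<rbrakk> \<Longrightarrow> nrm A (x + y) \<le> nrm A x + nrm A y"
    and nrm_scl: "x \<in> elems A \<Longrightarrow> nrm A (scl A c x) = cmod c * nrm A x"
    and nrm_mul: "\<lbrakk>x \<in> elems A; y \<in> elems A\<rbrakk> \<Longrightarrow> nrm A (mul A x y) \<le> nrm A x * nrm A y"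
    and cstar_identity: "x \<in> elems A \<Longrightarrow> nrm A (mul A (adj A x) x) = (nrm A x)\<^sup>2"
    and complete: "\<lbrakk>\<And>n. s n \<in> elems A;
        \<And>e. e > 0 \<Longrightarrow> \<exists>M. \<forall>m\<ge>M. \<forall>n\<ge>M. nrm A (s m - s n) < e\<rbrakk> \<Longrightarrow>
      \<exists>l\<in>elems A. (\<lambda>n. nrm A (s n - l)) \<longlonglongrightarrow> 0"

definition is_unit_of :: "'a star_struct \<Rightarrow> 'a \<Rightarrow> bool" where
  "is_unit_of A e \<longleftrightarrow> e \<in> elems A \<and> (\<forall>x\<in>elems A. mul A e x = x \<and> mul A x e = x)"

definition unital :: "'a star_struct \<Rightarrow> bool" where
  "unital A \<longleftrightarrow> (\<exists>e. is_unit_of A e)"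

definition linear_map_on ::
    "'a::ab_group_add star_struct \<Rightarrow> (complex \<Rightarrow> 'b \<Rightarrow> 'b) \<Rightarrow> ('a \<Rightarrow> 'b::ab_group_add) \<Rightarrow> bool" where
  "linear_map_on A s f \<longleftrightarrow>
     (\<forall>x\<in>elems A. \<forall>y\<in>elems A. f (x + y) = f x + f y) \<and>
     (\<forall>c. \<forall>x\<in>elems A. f (scl A c x) = s c (f x))"

text \<open>Homomorphisms are not required to preserve units.\<close>

definition star_hom ::
    "'a::ab_group_add star_struct \<Rightarrow> 'b::ab_group_add star_struct \<Rightarrow> ('a \<Rightarrow> 'b) \<Rightarrow> bool" where
  "star_hom A B f \<longleftrightarrow>
     f ` elems A \<subseteq> elems B \<and> linear_map_on A (scl B) f \<and>
     (\<forall>x\<in>elems A. \<forall>y\<in>elems A. f (mul A x y) = mul B (f x) (f y)) \<and>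
     (\<forall>x\<in>elems A. f (adj A x) = adj B (f x))"

definition state :: "'a::ab_group_add star_struct \<Rightarrow> ('a \<Rightarrow> complex) \<Rightarrow> bool" where
  "state A \<rho> \<longleftrightarrow>
     linear_map_on A (*) \<rho> \<and>
     (\<forall>x\<in>elems A. \<rho> (mul A (adj A x) x) \<in> \<real>\<^sub>\<ge>\<^sub>0) \<and>
     (\<exists>e. is_unit_of A e \<and> \<rho> e = 1)"

definition mu_linearly_disjoint ::
    "'a::ab_group_add star_struct \<Rightarrow> ('a \<Rightarrow> 'a) \<Rightarrow> bool" where
  "mu_linearly_disjoint A \<alpha> \<longleftrightarrow>
     (\<forall>\<rho> a. state A \<rho> \<and> a \<in> elems A \<longrightarrow>
       (\<lambda>N. (\<Sum>n=1..N. of_int (moebius_mu n) * \<rho> ((\<alpha> ^^ n) a)) / of_nat N) \<longlonglongrightarrow> 0)"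

text \<open>Positivity in the C*-algebra of \<open>n \<times> n\<close> matrices over \<open>A\<close>: the matrix is of the form
  \<open>x\<^sup>* x\<close>.  Entries outside the index range are ignored.\<close>

definition positive_matrix ::
    "'a::ab_group_add star_struct \<Rightarrow> nat \<Rightarrow> (nat \<Rightarrow> nat \<Rightarrow> 'a) \<Rightarrow> bool" where
  "positive_matrix A n a \<longleftrightarrow>
     (\<exists>x. (\<forall>i<n. \<forall>j<n. x i j \<in> elems A) \<and>
          (\<forall>i<n. \<forall>j<n. a i j = (\<Sum>k<n. mul A (adj A (x k i)) (x k j))))"

definition completely_positive ::
    "'a::ab_group_add star_struct \<Rightarrow> 'b::ab_group_add star_struct \<Rightarrow> ('a \<Rightarrow> 'b) \<Rightarrow> bool" where
  "completely_positive A B f \<longleftrightarrow>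
     f ` elems A \<subseteq> elems B \<and> linear_map_on A (scl B) f \<and>
     (\<forall>n a. positive_matrix A n a \<longrightarrow> positive_matrix B n (\<lambda>i j. f (a i j)))"

definition contractive ::
    "'a::ab_group_add star_struct \<Rightarrow> 'b::ab_group_add star_struct \<Rightarrow> ('a \<Rightarrow> 'b) \<Rightarrow> bool" where
  "contractive A B f \<longleftrightarrow> (\<forall>x\<in>elems A. nrm B (f x) \<le> nrm A x)"

definition finite_dimensional :: "'a::ab_group_add star_struct \<Rightarrow> bool" where
  "finite_dimensional A \<longleftrightarrow> (\<exists>b. finite b \<and> elems A \<subseteq> module.span (scl A) b)"

definition abelian_cstar_subalgebra :: "'a::ab_group_add star_struct \<Rightarrow> 'a set \<Rightarrow> bool" where
  "abelian_cstar_subalgebra A M \<longleftrightarrow>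
     M \<subseteq> elems A \<and> cstar_algebra (A\<lparr>elems := M\<rparr>) \<and>
     (\<forall>x\<in>M. \<forall>y\<in>M. mul A x y = mul A y x)"

definition maximal_abelian :: "'a::ab_group_add star_struct \<Rightarrow> 'a set \<Rightarrow> bool" where
  "maximal_abelian A M \<longleftrightarrow>
     abelian_cstar_subalgebra A M \<and>
     (\<forall>M'. abelian_cstar_subalgebra A M' \<and> M \<subseteq> M' \<longrightarrow> M' = M)"

text \<open>In a finite-dimensional C*-algebra all maximal abelian C*-subalgebras have the same
  dimension, so the choice is immaterial.\<close>

definition cstar_rank :: "'a::ab_group_add star_struct \<Rightarrow> nat" where
  "cstar_rank A = vector_space.dim (scl A) (SOME M. maximal_abelian A M)"

section \<open>Representations on Hilbert spaces\<close>

class complex_hilbert_space = banach +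
  fixes scaleC :: "complex \<Rightarrow> 'a \<Rightarrow> 'a"
    and cinner :: "'a \<Rightarrow> 'a \<Rightarrow> complex"
  assumes scaleC_add_right: "scaleC c (x + y) = scaleC c x + scaleC c y"
    and scaleC_add_left: "scaleC (c + d) x = scaleC c x + scaleC d x"
    and scaleC_scaleC: "scaleC c (scaleC d x) = scaleC (c * d) x"
    and scaleC_of_real: "scaleC (complex_of_real r) x = scaleR r x"
    and cinner_commute: "cinner x y = cnj (cinner y x)"
    and cinner_add_left: "cinner (x + y) z = cinner x z + cinner y z"
    and cinner_scaleC_left: "cinner (scaleC c x) y = c * cinner x y"
    and cinner_self: "cinner x x = complex_of_real ((norm x)\<^sup>2)"

definition bounded_operators :: "('h::complex_hilbert_space \<Rightarrow> 'h) star_struct" where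
  "bounded_operators =
     \<lparr>elems = {S. bounded_linear S \<and> (\<forall>c x. S (scaleC c x) = scaleC c (S x))},
      scl = (\<lambda>c S x. scaleC c (S x)),
      mul = (\<circ>),
      adj = (\<lambda>S. THE S'. \<forall>x y. cinner (S x) y = cinner x (S' y)),
      nrm = onorm\<rparr>"

definition faithful_representation ::
    "'a::ab_group_add star_struct \<Rightarrow> ('a \<Rightarrow> 'h::complex_hilbert_space \<Rightarrow> 'h) \<Rightarrow> bool" where
  "faithful_representation A \<pi> \<longleftrightarrow> star_hom A bounded_operators \<pi> \<and> inj_on \<pi> (elems A)"

section \<open>Exactness and Voiculescu--Brown entropy\<close>

text \<open>The finite-dimensional algebras \<open>B\<close> are carried by finite-dimensional subspaces of the
  sequence type \<^typ>\<open>nat \<Rightarrow> complex\<close>, with arbitrary operations and norm; every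
  finite-dimensional C*-algebra is isomorphic to one of these.\<close>

definition CPA ::
    "'a::ab_group_add star_struct \<Rightarrow> ('a \<Rightarrow> 'h::complex_hilbert_space \<Rightarrow> 'h) \<Rightarrow> 'a set \<Rightarrow> real \<Rightarrow>
     (('a \<Rightarrow> nat \<Rightarrow> complex) \<times> ((nat \<Rightarrow> complex) \<Rightarrow> 'h \<Rightarrow> 'h) \<times> (nat \<Rightarrow> complex) star_struct) set"
  where
  "CPA A \<pi> \<Omega> \<delta> =
     {(\<phi>, \<psi>, B).
        cstar_algebra B \<and> finite_dimensional B \<and>
        completely_positive A B \<phi> \<and> contractive A B \<phi> \<and>
        completely_positive B bounded_operators \<psi> \<and> contractive B bounded_operators \<psi> \<and>
        (\<forall>a\<in>\<Omega>. nrm bounded_operators (\<psi> (\<phi> a) - \<pi> a) < \<delta>)}"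

text \<open>The infimum over the empty set is \<open>\<infinity>\<close>.\<close>

definition rcp ::
    "'a::ab_group_add star_struct \<Rightarrow> ('a \<Rightarrow> 'h::complex_hilbert_space \<Rightarrow> 'h) \<Rightarrow> 'a set \<Rightarrow> real \<Rightarrow> enat"
  where
  "rcp A \<pi> \<Omega> \<delta> = (INF (\<phi>, \<psi>, B)\<in>CPA A \<pi> \<Omega> \<delta>. enat (cstar_rank B))"

text \<open>The value at 0 only matters for the zero algebra \<open>B = 0\<close>, which can occur in
  \<^const>\<open>CPA\<close> if all elements of \<open>\<Omega>\<close> have norm less than \<open>\<delta>\<close>.\<close>

definition ln_enat :: "enat \<Rightarrow> ereal" where
  "ln_enat r = (case r of enat k \<Rightarrow> (if k = 0 then -\<infinity> else ereal (ln (real k))) | \<infinity> \<Rightarrow> \<infinity>)"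

definition voiculescu_brown_entropy ::
    "'a::ab_group_add star_struct \<Rightarrow> ('a \<Rightarrow> 'h::complex_hilbert_space \<Rightarrow> 'h) \<Rightarrow> ('a \<Rightarrow> 'a) \<Rightarrow> ereal"
  where
  "voiculescu_brown_entropy A \<pi> \<alpha> =
     (SUP \<Omega>\<in>{\<Omega>. finite \<Omega> \<and> \<Omega> \<subseteq> elems A}. SUP \<delta>\<in>{0<..}.
        limsup (\<lambda>n. ln_enat (rcp A \<pi> (\<Union>i<n. (\<alpha> ^^ i) ` \<Omega>) \<delta>) / ereal (real n)))"

text \<open>Exactness as nuclear embeddability: some faithful representation on a Hilbert space is a
  nuclear map.  The underlying type \<open>'k\<close> of that space is a parameter; a theorem that assumes
  \<open>exact_via TYPE('k) A\<close> for a type variable \<open>'k\<close> holds for all \<open>A\<close> embedding nuclearly into the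
  operators on any Hilbert space whatsoever.\<close>

definition exact_via :: "'k::complex_hilbert_space itself \<Rightarrow> 'a::ab_group_add star_struct \<Rightarrow> bool"
  where
  "exact_via _ A \<longleftrightarrow>
     (\<exists>\<pi> :: 'a \<Rightarrow> 'k \<Rightarrow> 'k. faithful_representation A \<pi> \<and>
       (\<forall>\<Omega> \<delta>. finite \<Omega> \<and> \<Omega> \<subseteq> elems A \<and> \<delta> > 0 \<longrightarrow> CPA A \<pi> \<Omega> \<delta> \<noteq> {}))"

end

theory Submission
  imports Defs "HOL-Computational_Algebra.Fundamental_Theorem_Algebra"
begin

text \<open>
  Fix a state \<open>\<rho>\<close> and an element \<open>a\<close>, and write \<open>a\<^sub>i\<close> for the \<open>i\<close>-th iterate of \<open>a\<close> under
  \<open>\<alpha>\<close>.  The sequence \<open>\<rho>(a\<^sub>i)\<close> is a point of the space \<open>X\<close> of all complex sequences \<open>s\<close> with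
  \<open>\<bar>\<Sum>c\<^sub>i s\<^sub>i\<bar> \<le> \<parallel>\<Sum>c\<^sub>i a\<^sub>i\<parallel>\<close> for all finite families \<open>c\<close>.  This space is compact, and it is
  invariant under the shift because \<open>\<alpha>\<close> is contractive.  If the shift on \<open>X\<close> has entropy zero, the
  conjecture, applied with the zeroth coordinate as observable, is the assertion.  So everything
  rests on a bound for the entropy of \<open>X\<close>, and both that bound and the hypothesis on \<open>\<alpha>\<close> are read
  off from one sequence of numbers, the Rademacher averages
  \<open>R\<^sub>n = E \<parallel>\<epsilon>\<^sub>0 a\<^sub>0 + \<dots> + \<epsilon>\<^bsub>n-1\<^esub> a\<^bsub>n-1\<^esub>\<parallel>\<close> over independent signs.

  Vanishing Voiculescu--Brown entropy gives \<open>R\<^sub>n = o(n)\<close>.  A faithful representation is isometric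
  (\<open>faithful_representation_isometric\<close>), so up to an error \<open>\<delta> n\<close> the \<open>a\<^sub>i\<close> may be replaced by
  their images \<open>b\<^sub>i\<close> in a finite-dimensional algebra \<open>B\<close> whose rank \<open>k\<close> grows subexponentially.
  The minimal projections of a maximal abelian subalgebra of \<open>B\<close> give at most \<open>k\<close> contractive
  functionals \<open>f\<^sub>p\<close> with \<open>\<parallel>y\<parallel>\<^sup>2 \<le> k \<Sum>f\<^sub>p(y\<^sup>* y)\<close> (\<open>pinching_functionals\<close>).  Apply
  this to a high power of \<open>y\<^sup>* y\<close> with \<open>y = \<Sum>\<epsilon>\<^sub>j b\<^sub>j\<close> and expand into words in the \<open>b\<^sub>j\<close>:
  averaging over the signs kills every word in which some index occurs an odd number of times, and
  the others are counted by the moment \<open>E (\<Sum>\<epsilon>\<^sub>j)\<^sup>L\<close>.  Hence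
  \<open>E \<parallel>y\<parallel>\<^sup>L \<le> k\<^sup>2 E (\<Sum>\<epsilon>\<^sub>j)\<^sup>L\<close> if the \<open>b\<^sub>j\<close> are contractions and
  \<open>L \<ge> 4\<close> is a power of two (\<open>sign_avg_nrm_power\<close>).  For \<open>L\<close> of the order of a small multiple
  of \<open>n\<close> the factor \<open>k\<^sup>2\<close> is harmless (\<open>sign_avg_nrm_le\<close>, \<open>rademacher_averages_of_orbit\<close>).

  Conversely, \<open>R\<^sub>n = o(n)\<close> bounds the entropy of \<open>X\<close> by an argument from online learning.
  Reveal the coordinates of the real part of a point of \<open>X\<close> one after the other, guessing each of
  them before it is revealed, and update the state of the guesser only after a miss, that is, if
  the residual does not round to 0 in units of \<open>\<gamma>\<close>.  The guess can be chosen so that each miss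
  consumes at least \<open>\<gamma>/2\<close> of a budget whose total is \<open>R\<^sub>n\<close>
  (\<open>residual_code_nonzero_bound\<close>).  The word of rounded residuals therefore has at most
  \<open>2 R\<^sub>n / \<gamma> = o(n)\<close> nonzero letters from a fixed finite alphabet, it determines the coordinates
  up to \<open>\<gamma>\<close>, and there are only \<open>e\<^bsup>o(n)\<^esup>\<close> such words (\<open>sparse_codes_card\<close>).
\<close>

section \<open>Algebra and convergence in a C*-algebra; square roots\<close>

context cstar_algebra begin

lemma zero_closed: "0 \<in> elems A"
  using subspace_elems by (rule subspace_0)

lemma add_closed: "\<lbrakk>x \<in> elems A; y \<in> elems A\<rbrakk> \<Longrightarrow> x + y \<in> elems A"
  using subspace_elems by (rule subspace_add)

lemma diff_closed: "\<lbrakk>x \<in> elems A; y \<in> elems A\<rbrakk> \<Longrightarrow> x - y \<in> elems A"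
  using subspace_elems by (rule subspace_diff)

lemma scl_closed: "x \<in> elems A \<Longrightarrow> scl A c x \<in> elems A"
  using subspace_elems by (rule subspace_scale)

lemma sum_closed: "(\<And>i. i \<in> I \<Longrightarrow> f i \<in> elems A) \<Longrightarrow> sum f I \<in> elems A"
  using subspace_elems by (rule subspace_sum)

lemmas closed = zero_closed add_closed diff_closed scl_closed sum_closed mul_closed adj_closed

lemma mul_diff_left:
  "\<lbrakk>x \<in> elems A; y \<in> elems A; z \<in> elems A\<rbrakk> \<Longrightarrow> mul A (x - y) z = mul A x z - mul A y z"
  using mul_add_left[of "x - y" y z] by (simp add: closed)

lemma mul_diff_right:
  "\<lbrakk>x \<in> elems A; y \<in> elems A; z \<in> elems A\<rbrakk> \<Longrightarrow> mul A x (y - z) = mul A x y - mul A x z"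
  using mul_add_right[of x "y - z" z] by (simp add: closed)

lemma mul_zero_left: "x \<in> elems A \<Longrightarrow> mul A 0 x = 0"
  using mul_diff_left[of 0 0 x] by (simp add: closed)

lemma mul_zero_right: "x \<in> elems A \<Longrightarrow> mul A x 0 = 0"
  using mul_diff_right[of x 0 0] by (simp add: closed)

lemma adj_diff: "\<lbrakk>x \<in> elems A; y \<in> elems A\<rbrakk> \<Longrightarrow> adj A (x - y) = adj A x - adj A y"
  using adj_add[of "x - y" y] by (simp add: closed)

lemma adj_zero: "adj A 0 = 0"
  using adj_diff[of 0 0] by (simp add: closed)

lemma mul_sum_left:
  "\<lbrakk>\<And>i. i \<in> I \<Longrightarrow> f i \<in> elems A; y \<in> elems A\<rbrakk> \<Longrightarrow> mul A (sum f I) y = (\<Sum>i\<in>I. mul A (f i) y)"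
  by (induction I rule: infinite_finite_induct) (auto simp: mul_zero_left mul_add_left closed)

lemma mul_sum_right:
  "\<lbrakk>\<And>i. i \<in> I \<Longrightarrow> f i \<in> elems A; y \<in> elems A\<rbrakk> \<Longrightarrow> mul A y (sum f I) = (\<Sum>i\<in>I. mul A y (f i))"
  by (induction I rule: infinite_finite_induct) (auto simp: mul_zero_right mul_add_right closed)

lemma adj_sum: "(\<And>i. i \<in> I \<Longrightarrow> f i \<in> elems A) \<Longrightarrow> adj A (sum f I) = (\<Sum>i\<in>I. adj A (f i))"
  by (induction I rule: infinite_finite_induct) (auto simp: adj_zero adj_add closed)

lemma nrm_zero: "nrm A 0 = 0"
  using nrm_eq_0[OF zero_closed] by simp

lemma scl_m1: "scl A (-1) x = - x"
  by (metis scale_minus_left scale_one)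

lemma nrm_uminus: "x \<in> elems A \<Longrightarrow> nrm A (- x) = nrm A x"
  using nrm_scl[of x "-1"] by (simp add: scl_m1)

lemma uminus_closed: "x \<in> elems A \<Longrightarrow> - x \<in> elems A"
  using scl_closed[of x "-1"] by (simp add: scl_m1)

lemma nrm_nonneg: "x \<in> elems A \<Longrightarrow> 0 \<le> nrm A x"
  using nrm_triangle[of x "- x"] by (simp add: nrm_zero nrm_uminus uminus_closed)

lemma nrm_diff: "\<lbrakk>x \<in> elems A; y \<in> elems A\<rbrakk> \<Longrightarrow> nrm A (x - y) \<le> nrm A x + nrm A y"
  using nrm_triangle[of x "- y"] by (simp add: nrm_uminus uminus_closed)

lemma nrm_minus_commute: "\<lbrakk>x \<in> elems A; y \<in> elems A\<rbrakk> \<Longrightarrow> nrm A (x - y) = nrm A (y - x)"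
  using nrm_uminus[of "x - y"] by (simp add: closed)

lemma nrm_triangle_sub:
  "\<lbrakk>x \<in> elems A; y \<in> elems A; z \<in> elems A\<rbrakk> \<Longrightarrow> nrm A (x - z) \<le> nrm A (x - y) + nrm A (y - z)"
  using nrm_triangle[of "x - y" "y - z"] by (simp add: closed)

lemma nrm_sum: "(\<And>i. i \<in> I \<Longrightarrow> f i \<in> elems A) \<Longrightarrow> nrm A (sum f I) \<le> (\<Sum>i\<in>I. nrm A (f i))"
proof (induction I rule: infinite_finite_induct)
  case (insert i I)
  then show ?case using nrm_triangle[of "f i" "sum f I"] by (force simp: closed)
qed (auto simp: nrm_zero)

text \<open>The C*-identity and submultiplicativity give \<open>\<parallel>x\<parallel>\<^sup>2 \<le> \<parallel>x\<^sup>*\<parallel> \<parallel>x\<parallel>\<close>; the other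
  inequality follows because the adjoint is involutive.\<close>

lemma nrm_adj:
  assumes x: "x \<in> elems A" shows "nrm A (adj A x) = nrm A x"
proof -
  have le: "nrm A y \<le> nrm A (adj A y)" if y: "y \<in> elems A" for y
  proof (cases "nrm A y = 0")
    case False
    then have "nrm A y > 0" using nrm_nonneg[OF y] by simp
    moreover have "nrm A y * nrm A y \<le> nrm A (adj A y) * nrm A y"
      using nrm_mul[of "adj A y" y] cstar_identity[OF y] y by (simp add: closed power2_eq_square)
    ultimately show ?thesis by simp
  qed (use nrm_nonneg y closed in auto)
  from le[OF x] le[of "adj A x"] x show ?thesis by (simp add: closed adj_adj)
qed

text \<open>The carrier lives in a bare additive group, so the topology of the ambient type cannot be used
  and limits have to be taken with respect to the norm field of the record.\<close>

definition tends :: "(nat \<Rightarrow> 'a) \<Rightarrow> 'a \<Rightarrow> bool" where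
  "tends s l \<longleftrightarrow> range s \<subseteq> elems A \<and> l \<in> elems A \<and> (\<lambda>n. nrm A (s n - l)) \<longlonglongrightarrow> 0"

lemma tendsD: "tends s l \<Longrightarrow> s n \<in> elems A" "tends s l \<Longrightarrow> l \<in> elems A"
  by (auto simp: tends_def)

lemma tendsI:
  assumes "\<And>n. s n \<in> elems A" "l \<in> elems A" "\<And>n. nrm A (s n - l) \<le> g n" "g \<longlonglongrightarrow> 0"
  shows "tends s l"
  unfolding tends_def
proof (intro conjI)
  show "(\<lambda>n. nrm A (s n - l)) \<longlonglongrightarrow> 0"
    by (rule tendsto_sandwich[OF _ _ tendsto_const assms(4)])
      (use assms nrm_nonneg closed in auto)
qed (use assms in auto)

lemma tends_unique:
  assumes "tends s l" "tends s l'" shows "l = l'"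
proof -
  have mem: "l \<in> elems A" "l' \<in> elems A" "\<And>n. s n \<in> elems A" using assms tendsD by auto
  have "(\<lambda>n. nrm A (s n - l) + nrm A (s n - l')) \<longlonglongrightarrow> 0 + 0"
    using assms by (intro tendsto_add) (auto simp: tends_def)
  moreover have "nrm A (l - l') \<le> nrm A (s n - l) + nrm A (s n - l')" for n
    using nrm_triangle_sub[of l "s n" l'] nrm_minus_commute[of l "s n"] mem by simp
  ultimately have "nrm A (l - l') \<le> 0 + 0"
    by (intro tendsto_lowerbound[where F = sequentially]) auto
  then show ?thesis using nrm_nonneg[of "l - l'"] nrm_eq_0[of "l - l'"] mem by (simp add: closed)
qed

lemma tends_const: "x \<in> elems A \<Longrightarrow> tends (\<lambda>_. x) x"
  by (auto simp: tends_def nrm_zero)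

lemma tends_add:
  assumes "tends s l" "tends r k" shows "tends (\<lambda>n. s n + r n) (l + k)"
proof (rule tendsI)
  show "nrm A (s n + r n - (l + k)) \<le> nrm A (s n - l) + nrm A (r n - k)" for n
    using nrm_triangle[of "s n - l" "r n - k"] tendsD assms by (simp add: closed algebra_simps)
  show "(\<lambda>n. nrm A (s n - l) + nrm A (r n - k)) \<longlonglongrightarrow> 0"
    using tendsto_add[of _ 0 _ _ 0] assms by (auto simp: tends_def)
qed (use tendsD assms closed in auto)

lemma tends_scl:
  assumes "tends s l" shows "tends (\<lambda>n. scl A c (s n)) (scl A c l)"
proof (rule tendsI)
  show "nrm A (scl A c (s n) - scl A c l) \<le> cmod c * nrm A (s n - l)" for n
    using nrm_scl[of "s n - l" c] tendsD assms by (simp add: closed scale_right_diff_distrib)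
  show "(\<lambda>n. cmod c * nrm A (s n - l)) \<longlonglongrightarrow> 0"
    using assms tendsto_mult_right_zero by (auto simp: tends_def)
qed (use tendsD assms closed in auto)

lemma tends_adj:
  assumes "tends s l" shows "tends (\<lambda>n. adj A (s n)) (adj A l)"
proof (rule tendsI)
  note mem = tendsD[OF assms]
  show "nrm A (adj A (s n) - adj A l) \<le> nrm A (s n - l)" for n
    using nrm_adj[of "s n - l"] mem by (simp add: adj_diff closed)
qed (use assms tendsD[OF assms] in \<open>auto simp: tends_def closed\<close>)

lemma tends_nrm:
  assumes "tends s l" shows "(\<lambda>n. nrm A (s n)) \<longlonglongrightarrow> nrm A l"
proof -
  note mem = tendsD[OF assms]
  have "\<bar>nrm A (s n) - nrm A l\<bar> \<le> nrm A (s n - l)" for n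
  proof -
    have "nrm A (s n) \<le> nrm A (s n - l) + nrm A l"
      using nrm_triangle[of "s n - l" l] mem by (simp add: closed)
    moreover have "nrm A l \<le> nrm A (s n - l) + nrm A (s n)"
      using nrm_triangle[of "l - s n" "s n"] mem nrm_minus_commute[OF mem(1)[of n] mem(2)]
      by (simp add: closed)
    ultimately show ?thesis by simp
  qed
  then have "(\<lambda>n. nrm A (s n) - nrm A l) \<longlonglongrightarrow> 0"
    using assms Lim_null_comparison[of "\<lambda>n. nrm A (s n) - nrm A l" "\<lambda>n. nrm A (s n - l)" sequentially]
    unfolding tends_def by simp
  then show ?thesis by (rule LIM_zero_cancel)
qed

lemma tends_mul:
  assumes "tends s l" "tends r k" shows "tends (\<lambda>n. mul A (s n) (r n)) (mul A l k)"
proof (rule tendsI)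
  have mem: "l \<in> elems A" "k \<in> elems A" "\<And>n. s n \<in> elems A" "\<And>n. r n \<in> elems A"
    using assms tendsD by auto
  show "nrm A (mul A (s n) (r n) - mul A l k)
      \<le> nrm A (s n - l) * nrm A (r n) + nrm A l * nrm A (r n - k)" for n
  proof -
    have "mul A (s n) (r n) - mul A l k = mul A (s n - l) (r n) + mul A l (r n - k)"
      using mem by (simp add: mul_diff_left mul_diff_right closed)
    then show ?thesis
      using nrm_triangle[of "mul A (s n - l) (r n)" "mul A l (r n - k)"]
        nrm_mul[of "s n - l" "r n"] nrm_mul[of l "r n - k"] mem by (simp add: closed)
  qed
  have "(\<lambda>n. nrm A (s n - l) * nrm A (r n) + nrm A l * nrm A (r n - k)) \<longlonglongrightarrow> 0 * nrm A k + nrm A l * 0"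
    using assms tends_nrm[OF assms(2)] unfolding tends_def
    by (intro tendsto_add tendsto_mult tendsto_const) auto
  then show "(\<lambda>n. nrm A (s n - l) * nrm A (r n) + nrm A l * nrm A (r n - k)) \<longlonglongrightarrow> 0" by simp
qed (use tendsD assms closed in auto)

lemma Cauchy_tends:
  assumes s: "\<And>n. s n \<in> elems A"
    and le: "\<And>m n. m \<le> n \<Longrightarrow> nrm A (s n - s m) \<le> \<zeta> n - \<zeta> m" and \<zeta>: "Cauchy \<zeta>"
  obtains l where "tends s l"
proof -
  have "\<exists>l\<in>elems A. (\<lambda>n. nrm A (s n - l)) \<longlonglongrightarrow> 0"
  proof (rule complete[OF s])
    fix e :: real assume "e > 0"
    then obtain M where M: "\<forall>m\<ge>M. \<forall>n\<ge>M. norm (\<zeta> m - \<zeta> n) < e"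
      using CauchyD[OF \<zeta>] by meson
    have "nrm A (s m - s n) < e" if mn: "m \<ge> M" "n \<ge> M" for m n
    proof -
      have "norm (\<zeta> m - \<zeta> n) < e" using M mn by blast
      then have "\<zeta> m - \<zeta> n < e" "\<zeta> n - \<zeta> m < e" by (simp_all add: abs_less_iff)
      then show ?thesis
        using le[of m n] le[of n m] nrm_minus_commute[OF s s, of m n] by (cases "m \<le> n") auto
    qed
    then show "\<exists>M. \<forall>m\<ge>M. \<forall>n\<ge>M. nrm A (s m - s n) < e" by blast
  qed
  then obtain l where "l \<in> elems A" "(\<lambda>n. nrm A (s n - l)) \<longlonglongrightarrow> 0" by blast
  then have "tends s l" using s by (auto simp: tends_def)
  then show thesis by (rule that)
qed

end

text \<open>The iteration \<open>z \<mapsto> (u + z\<^sup>2) / 2\<close> converges to a solution of \<open>(1 - z)\<^sup>2 = 1 - u\<close>.  Its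
  instance with the scalar \<open>u = 1\<close> increases to 1 and majorises, step by step, the
  increments of the same iteration in a C*-algebra whenever \<open>\<parallel>u\<parallel> \<le> 1\<close>.\<close>

fun sqrt_majorant :: "nat \<Rightarrow> real" where
  "sqrt_majorant 0 = 0"
| "sqrt_majorant (Suc n) = (1 + (sqrt_majorant n)\<^sup>2) / 2"

lemma sqrt_majorant_bounds: "0 \<le> sqrt_majorant n \<and> sqrt_majorant n \<le> 1 \<and> sqrt_majorant n \<le> sqrt_majorant (Suc n)"
proof (induction n)
  case (Suc n)
  then have "(sqrt_majorant n)\<^sup>2 \<le> 1" "(sqrt_majorant n)\<^sup>2 \<le> (sqrt_majorant (Suc n))\<^sup>2"
    by (auto intro: power_le_one power_mono)
  then show ?case by simp
qed simp

lemma Cauchy_sqrt_majorant: "Cauchy sqrt_majorant"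
proof -
  have "incseq sqrt_majorant" using sqrt_majorant_bounds by (intro incseq_SucI) auto
  moreover have "sqrt_majorant i \<le> 1" for i using sqrt_majorant_bounds by auto
  ultimately show ?thesis using incseq_convergent[of sqrt_majorant 1] LIMSEQ_imp_Cauchy by blast
qed

context cstar_algebra begin

abbreviation commute :: "'a \<Rightarrow> 'a \<Rightarrow> bool" where
  "commute x y \<equiv> mul A x y = mul A y x"

fun sqrt_seq :: "'a \<Rightarrow> nat \<Rightarrow> 'a" where
  "sqrt_seq u 0 = 0"
| "sqrt_seq u (Suc n) = scl A (1/2) (u + mul A (sqrt_seq u n) (sqrt_seq u n))"

lemma commute_mul:
  assumes "x \<in> elems A" "y \<in> elems A" "z \<in> elems A" "commute z x" "commute z y"
  shows "commute z (mul A x y)"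
  using assms by (metis mul_assoc)

lemma commute_tends:
  assumes "tends s l" "y \<in> elems A" "\<And>n. commute y (s n)"
  shows "commute y l"
proof -
  have "tends (\<lambda>n. mul A (s n) y) (mul A y l)"
    using tends_mul[OF tends_const[OF assms(2)] assms(1)] assms(3) by simp
  then show ?thesis using tends_mul[OF assms(1) tends_const[OF assms(2)]] tends_unique by blast
qed

text \<open>Square roots without spectral theory.  The boundary case \<open>\<parallel>u\<parallel> = 1\<close> is included: the scalar
  majorant still converges there.  The bound on \<open>z\<close> makes the construction iterable, since the root
  \<open>e - z\<close> is again of the form to which the lemma applies.\<close>

lemma sqrt_exists:
  assumes u: "u \<in> elems A" "adj A u = u" "nrm A u \<le> 1" and e: "is_unit_of A e"
  obtains z where "z \<in> elems A" "adj A z = z" "nrm A z \<le> 1"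
    "mul A (e - z) (e - z) = e - u" "\<And>y. \<lbrakk>y \<in> elems A; commute y u\<rbrakk> \<Longrightarrow> commute y z"
proof -
  let ?z = "sqrt_seq u"
  have mem: "?z n \<in> elems A" for n by (induction n) (auto simp: closed u)
  have comm: "commute y (?z n)" if "y \<in> elems A" "commute y u" for y n
  proof (induction n)
    case (Suc n)
    then show ?case using that commute_mul[OF mem mem that(1)]
      by (simp add: mul_scl_left mul_scl_right mul_add_left mul_add_right closed mem u)
  qed (use that in \<open>simp add: mul_zero_left mul_zero_right\<close>)
  have adj: "adj A (?z n) = ?z n" for n
    by (induction n) (simp_all add: adj_zero adj_scl adj_add adj_mul mem closed u)
  have cz: "commute (?z m) (?z n)" for m n
    using comm[of "?z m" n] comm[of u m] u mem by simp
  have bnd: "nrm A (?z n) \<le> sqrt_majorant n" for n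
  proof (induction n)
    case (Suc n)
    have "nrm A (mul A (?z n) (?z n)) \<le> sqrt_majorant n * sqrt_majorant n"
      using nrm_mul[OF mem mem, of n n] mult_mono[OF Suc Suc] nrm_nonneg mem
        sqrt_majorant_bounds[of n] by fastforce
    then have "nrm A (u + mul A (?z n) (?z n)) \<le> 1 + sqrt_majorant n * sqrt_majorant n"
      using nrm_triangle[of u "mul A (?z n) (?z n)"] u by (simp add: closed mem)
    then show ?case by (simp add: nrm_scl closed mem u power2_eq_square)
  qed (simp add: nrm_zero)
  have step: "nrm A (?z (Suc n) - ?z n) \<le> sqrt_majorant (Suc n) - sqrt_majorant n" for n
  proof (induction n)
    case 0
    then show ?case using u by (simp add: nrm_zero mul_zero_left closed nrm_scl)
  next
    case (Suc n)
    have "?z (Suc (Suc n)) - ?z (Suc n) =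
        scl A (1/2) (mul A (?z (Suc n)) (?z (Suc n)) - mul A (?z n) (?z n))"
      unfolding sqrt_seq.simps(2)[of u "Suc n"]  sqrt_seq.simps(2)[of u "n"]
      by (simp flip: scale_right_diff_distrib del: sqrt_seq.simps)
    also have "mul A (?z (Suc n)) (?z (Suc n)) - mul A (?z n) (?z n) =
        mul A (?z (Suc n) - ?z n) (?z (Suc n) + ?z n)"
      using cz[of n "Suc n"] by (simp add: mul_diff_left mul_add_right mem closed del: sqrt_seq.simps)
    finally have "nrm A (?z (Suc (Suc n)) - ?z (Suc n))
        \<le> (1/2) * (nrm A (?z (Suc n) - ?z n) * nrm A (?z (Suc n) + ?z n))"
      using nrm_mul[of "?z (Suc n) - ?z n" "?z (Suc n) + ?z n"]
      by (simp add: nrm_scl closed mem del: sqrt_seq.simps)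
    also have "\<dots> \<le> (1/2) * ((sqrt_majorant (Suc n) - sqrt_majorant n) * (sqrt_majorant (Suc n) + sqrt_majorant n))"
    proof (intro mult_left_mono mult_mono)
      show "nrm A (?z (Suc n) + ?z n) \<le> sqrt_majorant (Suc n) + sqrt_majorant n"
        using nrm_triangle[OF mem mem, of "Suc n" n] bnd[of n] bnd[of "Suc n"] by linarith
      show "0 \<le> nrm A (?z (Suc n) + ?z n)" by (intro nrm_nonneg closed mem)
    qed (use Suc sqrt_majorant_bounds[of n] in auto)
    also have "\<dots> = sqrt_majorant (Suc (Suc n)) - sqrt_majorant (Suc n)"
      by (simp add: power2_eq_square algebra_simps)
    finally show ?case .
  qed
  have "nrm A (?z n - ?z m) \<le> sqrt_majorant n - sqrt_majorant m" if "m \<le> n" for m n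
    using that
  proof (induction n rule: dec_induct)
    case (step n)
    then show ?case using nrm_triangle_sub[OF mem[of "Suc n"] mem[of n] mem[of m]] \<open>\<And>n. nrm A (?z (Suc n) - ?z n) \<le> _\<close>[of n]
      by linarith
  qed (simp add: nrm_zero)
  then obtain z where z: "tends ?z z"
    using Cauchy_tends[of ?z sqrt_majorant] mem Cauchy_sqrt_majorant by blast
  note z' = tendsD(2)[OF z]
  have "tends (\<lambda>n. ?z (Suc n)) z"
    using z LIMSEQ_Suc[of "\<lambda>n. nrm A (?z n - z)"] by (auto simp: tends_def mem simp del: sqrt_seq.simps)
  moreover have "tends (\<lambda>n. ?z (Suc n)) (scl A (1/2) (u + mul A z z))"
    unfolding sqrt_seq.simps by (intro tends_scl tends_add tends_mul z tends_const u)
  ultimately have "z = scl A (1/2) (u + mul A z z)" using tends_unique by blast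
  then have "scl A 2 z = scl A 2 (scl A (1/2) (u + mul A z z))" by simp
  then have fixp: "z + z = u + mul A z z"
    using scale_left_distrib[of 1 1 z] by simp
  have e': "e \<in> elems A" "\<And>x. x \<in> elems A \<Longrightarrow> mul A e x = x" "\<And>x. x \<in> elems A \<Longrightarrow> mul A x e = x"
    using e by (auto simp: is_unit_of_def)
  show thesis
  proof
    show "z \<in> elems A" by fact
    show "adj A z = z" using tends_unique[OF tends_adj[OF z]] z adj by simp
    show "nrm A z \<le> 1"
      using tends_nrm[OF z] bnd sqrt_majorant_bounds by (intro LIMSEQ_le_const2) (auto intro: order_trans)
    have "mul A (e - z) (e - z) = e - (z + z) + mul A z z"
      using e' z' by (simp add: mul_diff_left mul_diff_right closed algebra_simps)
    then show "mul A (e - z) (e - z) = e - u" by (simp add: fixp)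
    show "commute y z" if "y \<in> elems A" "commute y u" for y
      using commute_tends[OF z that(1)] comm[OF that] by blast
  qed
qed

end

section \<open>Unitary dilations, homomorphisms and states\<close>

context cstar_algebra begin

lemma unitD:
  assumes "is_unit_of A e"
  shows "e \<in> elems A" "\<And>x. x \<in> elems A \<Longrightarrow> mul A e x = x" "\<And>x. x \<in> elems A \<Longrightarrow> mul A x e = x"
    "adj A e = e" "nrm A e \<le> 1"
proof -
  show *: "e \<in> elems A" "\<And>x. x \<in> elems A \<Longrightarrow> mul A e x = x" "\<And>x. x \<in> elems A \<Longrightarrow> mul A x e = x"
    using assms by (auto simp: is_unit_of_def)
  show "adj A e = e" using *(2)[of "adj A e"] * adj_mul[of "adj A e" e] adj_adj by (metis adj_closed)
  then have "(nrm A e)\<^sup>2 = nrm A e" using cstar_identity[of e] * by simp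
  then show "nrm A e \<le> 1" by (auto simp: power2_eq_square)
qed

text \<open>For commuting self-adjoint elements the imaginary cross terms cancel.  Together with the
  C*-identity this turns a relation \<open>x\<^sup>2 + y\<^sup>2 = c\<close> into norm bounds for \<open>x\<close> and \<open>y\<close>.\<close>

lemma cartesian_square:
  assumes "x \<in> elems A" "y \<in> elems A" "adj A x = x" "adj A y = y" "commute x y"
  shows "mul A (adj A (x + scl A \<i> y)) (x + scl A \<i> y) = mul A x x + mul A y y"
  using assms
  by (simp add: adj_add adj_scl closed mul_add_left mul_add_right mul_scl_left mul_scl_right
      mul_diff_left mul_diff_right algebra_simps)

lemma cartesian_real_part:
  assumes "x \<in> elems A" "y \<in> elems A" "adj A x = x" "adj A y = y"
  shows "x = scl A (1/2) ((x + scl A \<i> y) + adj A (x + scl A \<i> y))"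
    and "y = scl A (1/(2*\<i>)) ((x + scl A \<i> y) - adj A (x + scl A \<i> y))"
proof -
  have "(x + scl A \<i> y) + adj A (x + scl A \<i> y) = scl A 2 x"
    using assms scale_left_distrib[of 1 1 x] by (simp add: adj_add adj_scl closed)
  then show "x = scl A (1/2) ((x + scl A \<i> y) + adj A (x + scl A \<i> y))" by simp
  have "(x + scl A \<i> y) - adj A (x + scl A \<i> y) = scl A (2*\<i>) y"
    using assms scale_left_distrib[of "\<i>" "\<i>" y] by (simp add: adj_add adj_scl closed)
  then show "y = scl A (1/(2*\<i>)) ((x + scl A \<i> y) - adj A (x + scl A \<i> y))" by simp
qed

text \<open>Take \<open>w\<close> to be a square root of \<open>e - h\<^sup>2\<close>, so that \<open>h + i w\<close> is unitary.  As the imaginary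
  part of a unitary, \<open>w\<close> has norm at most one; this takes the place of positivity of
  \<open>e - h\<^sup>2\<close> in norm estimates.\<close>

lemma unitary_dilation:
  assumes h: "h \<in> elems A" "adj A h = h" "nrm A h < 1" and e: "is_unit_of A e"
  obtains w where "w \<in> elems A" "adj A w = w" "nrm A w \<le> 1" "mul A h h + mul A w w = e"
    "commute h w"
    "\<And>y. \<lbrakk>y \<in> elems A; commute y h\<rbrakk> \<Longrightarrow> commute y w"
proof -
  note e' = unitD[OF e]
  have hh: "mul A h h \<in> elems A" "adj A (mul A h h) = mul A h h" by (simp_all add: h closed adj_mul)
  have "nrm A (mul A h h) \<le> 1"
    using cstar_identity[OF h(1)] h nrm_nonneg[OF h(1)] by (simp add: power_le_one)
  then obtain z where z: "z \<in> elems A" "adj A z = z"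
    "mul A (e - z) (e - z) = e - mul A h h"
    "\<And>y. \<lbrakk>y \<in> elems A; commute y (mul A h h)\<rbrakk> \<Longrightarrow> commute y z"
    using sqrt_exists[OF hh _ e] by metis
  define w where "w = e - z"
  have w: "w \<in> elems A" "adj A w = w" "mul A h h + mul A w w = e"
    using z e' by (simp_all add: w_def closed adj_diff)
  have comm: "commute y w" if "y \<in> elems A" "commute y h" for y
    using z(4)[OF that(1)] commute_mul[OF h(1) h(1) that(1) that(2) that(2)] z e' that
    by (simp add: w_def mul_diff_left mul_diff_right)
  let ?v = "h + scl A \<i> w"
  have v: "?v \<in> elems A" using h w by (simp add: closed)
  have "(nrm A ?v)\<^sup>2 \<le> 1"
    using cartesian_square[OF h(1) w(1) h(2) w(2)] comm[OF h(1)] w(3) cstar_identity[OF v] e' by simp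
  then have "nrm A ?v \<le> 1" using power_le_one_iff[of "nrm A ?v" 2] nrm_nonneg[OF v] by simp
  then have "nrm A (?v - adj A ?v) \<le> 2"
    using nrm_diff[OF v adj_closed[OF v]] nrm_adj[OF v] by simp
  then have "nrm A w \<le> 1"
    using cartesian_real_part(2)[OF h(1) w(1) h(2) w(2)] nrm_scl[of "?v - adj A ?v" "1/(2*\<i>)"] v
    by (simp add: closed norm_mult norm_divide)
  then show thesis using that w comm h by blast
qed

text \<open>After scaling \<open>h\<close> to norm less than one, \<open>w\<^sup>2 = e - h\<^sup>2\<close> has norm at most one by the unitary
  dilation.  Hence \<open>h\<^sup>2 = e - w\<^sup>2\<close> has a square root \<open>q\<close>, and \<open>q\<close> has a square root \<open>r\<close>.  So
  \<open>q\<close> plays the role of \<open>\<bar>h\<bar>\<close>, and \<open>r\<close> witnesses that it is positive.\<close>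

lemma abs_and_root_exist:
  assumes h: "h \<in> elems A" "adj A h = h" and e: "is_unit_of A e"
  obtains q r where "q \<in> elems A" "r \<in> elems A" "adj A q = q" "adj A r = r"
    "mul A q q = mul A h h" "mul A r r = q"
    "\<And>y. \<lbrakk>y \<in> elems A; commute y h\<rbrakk> \<Longrightarrow> commute y q"
    "\<And>y. \<lbrakk>y \<in> elems A; commute y h\<rbrakk> \<Longrightarrow> commute y r"
proof -
  note e' = unitD[OF e]
  \<comment> \<open>The dilation needs norm strictly less than one.\<close>
  define c where "c = nrm A h + 1"
  have c: "c > 0" "nrm A h < c" using nrm_nonneg[OF h(1)] by (auto simp: c_def)
  define g where "g = scl A (of_real (1/c)) h"
  have g: "g \<in> elems A" "adj A g = g" "nrm A g < 1"
    using h c by (auto simp: g_def closed adj_scl nrm_scl divide_less_eq norm_divide)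
  obtain w where w: "w \<in> elems A" "adj A w = w" "nrm A w \<le> 1" "mul A g g + mul A w w = e"
    "\<And>y. \<lbrakk>y \<in> elems A; commute y g\<rbrakk> \<Longrightarrow> commute y w"
    using unitary_dilation[OF g e] by metis
  have ww: "mul A w w \<in> elems A" "adj A (mul A w w) = mul A w w" "nrm A (mul A w w) \<le> 1"
    using w cstar_identity[OF w(1)] nrm_nonneg[OF w(1)] by (simp_all add: closed adj_mul power_le_one)
  obtain z where z: "z \<in> elems A" "adj A z = z" "nrm A z \<le> 1"
    "mul A (e - z) (e - z) = e - mul A w w"
    "\<And>y. \<lbrakk>y \<in> elems A; commute y (mul A w w)\<rbrakk> \<Longrightarrow> commute y z"
    using sqrt_exists[OF ww e] by metis
  obtain z' where z': "z' \<in> elems A" "adj A z' = z'"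
    "mul A (e - z') (e - z') = e - z"
    "\<And>y. \<lbrakk>y \<in> elems A; commute y z\<rbrakk> \<Longrightarrow> commute y z'"
    using sqrt_exists[OF z(1-3) e] by metis
  have comm_g: "commute y g" if "y \<in> elems A" "commute y h" for y
    using that h by (simp add: g_def mul_scl_left mul_scl_right)
  have comm_z: "commute y z" if "y \<in> elems A" "commute y h" for y
    using comm_g[OF that] w(5)[OF that(1)] z(5)[OF that(1)] commute_mul[OF w(1) w(1) that(1)] by blast
  define q where "q = scl A (of_real c) (e - z)"
  define r where "r = scl A (of_real (sqrt c)) (e - z')"
  have gg: "mul A (e - z) (e - z) = mul A g g" using z(4) w(4) by (metis add_diff_cancel_right')
  show thesis
  proof
    show "q \<in> elems A" "r \<in> elems A" "adj A q = q" "adj A r = r"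
      using z z' e' by (auto simp: q_def r_def closed adj_scl adj_diff)
    show "mul A q q = mul A h h"
    proof -
      have "mul A q q = scl A (of_real c * of_real c) (mul A g g)"
        using z(1) e' by (simp add: q_def mul_scl_left mul_scl_right closed gg)
      also have "\<dots> = mul A h h" using h c by (simp add: g_def mul_scl_left mul_scl_right closed)
      finally show ?thesis .
    qed
    have "complex_of_real (sqrt c) * complex_of_real (sqrt c) = complex_of_real c"
      using c by (simp flip: of_real_mult)
    then show "mul A r r = q"
      using z' e' by (simp add: q_def r_def mul_scl_left mul_scl_right closed)
    show "commute y q" if "y \<in> elems A" "commute y h" for y
      using comm_z[OF that] that z e'
      by (simp add: q_def mul_scl_left mul_scl_right mul_diff_left mul_diff_right closed)
    show "commute y r" if "y \<in> elems A" "commute y h" for y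
      using z'(4)[OF that(1) comm_z[OF that]] that z' e'
      by (simp add: r_def mul_scl_left mul_scl_right mul_diff_left mul_diff_right closed)
  qed
qed

lemma le_nrm_if_scaled:
  assumes x: "x \<in> elems A" and "\<And>c. \<lbrakk>c > 0; nrm A (scl A (of_real c) x) < 1\<rbrakk> \<Longrightarrow> c * v \<le> 1"
  shows "v \<le> nrm A x"
proof (rule field_le_epsilon)
  fix d :: real assume d: "d > 0"
  have n: "0 \<le> nrm A x" by (rule nrm_nonneg[OF x])
  have "1 / (nrm A x + d) * v \<le> 1"
    using d n x by (intro assms(2)) (auto simp: nrm_scl norm_divide divide_less_eq simp flip: of_real_add)
  then show "v \<le> nrm A x + d" using d n by (simp add: divide_le_eq)
qed

end

lemma star_homD:
  assumes "star_hom A B f"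
  shows "\<And>x. x \<in> elems A \<Longrightarrow> f x \<in> elems B"
    "\<And>x y. \<lbrakk>x \<in> elems A; y \<in> elems A\<rbrakk> \<Longrightarrow> f (x + y) = f x + f y"
    "\<And>c x. x \<in> elems A \<Longrightarrow> f (scl A c x) = scl B c (f x)"
    "\<And>x y. \<lbrakk>x \<in> elems A; y \<in> elems A\<rbrakk> \<Longrightarrow> f (mul A x y) = mul B (f x) (f y)"
    "\<And>x. x \<in> elems A \<Longrightarrow> f (adj A x) = adj B (f x)"
  using assms by (auto simp: star_hom_def linear_map_on_def)

text \<open>A self-adjoint \<open>h\<close> of norm less than one is the real part of a unitary; the image of the
  unitary is a partial isometry, hence of norm at most one, and so is its real part.  The C*-identity
  reduces general elements to self-adjoint ones.\<close>

lemma star_hom_contractive: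
  assumes A: "cstar_algebra A" and B: "cstar_algebra B" and e: "is_unit_of A e" and f: "star_hom A B f"
    and x: "x \<in> elems A"
  shows "nrm B (f x) \<le> nrm A x"
proof -
  interpret A: cstar_algebra A by fact
  interpret B: cstar_algebra B by fact
  note f' = star_homD[OF f] and e' = A.unitD[OF e]
  have fe: "nrm B (f e) \<le> 1"
  proof -
    have "(nrm B (f e))\<^sup>2 = nrm B (f e)"
      using B.cstar_identity[of "f e"] f' e' by (metis)
    then show ?thesis by (auto simp: power2_eq_square)
  qed
  have 1: "nrm B (f h) \<le> 1" if h: "h \<in> elems A" "adj A h = h" "nrm A h < 1" for h
  proof -
    obtain w where w: "w \<in> elems A" "adj A w = w" "mul A h h + mul A w w = e" "mul A h w = mul A w h"
      using A.unitary_dilation[OF h e] by metis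
    let ?v = "h + scl A \<i> w"
    have v: "?v \<in> elems A" using h w by (simp add: A.closed)
    have "mul B (adj B (f ?v)) (f ?v) = f e"
      using A.cartesian_square[OF h(1) w(1) h(2) w(2) w(4)] w(3) f' v by (metis A.adj_closed)
    then have "(nrm B (f ?v))\<^sup>2 \<le> 1" using B.cstar_identity[of "f ?v"] f'(1)[OF v] fe by simp
    then have "nrm B (f ?v) \<le> 1"
      using power_le_one_iff[of "nrm B (f ?v)" 2] B.nrm_nonneg f'(1)[OF v] by simp
    moreover have "f h = scl B (1/2) (f ?v + adj B (f ?v))"
      using A.cartesian_real_part(1)[OF h(1) w(1) h(2) w(2)] f' v by (metis A.adj_closed A.add_closed)
    ultimately show ?thesis
      using B.nrm_triangle[of "f ?v" "adj B (f ?v)"] B.nrm_adj[of "f ?v"] f'(1)[OF v]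
      by (simp add: B.nrm_scl B.closed norm_divide)
  qed
  have 2: "nrm B (f h) \<le> nrm A h" if h: "h \<in> elems A" "adj A h = h" for h
    using h 1[of "scl A (of_real c) h" for c]
    by (intro A.le_nrm_if_scaled)
      (fastforce simp: A.closed A.adj_scl f' B.nrm_scl A.nrm_scl)+
  have "(nrm B (f x))\<^sup>2 \<le> (nrm A x)\<^sup>2"
    using 2[of "mul A (adj A x) x"] x f' A.cstar_identity[OF x] B.cstar_identity[of "f x"]
    by (simp add: A.closed A.adj_mul A.adj_adj)
  then show ?thesis by (rule power2_le_imp_le[OF _ A.nrm_nonneg[OF x]])
qed

text \<open>By the Cauchy--Schwarz inequality, which is positivity of \<open>\<rho>\<close> at \<open>y\<^sup>* y\<close> with \<open>y = x - \<rho>(x) e\<close>,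
  it suffices to bound \<open>\<rho>(x\<^sup>* x)\<close>.  If \<open>c x\<^sup>* x\<close> has norm less than one, then
  \<open>e - c x\<^sup>* x\<close> is a square, so \<open>\<rho>\<close> is nonnegative there.\<close>

lemma state_bounded:
  assumes A: "cstar_algebra A" and \<rho>: "state A \<rho>" and x: "x \<in> elems A"
  shows "cmod (\<rho> x) \<le> nrm A x"
proof -
  interpret A: cstar_algebra A by fact
  obtain e where e: "is_unit_of A e" "\<rho> e = 1" using \<rho> by (auto simp: state_def)
  note e' = A.unitD[OF e(1)]
  have lin: "\<And>x y. \<lbrakk>x \<in> elems A; y \<in> elems A\<rbrakk> \<Longrightarrow> \<rho> (x + y) = \<rho> x + \<rho> y"
    "\<And>c x. x \<in> elems A \<Longrightarrow> \<rho> (scl A c x) = c * \<rho> x"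
    and pos: "\<And>x. x \<in> elems A \<Longrightarrow> \<rho> (mul A (adj A x) x) \<in> \<real>\<^sub>\<ge>\<^sub>0"
    using \<rho> by (auto simp: state_def linear_map_on_def)
  have exp: "\<rho> (mul A (adj A (x + scl A c e)) (x + scl A c e)) =
      \<rho> (mul A (adj A x) x) + c * \<rho> (adj A x) + cnj c * \<rho> x + cnj c * c" for c
    using x e' by (simp add: A.adj_add A.adj_scl A.closed A.mul_add_left A.mul_add_right
        A.mul_scl_left A.mul_scl_right lin e algebra_simps)
  have pos': "\<rho> (mul A (adj A x) x) + c * \<rho> (adj A x) + cnj c * \<rho> x + cnj c * c \<in> \<real>\<^sub>\<ge>\<^sub>0" for c
    using pos[of "x + scl A c e"] exp[of c] x e' by (simp add: A.closed)
  have r0: "Im (\<rho> (mul A (adj A x) x)) = 0"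
    using pos[OF x] by (simp add: complex_nonneg_Reals_iff)
  have herm: "\<rho> (adj A x) = cnj (\<rho> x)"
    using pos'[of 1] pos'[of \<i>] r0 by (auto simp: complex_nonneg_Reals_iff complex_eq_iff)
  have "\<rho> (mul A (adj A x) x) - \<rho> x * cnj (\<rho> x) \<in> \<real>\<^sub>\<ge>\<^sub>0"
    using pos'[of "- \<rho> x"] by (simp add: herm algebra_simps)
  then have cs: "(cmod (\<rho> x))\<^sup>2 \<le> Re (\<rho> (mul A (adj A x) x))"
    by (simp add: complex_nonneg_Reals_iff complex_mult_cnj flip: cmod_power2)
  have "Re (\<rho> (mul A (adj A x) x)) \<le> nrm A (mul A (adj A x) x)"
  proof (rule A.le_nrm_if_scaled)
    fix c :: real assume c: "c > 0" and lt: "nrm A (scl A (of_real c) (mul A (adj A x) x)) < 1"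
    let ?y = "scl A (of_real c) (mul A (adj A x) x)"
    have y: "?y \<in> elems A" "adj A ?y = ?y" using x by (simp_all add: A.closed A.adj_scl A.adj_mul A.adj_adj)
    obtain z where z: "z \<in> elems A" "adj A z = z" "mul A (e - z) (e - z) = e - ?y"
      using A.sqrt_exists[OF y _ e(1)] lt by auto
    have "\<rho> (e - ?y) \<in> \<real>\<^sub>\<ge>\<^sub>0"
      using pos[of "e - z"] z e' by (simp add: A.closed A.adj_diff)
    moreover have "\<rho> e = \<rho> (e - ?y) + \<rho> ?y" using lin(1)[of "e - ?y" ?y] y e' by (simp add: A.closed)
    ultimately show "c * Re (\<rho> (mul A (adj A x) x)) \<le> 1"
      using x by (simp add: complex_nonneg_Reals_iff lin A.closed e complex_eq_iff)
  qed (use x in \<open>simp add: A.closed\<close>)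
  with cs have "(cmod (\<rho> x))\<^sup>2 \<le> (nrm A x)\<^sup>2" using A.cstar_identity[OF x] by simp
  then show ?thesis by (rule power2_le_imp_le[OF _ A.nrm_nonneg[OF x]])
qed

section \<open>Adjoints on a Hilbert space; faithful representations are isometric\<close>

lemma cinner_add_right: "cinner x (y + z) = cinner x y + cinner x z"
  using cinner_commute cinner_add_left by (metis complex_cnj_add)

lemma cinner_scaleC_right: "cinner x (scaleC c y) = cnj c * cinner x y"
  using cinner_commute cinner_scaleC_left by (metis complex_cnj_mult)

lemma cinner_zero_left [simp]: "cinner 0 y = 0"
  using cinner_add_left[of 0 0 y] by simp

lemma cinner_zero_right [simp]: "cinner y 0 = 0"
  using cinner_add_right[of y 0 0] by simp

lemma cinner_minus_left: "cinner (- x) y = - cinner x y"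
  using cinner_add_left[of x "- x" y] minus_unique[of "cinner x y" "cinner (- x) y"] by simp

lemma cinner_minus_right: "cinner x (- y) = - cinner x y"
  using cinner_add_right[of x y "- y"] minus_unique[of "cinner x y" "cinner x (- y)"] by simp

lemma cinner_diff_left: "cinner (x - y) z = cinner x z - cinner y z"
  using cinner_add_left[of x "- y" z] by (simp add: cinner_minus_left)

lemma cinner_diff_right: "cinner x (y - z) = cinner x y - cinner x z"
  using cinner_add_right[of x "y - z" z] by simp

lemma Re_cinner_commute: "Re (cinner x y) = Re (cinner y x)"
  using cinner_commute[of x y] by simp

lemma norm_add_sq: "(norm (x + y))\<^sup>2 = (norm x)\<^sup>2 + (norm y)\<^sup>2 + 2 * Re (cinner x y)"
proof -
  have "complex_of_real ((norm (x + y))\<^sup>2) = cinner x x + cinner y y + (cinner x y + cinner y x)"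
    unfolding cinner_self[symmetric] by (simp add: cinner_add_left cinner_add_right)
  then have "Re (complex_of_real ((norm (x + y))\<^sup>2)) = Re (cinner x x + cinner y y + (cinner x y + cinner y x))"
    by (rule arg_cong)
  then show ?thesis using Re_cinner_commute[of x y] by (simp add: cinner_self)
qed

lemma cinner_scaleR_left: "cinner (scaleR r x) y = of_real r * cinner x y"
  by (metis cinner_scaleC_left scaleC_of_real)

lemma cinner_scaleR_right: "cinner x (scaleR r y) = of_real r * cinner x y"
  using cinner_scaleC_right[of x "of_real r" y] by (simp add: scaleC_of_real)

lemma parallelogram:
  fixes x y :: "'h::complex_hilbert_space"
  shows "(norm (x + y))\<^sup>2 + (norm (x - y))\<^sup>2 = 2 * (norm x)\<^sup>2 + 2 * (norm y)\<^sup>2"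
  using norm_add_sq[of x y] norm_add_sq[of x "- y"] cinner_minus_left[of y x]
    Re_cinner_commute[of x y] Re_cinner_commute[of x "-y"] by simp

lemma cinner_eqI:
  assumes "\<And>x. cinner x y = cinner x z" shows "y = z"
  using assms[of "y - z"] cinner_self[of "y - z"] by (simp add: cinner_diff_right)

lemma Re_cinner_le: "Re (cinner x y) \<le> norm x * norm y"
proof (cases "y = 0")
  case False
  define a where "a = norm x"
  define b where "b = norm y"
  have b: "b > 0" using False by (simp add: b_def)
  have "0 \<le> (norm (scaleR b x + scaleR (- a) y))\<^sup>2" by simp
  also have "\<dots> = (b * a)\<^sup>2 + (a * b)\<^sup>2 - 2 * b * a * Re (cinner x y)"
    unfolding norm_add_sq by (simp add: cinner_scaleR_left cinner_scaleR_right a_def b_def cinner_minus_left cinner_minus_right)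
  finally have "0 \<le> 2 * (b * a) * (a * b - Re (cinner x y))"
    by (simp add: power2_eq_square algebra_simps)
  then show ?thesis
  proof (cases "a = 0")
    case True
    then have "x = 0" by (simp add: a_def)
    then show ?thesis by simp
  next
    case False
    then have "a > 0" by (simp add: a_def)
    with b have "0 < 2 * (b * a)" by simp
    with \<open>0 \<le> 2 * (b * a) * (a * b - Re (cinner x y))\<close> have "0 \<le> a * b - Re (cinner x y)"
      by (simp only: zero_le_mult_iff) auto
    then show ?thesis by (simp add: a_def b_def)
  qed
qed simp

text \<open>The representing vector minimises \<open>\<parallel>x\<parallel>\<^sup>2 - 2 f(x)\<close>: by the parallelogram law every
  minimising sequence is Cauchy, and the first variation at the minimum is the assertion.\<close>

lemma riesz_real:
  fixes f :: "'h::complex_hilbert_space \<Rightarrow> real"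
  assumes f: "bounded_linear f"
  obtains z where "\<And>x. f x = Re (cinner x z)"
proof -
  interpret f: bounded_linear f by fact
  obtain K where K: "\<And>x. \<bar>f x\<bar> \<le> norm x * K" using f.bounded by auto
  define g where "g x = (norm x)\<^sup>2 - 2 * f x" for x
  have gK: "- K\<^sup>2 \<le> g x" for x
  proof -
    have "0 \<le> (norm x - K)\<^sup>2" by simp
    then show ?thesis using K[of x] by (simp add: g_def power2_eq_square algebra_simps abs_le_iff)
  qed
  define m where "m = Inf (range g)"
  have bdd: "bdd_below (range g)" using gK by (intro bdd_belowI[of _ "- K\<^sup>2"]) auto
  have m: "m \<le> g x" for x unfolding m_def using bdd by (intro cInf_lower) auto
  define r where "r n = 1 / real (Suc n)" for n
  have "\<exists>x. g x < m + r n" for n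
  proof -
    have "m < m + r n" by (simp add: r_def)
    then show ?thesis unfolding m_def using cInf_less_iff[OF _ bdd] by (metis UNIV_not_empty image_is_empty rangeE)
  qed
  then obtain s where s: "\<And>n. g (s n) < m + r n" by metis
  have mid: "(norm (x - y))\<^sup>2 \<le> 2 * (g x - m) + 2 * (g y - m)" for x y
  proof -
    \<comment> \<open>The midpoint of \<open>x\<close> and \<open>y\<close> does not beat the infimum.\<close>
    have "4 * m \<le> 4 * g (scaleR (1/2) (x + y))" using m by simp
    also have "\<dots> = (norm (x + y))\<^sup>2 - 4 * (f x + f y)"
    proof -
      have "(norm (scaleR (1/2) w))\<^sup>2 = (norm w)\<^sup>2 / 4" for w :: 'h
        by (simp add: power_divide)
      then show ?thesis by (simp only: g_def f.scaleR f.add) (simp add: field_simps)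
    qed
    finally show ?thesis using parallelogram[of x y] by (simp add: g_def)
  qed
  have "Cauchy s"
  proof (rule CauchyI)
    fix e :: real assume e: "e > 0"
    then obtain N where N: "r N < e\<^sup>2 / 4"
      using nat_approx_posE[of "e\<^sup>2 / 4"] by (auto simp: zero_less_power r_def)
    have "norm (s i - s j) < e" if "N \<le> i" "N \<le> j" for i j
    proof -
      have "r i \<le> r N" "r j \<le> r N"
        using that by (auto simp: r_def frac_le)
      moreover have "g (s i) - m < r i" "g (s j) - m < r j" using s[of i] s[of j] by simp_all
      ultimately have "2 * (g (s i) - m) + 2 * (g (s j) - m) < 4 * r N" by simp
      then have "(norm (s i - s j))\<^sup>2 < 4 * r N" using mid[of "s i" "s j"] by (rule order_le_less_trans[rotated])
      also have "4 * r N < e\<^sup>2" using N by simp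
      finally have "(norm (s i - s j))\<^sup>2 < e\<^sup>2" .
      then show ?thesis using e power_less_imp_less_base[of "norm (s i - s j)" 2 e] by simp
    qed
    then show "\<exists>M. \<forall>i\<ge>M. \<forall>j\<ge>M. norm (s i - s j) < e" by blast
  qed
  then obtain z where z: "s \<longlonglongrightarrow> z" using Cauchy_convergent convergent_def by blast
  have "(\<lambda>n. g (s n)) \<longlonglongrightarrow> g z"
    unfolding g_def by (intro tendsto_intros z f.tendsto)
  moreover have "(\<lambda>n. m + r n) \<longlonglongrightarrow> m + 0"
    unfolding r_def by (intro tendsto_add tendsto_const lim_1_over_n[THEN LIMSEQ_Suc])
  ultimately have gz: "g z \<le> m" using s by (intro LIMSEQ_le[of _ "g z" _ m]) (auto intro: less_imp_le)
  have "f x = Re (cinner x z)" for x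
  proof -
    define b where "b = Re (cinner x z) - f x"
    have 1: "0 \<le> t\<^sup>2 * (norm x)\<^sup>2 + 2 * t * b" for t
    proof -
      have "g z \<le> g (z + scaleR t x)" using gz m order_trans by blast
      then show ?thesis
        using norm_add_sq[of z "scaleR t x"] Re_cinner_commute[of x z]
        by (simp add: g_def f.add f.scaleR cinner_scaleR_right b_def power_mult_distrib algebra_simps)
    qed
    have "b = 0"
    proof (rule ccontr)
      assume "b \<noteq> 0"
      define c where "c = (norm x)\<^sup>2 + 1"
      have c: "c > 0" "(norm x)\<^sup>2 < c" by (auto simp: c_def add_nonneg_pos)
      have "0 \<le> (-(b/c))\<^sup>2 * (norm x)\<^sup>2 + 2 * (-(b/c)) * b" by (rule 1)
      also have "\<dots> \<le> (b/c)\<^sup>2 * c - 2 * (b/c) * b"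
        using c by (simp add: mult_left_mono)
      also have "\<dots> = - (b\<^sup>2 / c)" using c by (simp add: power2_eq_square field_simps)
      finally show False using \<open>b \<noteq> 0\<close> c by (simp add: divide_le_0_iff)
    qed
    then show ?thesis by (simp add: b_def)
  qed
  then show thesis by (rule that)
qed

text \<open>The adjoint of an operator is defined by a definite description; Riesz representation shows
  that the described operator exists.\<close>

lemma adjoint_exists:
  assumes S: "S \<in> elems (bounded_operators :: ('h::complex_hilbert_space \<Rightarrow> 'h) star_struct)"
  shows "cinner (S x) y = cinner x (adj bounded_operators S y)"
proof -
  have S': "bounded_linear S" and SC: "\<And>c x. S (scaleC c x) = scaleC c (S x)"
    using S by (auto simp: bounded_operators_def)
  interpret S: bounded_linear S by fact
  obtain K where K: "\<And>x. norm (S x) \<le> norm x * K" "K \<ge> 0" using S.nonneg_bounded by auto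
  have "\<exists>z. \<forall>x. cinner (S x) y = cinner x z" for y
  proof -
    have "bounded_linear (\<lambda>x. Re (cinner (S x) y))"
    proof (rule bounded_linear_intro)
      fix x
      have "\<bar>Re (cinner (S x) y)\<bar> \<le> norm (S x) * norm y"
        using Re_cinner_le[of "S x" y] Re_cinner_le[of "- S x" y] by (simp add: abs_le_iff cinner_minus_left)
      also have "\<dots> \<le> norm x * K * norm y" using K by (intro mult_right_mono) auto
      finally show "norm (Re (cinner (S x) y)) \<le> norm x * (K * norm y)" by (simp add: mult.assoc)
    qed (auto simp: S.add S.scaleR cinner_add_left cinner_scaleR_left)
    then obtain z where z: "\<And>x. Re (cinner (S x) y) = Re (cinner x z)" using riesz_real by metis
    have "cinner (S x) y = cinner x z" for x
      using z[of x] z[of "scaleC \<i> x"] by (simp add: complex_eq_iff SC cinner_scaleC_left)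
    then show ?thesis by blast
  qed
  then obtain S' where S': "\<And>x y. cinner (S x) y = cinner x (S' y)" by metis
  have "adj bounded_operators S = S'"
  proof -
    have "T = S'" if "\<forall>x y. cinner (S x) y = cinner x (T y)" for T
      using that S' by (intro ext cinner_eqI) metis
    then show ?thesis using S' unfolding bounded_operators_def by (simp, intro the_equality) auto
  qed
  then show ?thesis using S' by simp
qed

text \<open>For self-adjoint \<open>a\<close> let \<open>t = \<parallel>\<pi>(a)\<parallel>\<close> and \<open>h = t\<^sup>2 e - a\<^sup>2\<close>.  Since \<open>\<pi>(h)\<close> is a
  nonnegative operator, \<open>\<pi>\<close> annihilates \<open>\<bar>h\<bar> - h\<close>, and injectivity gives \<open>h = \<bar>h\<bar> = r\<^sup>2\<close>
  inside \<open>A\<close>.  So \<open>a\<^sup>2 + r\<^sup>2 = t\<^sup>2 e\<close>, which bounds \<open>\<parallel>a\<parallel>\<close> by \<open>t\<close>.\<close>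

lemma faithful_representation_isometric:
  fixes \<pi> :: "'a::ab_group_add \<Rightarrow> 'h::complex_hilbert_space \<Rightarrow> 'h"
  assumes A: "cstar_algebra A" and e: "is_unit_of A e" and \<pi>: "faithful_representation A \<pi>"
    and x: "x \<in> elems A"
  shows "nrm A x \<le> onorm (\<pi> x)"
proof -
  interpret A: cstar_algebra A by fact
  note e' = A.unitD[OF e]
  have hom: "star_hom A bounded_operators \<pi>" and inj: "inj_on \<pi> (elems A)"
    using \<pi> by (auto simp: faithful_representation_def)
  note hom' = star_homD[OF hom]
  have bl: "bounded_linear (\<pi> a)" if "a \<in> elems A" for a
    using hom'(1)[OF that] by (simp add: bounded_operators_def)
  have add: "\<pi> (a + b) \<xi> = \<pi> a \<xi> + \<pi> b \<xi>" if "a \<in> elems A" "b \<in> elems A" for a b \<xi>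
    using hom'(2)[OF that] by simp
  have scl: "\<pi> (scl A c a) \<xi> = scaleC c (\<pi> a \<xi>)" if "a \<in> elems A" for a c \<xi>
    using hom'(3)[OF that] by (simp add: bounded_operators_def)
  have mul: "\<pi> (mul A a b) \<xi> = \<pi> a (\<pi> b \<xi>)" if "a \<in> elems A" "b \<in> elems A" for a b \<xi>
    using hom'(4)[OF that] by (simp add: bounded_operators_def)
  have adj: "cinner (\<pi> a \<xi>) \<zeta> = cinner \<xi> (\<pi> (adj A a) \<zeta>)" if "a \<in> elems A" for a \<xi> \<zeta>
    using adjoint_exists[OF hom'(1)[OF that]] hom'(5)[OF that] by simp
  have zero: "\<pi> 0 \<xi> = 0" for \<xi> using add[of 0 0 \<xi>] A.zero_closed by simp
  have diff: "\<pi> (a - b) \<xi> = \<pi> a \<xi> - \<pi> b \<xi>" if "a \<in> elems A" "b \<in> elems A" for a b \<xi>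
    using add[of "a - b" b \<xi>] that by (simp add: A.closed)
  have self: "nrm A a \<le> onorm (\<pi> a)" if a: "a \<in> elems A" "adj A a = a" for a
  proof -
    define t where "t = onorm (\<pi> a)"
    have t: "t \<ge> 0" using onorm_pos_le[OF bl[OF a(1)]] by (simp add: t_def)
    have ta: "norm (\<pi> a \<xi>) \<le> t * norm \<xi>" for \<xi> unfolding t_def by (rule onorm[OF bl[OF a(1)]])
    define h where "h = scl A (of_real (t\<^sup>2)) e - mul A a a"
    have h: "h \<in> elems A" "adj A h = h"
      using a e' by (simp_all add: h_def A.closed A.adj_diff A.adj_scl A.adj_mul)
    obtain q r where q: "q \<in> elems A" "r \<in> elems A" "adj A q = q" "adj A r = r"
      "mul A q q = mul A h h" "mul A r r = q"
      and comm: "\<And>y. \<lbrakk>y \<in> elems A; mul A y h = mul A h y\<rbrakk> \<Longrightarrow> mul A y q = mul A q y"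
      "\<And>y. \<lbrakk>y \<in> elems A; mul A y h = mul A h y\<rbrakk> \<Longrightarrow> mul A y r = mul A r y"
      using A.abs_and_root_exist[OF h e] by metis
    have ah: "mul A a h = mul A h a"
      using a e' by (simp add: h_def A.mul_diff_left A.mul_diff_right A.mul_scl_left A.mul_scl_right A.closed A.mul_assoc)
    have hq: "mul A h q = mul A q h" using comm(1)[OF h(1)] by simp
    define d where "d = q - h"
    have d: "d \<in> elems A" "adj A d = d" using q h by (simp_all add: d_def A.closed A.adj_diff)
    have "mul A (q + h) d = 0"
      using q h hq by (simp add: d_def A.closed A.mul_diff_right A.mul_add_left)
    have ed: "mul A e d = d" using e' d by simp
    \<comment> \<open>On the range of \<open>\<pi> d\<close> the nonnegative operators \<open>\<pi> q\<close> and \<open>\<pi> h\<close> add up to zero.\<close>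
    have key: "\<pi> d (\<pi> d \<xi>) = 0" for \<xi>
    proof -
      define \<zeta> where "\<zeta> = \<pi> d \<xi>"
      have e\<zeta>: "\<pi> e \<zeta> = \<zeta>" unfolding \<zeta>_def using mul[of e d \<xi>] ed e' d by simp
      have sum0: "\<pi> q \<zeta> + \<pi> h \<zeta> = 0"
        unfolding \<zeta>_def using mul[of "q + h" d \<xi>] add[of q h "\<pi> d \<xi>"] \<open>mul A (q + h) d = 0\<close> q h d zero
        by (simp add: A.closed)
      have "Re (cinner (\<pi> q \<zeta>) \<zeta>) = (norm (\<pi> r \<zeta>))\<^sup>2"
        using mul[of r r \<zeta>] adj[of r "\<pi> r \<zeta>" \<zeta>] q by (simp add: cinner_self)
      moreover have "Re (cinner (\<pi> h \<zeta>) \<zeta>) = t\<^sup>2 * (norm \<zeta>)\<^sup>2 - (norm (\<pi> a \<zeta>))\<^sup>2"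
      proof -
        have "\<pi> h \<zeta> = scaleR (t\<^sup>2) \<zeta> - \<pi> a (\<pi> a \<zeta>)"
          using a e' e\<zeta> by (simp add: h_def diff scl mul A.closed scaleC_of_real del: of_real_power)
        then show ?thesis
          using adj[of a "\<pi> a \<zeta>" \<zeta>] a by (simp add: cinner_diff_left cinner_scaleR_left cinner_self)
      qed
      moreover have "(norm (\<pi> a \<zeta>))\<^sup>2 \<le> t\<^sup>2 * (norm \<zeta>)\<^sup>2"
        using power_mono[OF ta[of \<zeta>], of 2] by (simp add: power_mult_distrib)
      moreover have "Re (cinner (\<pi> q \<zeta>) \<zeta>) + Re (cinner (\<pi> h \<zeta>) \<zeta>) = 0"
        using arg_cong[OF sum0, of "\<lambda>v. Re (cinner v \<zeta>)"] by (simp add: cinner_add_left)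
      ultimately have "(norm (\<pi> r \<zeta>))\<^sup>2 \<le> 0" by linarith
      then have "\<pi> r \<zeta> = 0" by simp
      then have "\<pi> q \<zeta> = 0" using mul[of r r \<zeta>] q linear_0[OF bounded_linear.linear[OF bl[OF q(2)]]] by simp
      then have "\<pi> d \<zeta> = 0" using sum0 diff[of q h \<zeta>] q h by (simp add: d_def)
      then show ?thesis by (simp add: \<zeta>_def)
    qed
    \<comment> \<open>The square of the self-adjoint operator \<open>\<pi> d\<close> vanishes.\<close>
    have "\<pi> d \<xi> = 0" for \<xi>
      using adj[of d \<xi> "\<pi> d \<xi>"] d key[of \<xi>] by (simp add: cinner_self)
    then have "\<pi> d = \<pi> 0" using zero by (intro ext) simp
    then have "d = 0" using inj d A.zero_closed by (auto dest: inj_onD)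
    then have "mul A r r = h" using q by (simp add: d_def)
    then have sumsq: "mul A a a + mul A r r = scl A (of_real (t\<^sup>2)) e" by (simp add: h_def)
    let ?v = "a + scl A \<i> r"
    have v: "?v \<in> elems A" using a q by (simp add: A.closed)
    have "(nrm A ?v)\<^sup>2 = nrm A (scl A (of_real (t\<^sup>2)) e)"
      using A.cartesian_square[OF a(1) q(2) a(2) q(4)] comm(2)[OF a(1) ah] sumsq A.cstar_identity[OF v] by simp
    also have "\<dots> \<le> t\<^sup>2 * 1"
      unfolding A.nrm_scl[OF e'(1)] using e'(5) by (intro mult_mono) (auto simp: A.nrm_nonneg e' norm_power)
    finally have "nrm A ?v \<le> t" using t power2_le_imp_le by simp
    then have "nrm A (?v + adj A ?v) \<le> 2 * t"
      using A.nrm_triangle[OF v A.adj_closed[OF v]] A.nrm_adj[OF v] by simp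
    then show ?thesis
      using A.cartesian_real_part(1)[OF a(1) q(2) a(2) q(4)] A.nrm_scl[of "?v + adj A ?v" "1/2"] v
      by (simp add: A.closed t_def)
  qed
  have "(nrm A x)\<^sup>2 = nrm A (mul A (adj A x) x)" using A.cstar_identity[OF x] by simp
  also have "\<dots> \<le> onorm (\<pi> (mul A (adj A x) x))"
    using x by (intro self) (simp_all add: A.closed A.adj_mul A.adj_adj)
  also have "\<dots> \<le> (onorm (\<pi> x))\<^sup>2"
  proof (rule onorm_bound)
    let ?T = "onorm (\<pi> x)"
    have T: "?T \<ge> 0" using onorm_pos_le[OF bl[OF x]] .
    fix \<xi>
    define \<eta> where "\<eta> = \<pi> (mul A (adj A x) x) \<xi>"
    have "(norm \<eta>)\<^sup>2 = Re (cinner (\<pi> x \<eta>) (\<pi> x \<xi>))"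
      using adj[OF x, of \<eta> "\<pi> x \<xi>"] mul[of "adj A x" x \<xi>] x by (simp add: \<eta>_def A.closed cinner_self)
    also have "\<dots> \<le> norm (\<pi> x \<eta>) * norm (\<pi> x \<xi>)" by (rule Re_cinner_le)
    also have "\<dots> \<le> (?T * norm \<eta>) * (?T * norm \<xi>)"
      using onorm[OF bl[OF x]] T by (intro mult_mono) auto
    finally have "norm \<eta> * norm \<eta> \<le> (?T\<^sup>2 * norm \<xi>) * norm \<eta>"
      by (simp add: power2_eq_square algebra_simps)
    then show "norm (\<pi> (mul A (adj A x) x) \<xi>) \<le> ?T\<^sup>2 * norm \<xi>"
      using T unfolding \<eta>_def[symmetric] by (cases "norm \<eta> = 0") auto
  qed simp
  finally show ?thesis using power2_le_imp_le onorm_pos_le[OF bl[OF x]] by blast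
qed

section \<open>Maximal abelian subalgebras and minimal projections\<close>

context cstar_algebra begin

lemma cstar_subalgebraI:
  assumes M: "M \<subseteq> elems A" "subspace M" "\<And>x y. \<lbrakk>x \<in> M; y \<in> M\<rbrakk> \<Longrightarrow> mul A x y \<in> M"
    "\<And>x. x \<in> M \<Longrightarrow> adj A x \<in> M" and lim: "\<And>s l. \<lbrakk>range s \<subseteq> M; tends s l\<rbrakk> \<Longrightarrow> l \<in> M"
  shows "cstar_algebra (A\<lparr>elems := M\<rparr>)"
proof (rule cstar_algebra.intro)
  have MA: "x \<in> elems A" if "x \<in> M" for x using that M(1) by blast
  show "vector_space (scl (A\<lparr>elems := M\<rparr>))" using vector_space_axioms by simp
  show "cstar_algebra_axioms (A\<lparr>elems := M\<rparr>)"
  proof (rule cstar_algebra_axioms.intro, goal_cases)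
    case (18 s)
    have s: "s n \<in> elems A" "s n \<in> M" for n using 18(1)[of n] MA by simp_all
    have "\<exists>l\<in>elems A. (\<lambda>n. nrm A (s n - l)) \<longlonglongrightarrow> 0"
      by (rule complete[OF s(1)]) (use 18(2) in simp)
    then obtain l where l: "l \<in> elems A" "(\<lambda>n. nrm A (s n - l)) \<longlonglongrightarrow> 0" by blast
    then have "tends s l" using s by (auto simp: tends_def)
    then have "l \<in> M" using lim s(2) by blast
    then show ?case using l by auto
  qed (simp_all add: MA M(2-4) mul_assoc mul_add_left mul_add_right mul_scl_left mul_scl_right
      adj_adj adj_add adj_scl adj_mul nrm_eq_0 nrm_triangle nrm_scl nrm_mul cstar_identity)
qed

definition commutant :: "'a set \<Rightarrow> 'a set" where
  "commutant S = {x \<in> elems A. \<forall>y\<in>S. commute x y}"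

text \<open>Commutants are a source of C*-subalgebras for which completeness is automatic.\<close>

lemma cstar_commutant:
  assumes S: "S \<subseteq> elems A" "adj A ` S \<subseteq> S"
  shows "cstar_algebra (A\<lparr>elems := commutant S\<rparr>)"
proof (rule cstar_subalgebraI)
  have S': "y \<in> elems A" "adj A y \<in> S" if "y \<in> S" for y using that S by auto
  show "commutant S \<subseteq> elems A" by (auto simp: commutant_def)
  show "subspace (commutant S)"
    by (rule subspaceI) (auto simp: commutant_def closed S' mul_zero_left mul_zero_right
        mul_add_left mul_add_right mul_scl_left mul_scl_right)
  show "mul A x y \<in> commutant S" if "x \<in> commutant S" "y \<in> commutant S" for x y
    using that commute_mul[of x y] S'(1) unfolding commutant_def by (auto simp: closed)
  show "adj A x \<in> commutant S" if x: "x \<in> commutant S" for x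
  proof -
    have "commute (adj A x) y" if y: "y \<in> S" for y
    proof -
      have "adj A (mul A x (adj A y)) = adj A (mul A (adj A y) x)"
        using x S'(2)[OF y] by (simp add: commutant_def)
      then show ?thesis using x S'(1)[OF y] by (simp add: commutant_def adj_mul closed adj_adj)
    qed
    then show ?thesis using x by (simp add: commutant_def closed)
  qed
  show "l \<in> commutant S" if "range s \<subseteq> commutant S" "tends s l" for s l
  proof -
    have "commute y l" if y: "y \<in> S" for y
    proof (rule commute_tends[OF \<open>tends s l\<close> S'(1)[OF y]])
      fix n
      have "s n \<in> commutant S" using \<open>range s \<subseteq> commutant S\<close> by blast
      then show "commute y (s n)" using y by (simp add: commutant_def)
    qed
    then show ?thesis using tendsD(2)[OF that(2)] by (simp add: commutant_def)
  qed
qed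

text \<open>A commuting set is contained in its commutant, so its bicommutant is contained in the commutant
  too and is therefore abelian.\<close>

lemma bicommutant_abelian:
  assumes S: "S \<subseteq> elems A" "adj A ` S \<subseteq> S" "\<And>x y. \<lbrakk>x \<in> S; y \<in> S\<rbrakk> \<Longrightarrow> commute x y"
  shows "abelian_cstar_subalgebra A (commutant (commutant S))" "S \<subseteq> commutant (commutant S)"
proof -
  interpret S': cstar_algebra "A\<lparr>elems := commutant S\<rparr>" by (rule cstar_commutant[OF S(1,2)])
  have sub: "S \<subseteq> commutant S" using S unfolding commutant_def by blast
  have "commute x y" if "x \<in> commutant (commutant S)" "y \<in> commutant (commutant S)" for x y
  proof -
    have "y \<in> commutant S" using that(2) sub unfolding commutant_def by blast
    then show ?thesis using that(1) unfolding commutant_def by blast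
  qed
  moreover have CA: "commutant T \<subseteq> elems A" for T unfolding commutant_def by blast
  moreover have "cstar_algebra (A\<lparr>elems := commutant (commutant S)\<rparr>)"
  proof (rule cstar_commutant[OF CA])
    show "adj A ` commutant S \<subseteq> commutant S" using S'.adj_closed by auto
  qed
  ultimately show "abelian_cstar_subalgebra A (commutant (commutant S))"
    unfolding abelian_cstar_subalgebra_def by blast
  show "S \<subseteq> commutant (commutant S)"
  proof
    fix x assume x: "x \<in> S"
    have "commute x y" if "y \<in> commutant S" for y using that x unfolding commutant_def by simp
    then show "x \<in> commutant (commutant S)" using x S(1) unfolding commutant_def[of "commutant S"] by blast
  qed
qed

lemma independent_card_le:
  assumes fd: "finite_dimensional A" and V: "V \<subseteq> elems A" and P: "P \<subseteq> V" "independent P"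
  shows "finite P \<and> card P \<le> dim V"
proof -
  obtain b where b: "finite b" "elems A \<subseteq> span b" using fd by (auto simp: finite_dimensional_def)
  obtain C where C: "C \<subseteq> V" "independent C" "V \<subseteq> span C" "card C = dim V" using basis_exists by blast
  have "finite C" using independent_span_bound[OF b(1) C(2)] C(1) V b(2) by blast
  then show ?thesis using independent_span_bound[OF _ P(2), of C] P(1) C by (metis subset_trans)
qed

lemma subspace_eq_if_dim_le:
  assumes fd: "finite_dimensional A" and W: "W \<subseteq> elems A" "V \<subseteq> W" "subspace V" "dim W \<le> dim V"
  shows "V = W"
proof (rule ccontr)
  assume "V \<noteq> W"
  then obtain x where x: "x \<in> W" "x \<notin> V" using W by blast
  obtain B where B: "B \<subseteq> V" "independent B" "V \<subseteq> span B" "card B = dim V" using basis_exists by blast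
  have "x \<notin> span B" using span_minimal[OF B(1) W(3)] x by blast
  then have "independent (insert x B)" using B(2) independent_insert by auto
  then have "finite (insert x B)" "card (insert x B) \<le> dim W"
    using independent_card_le[OF fd W(1), of "insert x B"] x B W by auto
  moreover have "x \<notin> B" using x B by blast
  ultimately show False using B W by simp
qed

lemma maximal_abelian_exists:
  assumes fd: "finite_dimensional A"
  shows "\<exists>M. maximal_abelian A M"
proof -
  obtain b where b: "finite b" "elems A \<subseteq> span b" using fd by (auto simp: finite_dimensional_def)
  have bound: "dim M \<le> card b" if "abelian_cstar_subalgebra A M" for M
    using that b dim_le_card[of M b] by (auto simp: abelian_cstar_subalgebra_def)
  have "abelian_cstar_subalgebra A (commutant (commutant {}))" by (rule bicommutant_abelian) auto
  moreover have "\<forall>M. abelian_cstar_subalgebra A M \<longrightarrow> dim M < Suc (card b)"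
    using bound by (simp add: less_Suc_eq_le)
  ultimately obtain M where M: "abelian_cstar_subalgebra A M"
    "\<And>M'. abelian_cstar_subalgebra A M' \<Longrightarrow> dim M' \<le> dim M"
    using ex_has_greatest_nat[of "abelian_cstar_subalgebra A" _ dim "Suc (card b)"] by blast
  have "M' = M" if M': "abelian_cstar_subalgebra A M'" "M \<subseteq> M'" for M'
  proof -
    have "subspace M"
      using M(1) cstar_algebra.subspace_elems[of "A\<lparr>elems := M\<rparr>"] by (simp add: abelian_cstar_subalgebra_def)
    then show ?thesis
      using subspace_eq_if_dim_le[OF fd, of M' M] M(2)[OF M'(1)] M' by (auto simp: abelian_cstar_subalgebra_def)
  qed
  then show ?thesis using M(1) by (auto simp: maximal_abelian_def)
qed

text \<open>The bicommutant of \<open>M\<close> together with \<open>h\<close> is an abelian C*-subalgebra that contains \<open>M\<close>.\<close>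

lemma maximal_abelian_mem:
  assumes M: "maximal_abelian A M" and h: "h \<in> elems A" "adj A h = h" "\<And>m. m \<in> M \<Longrightarrow> commute h m"
  shows "h \<in> M"
proof -
  have ab: "abelian_cstar_subalgebra A M" using M by (simp add: maximal_abelian_def)
  then interpret M: cstar_algebra "A\<lparr>elems := M\<rparr>" by (simp add: abelian_cstar_subalgebra_def)
  let ?S = "insert h M"
  have S: "?S \<subseteq> elems A" "adj A ` ?S \<subseteq> ?S" "\<And>x y. \<lbrakk>x \<in> ?S; y \<in> ?S\<rbrakk> \<Longrightarrow> commute x y"
  proof -
    show "?S \<subseteq> elems A" using ab h(1) by (simp add: abelian_cstar_subalgebra_def)
    show "adj A ` ?S \<subseteq> ?S" using h(2) M.adj_closed by auto
    show "commute x y" if "x \<in> ?S" "y \<in> ?S" for x y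
      using that ab h(3) unfolding abelian_cstar_subalgebra_def by (metis insertE)
  qed
  have "commutant (commutant ?S) = M"
    using M bicommutant_abelian[OF S] unfolding maximal_abelian_def by blast
  then show ?thesis using bicommutant_abelian(2)[OF S] by auto
qed

lemma adj_mul_self_nonzero: "\<lbrakk>x \<in> elems A; x \<noteq> 0\<rbrakk> \<Longrightarrow> mul A (adj A x) x \<noteq> 0"
  using cstar_identity[of x] nrm_eq_0[of x] nrm_zero by auto

definition ideal :: "'a set \<Rightarrow> bool" where
  "ideal J \<longleftrightarrow> subspace J \<and> J \<subseteq> elems A \<and> (\<forall>m\<in>elems A. \<forall>x\<in>J. mul A m x \<in> J)"

definition minimal_projection :: "'a \<Rightarrow> bool" where
  "minimal_projection p \<longleftrightarrow> p \<in> elems A \<and> p \<noteq> 0 \<and> adj A p = p \<and> mul A p p = p \<and>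
     (\<forall>m\<in>elems A. \<exists>c. mul A m p = scl A c p)"

text \<open>A nonzero polynomial \<open>p\<close> of least degree with \<open>p(x) v = 0\<close> has a root \<open>\<mu>\<close>; dividing by
  \<open>X - \<mu>\<close> gives a polynomial \<open>q\<close> with \<open>q(x) v \<noteq> 0\<close>, and this vector is the eigenvector.\<close>

lemma eigenvector_exists:
  assumes fd: "finite_dimensional A" and J: "ideal J" "J \<noteq> {0}" and x: "x \<in> elems A"
  obtains \<mu> y where "y \<in> J" "y \<noteq> 0" "mul A x y = scl A \<mu> y"
proof -
  have sub: "subspace J" and JA: "J \<subseteq> elems A" and Jm: "\<And>m y. \<lbrakk>m \<in> elems A; y \<in> J\<rbrakk> \<Longrightarrow> mul A m y \<in> J"
    using J(1) by (auto simp: ideal_def)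
  obtain v where v: "v \<in> J" "v \<noteq> 0" using J(2) subspace_0[OF sub] by auto
  define pw where "pw i = (mul A x ^^ i) v" for i
  have pw: "pw i \<in> J" for i by (induction i) (auto simp: pw_def v Jm x)
  then have pwA: "pw i \<in> elems A" for i using JA by blast
  define ev where "ev p = (\<Sum>i\<le>degree p. scl A (coeff p i) (pw i))" for p
  have ev_mem: "ev p \<in> J" for p
    unfolding ev_def by (intro subspace_sum[OF sub] subspace_scale[OF sub] pw)
  have ev: "ev p = (\<Sum>i\<le>n. scl A (coeff p i) (pw i))" if "degree p \<le> n" for p n
    unfolding ev_def using that by (intro sum.mono_neutral_left) (auto simp: coeff_eq_0)
  obtain b where b: "finite b" "elems A \<subseteq> span b" using fd by (auto simp: finite_dimensional_def)
  have "\<exists>p. p \<noteq> 0 \<and> ev p = 0"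
  proof (cases "inj_on pw {..card b}")
    case True
    then have "card (pw ` {..card b}) = Suc (card b)" by (simp add: card_image)
    then have "dependent (pw ` {..card b})"
      using independent_span_bound[OF b(1), of "pw ` {..card b}"] pwA b(2) by force
    then obtain u w where u: "w \<in> pw ` {..card b}" "u w \<noteq> 0"
      "(\<Sum>w\<in>pw ` {..card b}. scl A (u w) w) = 0"
      by (auto simp: dependent_finite)
    define p where "p = (\<Sum>i\<le>card b. monom (u (pw i)) i)"
    have coeff: "coeff p i = (if i \<le> card b then u (pw i) else 0)" for i
      by (simp add: p_def coeff_sum)
    have "degree p \<le> card b" by (intro degree_le) (simp add: coeff)
    then have "ev p = (\<Sum>i\<le>card b. scl A (coeff p i) (pw i))" by (rule ev)
    also have "\<dots> = (\<Sum>i\<le>card b. scl A (u (pw i)) (pw i))" by (intro sum.cong refl) (simp add: coeff)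
    also have "\<dots> = 0" using u(3) by (simp add: sum.reindex[OF True])
    finally have "ev p = 0" .
    moreover have "p \<noteq> 0" using u(1,2) coeff by (metis atMost_iff coeff_0 imageE)
    ultimately show ?thesis by blast
  next
    case False
    then obtain i j where ij: "pw i = pw j" "i \<noteq> j" by (auto simp: inj_on_def)
    let ?p = "monom (1::complex) i - monom 1 j"
    have "degree ?p \<le> max i j" by (intro degree_diff_le) (auto intro: order_trans[OF degree_monom_le])
    then have "ev ?p = (\<Sum>k\<le>max i j. scl A (coeff ?p k) (pw k))" by (rule ev)
    also have "\<dots> = (\<Sum>k\<le>max i j. (if k = i then pw k else 0) - (if k = j then pw k else 0))"
      by (intro sum.cong refl) (auto simp: scale_left_diff_distrib)
    also have "\<dots> = 0" by (simp add: sum_subtractf ij)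
    finally have "ev ?p = 0" .
    moreover have "coeff ?p i \<noteq> 0" using ij by simp
    then have "?p \<noteq> 0" by force
    ultimately show ?thesis by blast
  qed
  then obtain p where p: "p \<noteq> 0" "ev p = 0" and min: "\<And>q. \<lbrakk>q \<noteq> 0; ev q = 0\<rbrakk> \<Longrightarrow> degree p \<le> degree q"
    using ex_has_least_nat[of "\<lambda>p. p \<noteq> 0 \<and> ev p = 0" _ degree] by blast
  have "degree p \<noteq> 0"
  proof
    assume "degree p = 0"
    then have "ev p = scl A (coeff p 0) v" by (simp add: ev_def pw_def)
    moreover have "coeff p 0 \<noteq> 0" using \<open>degree p = 0\<close> p(1) by (metis leading_coeff_0_iff)
    ultimately show False using p(2) v by simp
  qed
  then obtain \<mu> where "poly p \<mu> = 0"
    using fundamental_theorem_of_algebra[of p] by (auto simp: constant_degree)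
  then obtain q where q: "p = [:- \<mu>, 1:] * q" by (auto simp: poly_eq_0_iff_dvd)
  then have q0: "q \<noteq> 0" using p(1) by auto
  then have deg: "degree p = Suc (degree q)" unfolding q by (subst degree_mult_eq) auto
  then have "ev q \<noteq> 0" using min[OF q0] by auto
  moreover have "mul A x (ev q) = scl A \<mu> (ev q)"
  proof -
    have c: "coeff p i = (case i of 0 \<Rightarrow> 0 | Suc k \<Rightarrow> coeff q k) - \<mu> * coeff q i" for i
      unfolding q by (simp add: coeff_pCons split: nat.split)
    have "0 = (\<Sum>i\<le>Suc (degree q). scl A (coeff p i) (pw i))" using p(2) ev[of p "Suc (degree q)"] deg by simp
    also have "\<dots> = (\<Sum>i\<le>Suc (degree q). scl A (case i of 0 \<Rightarrow> 0 | Suc k \<Rightarrow> coeff q k) (pw i))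
        - (\<Sum>i\<le>Suc (degree q). scl A \<mu> (scl A (coeff q i) (pw i)))"
      unfolding c by (simp only: scale_left_diff_distrib sum_subtractf scale_scale)
    also have "(\<Sum>i\<le>Suc (degree q). scl A \<mu> (scl A (coeff q i) (pw i))) = scl A \<mu> (ev q)"
      using ev[of q "Suc (degree q)"] by (simp only: scale_sum_right)
    also have "(\<Sum>i\<le>Suc (degree q). scl A (case i of 0 \<Rightarrow> 0 | Suc k \<Rightarrow> coeff q k) (pw i))
        = (\<Sum>i\<le>degree q. scl A (coeff q i) (mul A x (pw i)))"
      by (simp only: sum.atMost_Suc_shift) (simp add: pw_def)
    also have "\<dots> = mul A x (ev q)"
      unfolding ev_def by (simp add: mul_sum_right mul_scl_right closed pwA x)
    finally show ?thesis by simp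
  qed
  ultimately show thesis using that ev_mem by blast
qed

text \<open>A nonzero ideal \<open>I\<close> of least dimension is a field: for nonzero \<open>a\<close> in \<open>I\<close> the ideal \<open>a I\<close> is
  nonzero by the C*-identity, hence all of \<open>I\<close>.  A finite-dimensional field over the complex
  numbers consists of the multiples of its unit, and this unit is the projection.\<close>

lemma minimal_projection_exists:
  assumes fd: "finite_dimensional A" and comm: "\<And>x y. \<lbrakk>x \<in> elems A; y \<in> elems A\<rbrakk> \<Longrightarrow> commute x y"
    and J: "ideal J" "J \<noteq> {0}"
  obtains p where "p \<in> J" "minimal_projection p"
proof -
  obtain I where I: "ideal I" "I \<subseteq> J" "I \<noteq> {0}"
    and min: "\<And>I'. \<lbrakk>ideal I'; I' \<subseteq> J; I' \<noteq> {0}\<rbrakk> \<Longrightarrow> dim I \<le> dim I'"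
    using ex_has_least_nat[of "\<lambda>I. ideal I \<and> I \<subseteq> J \<and> I \<noteq> {0}" J dim] J by blast
  have sub: "subspace I" and IA: "\<And>y. y \<in> I \<Longrightarrow> y \<in> elems A"
    and Im: "\<And>m y. \<lbrakk>m \<in> elems A; y \<in> I\<rbrakk> \<Longrightarrow> mul A m y \<in> I"
    using I(1) by (auto simp: ideal_def)
  have simple: "mul A a ` I = I" if a: "a \<in> I" "a \<noteq> 0" for a
  proof -
    note aA = IA[OF a(1)]
    have sub': "mul A a ` I \<subseteq> I" using Im aA by blast
    have "subspace (mul A a ` I)"
    proof (rule subspaceI)
      show "0 \<in> mul A a ` I" using mul_zero_right[OF aA] subspace_0[OF sub] by force
      show "x + y \<in> mul A a ` I" if xy: "x \<in> mul A a ` I" "y \<in> mul A a ` I" for x y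
      proof -
        obtain x' y' where "x' \<in> I" "y' \<in> I" "x = mul A a x'" "y = mul A a y'" using xy by blast
        then have "x + y = mul A a (x' + y')" "x' + y' \<in> I"
          using IA aA subspace_add[OF sub] by (auto simp: mul_add_right)
        then show ?thesis by blast
      qed
      show "scl A c x \<in> mul A a ` I" if "x \<in> mul A a ` I" for c x
      proof -
        obtain x' where "x' \<in> I" "x = mul A a x'" using \<open>x \<in> mul A a ` I\<close> by blast
        then have "scl A c x = mul A a (scl A c x')" "scl A c x' \<in> I"
          using IA aA subspace_scale[OF sub] by (auto simp: mul_scl_right)
        then show ?thesis by blast
      qed
    qed
    moreover have "mul A m y \<in> mul A a ` I" if m: "m \<in> elems A" and y: "y \<in> mul A a ` I" for m y
    proof -
      obtain y' where y': "y' \<in> I" "y = mul A a y'" using y by blast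
      then have "mul A m y = mul A a (mul A m y')"
        using m aA IA comm[OF m aA] by (metis mul_assoc)
      then show ?thesis using Im[OF m y'(1)] by blast
    qed
    moreover have "mul A a ` I \<noteq> {0}"
    proof -
      define s where "s = mul A (adj A a) a"
      have s: "s \<in> elems A" "adj A s = s" "s \<noteq> 0" "s \<in> I"
        using aA a adj_mul_self_nonzero Im by (auto simp: s_def closed adj_mul adj_adj)
      have "mul A (adj A a) (mul A a s) = mul A s s" using aA s by (simp add: s_def mul_assoc closed)
      then have "mul A a s \<noteq> 0" using adj_mul_self_nonzero[of s] s aA mul_zero_right[of "adj A a"] closed by auto
      then show ?thesis using s(4) by blast
    qed
    moreover have "mul A a ` I \<subseteq> elems A" "mul A a ` I \<subseteq> J" using sub' I(2) IA by blast+
    ultimately have "subspace (mul A a ` I)" "dim I \<le> dim (mul A a ` I)"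
      using min[of "mul A a ` I"] unfolding ideal_def by blast+
    then show ?thesis using subspace_eq_if_dim_le[OF fd _ sub'] IA by blast
  qed
  obtain a where a: "a \<in> I" "a \<noteq> 0" using I(3) subspace_0[OF sub] by auto
  obtain u where u: "u \<in> I" "mul A a u = a" using simple[OF a] a(1) by (metis imageE)
  have uA: "u \<in> elems A" using u IA by blast
  have unit: "mul A y u = y" if y: "y \<in> I" for y
  proof -
    obtain x where x: "x \<in> I" "y = mul A a x" using y simple[OF a] by blast
    have "mul A y u = mul A (mul A a u) x"
      using x IA a u comm[of x u] by (metis mul_assoc)
    then show ?thesis using x u by simp
  qed
  have scalar: "\<exists>c. x = scl A c u" if x: "x \<in> I" for x
  proof -
    obtain \<mu> y where y: "y \<in> I" "y \<noteq> 0" "mul A x y = scl A \<mu> y"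
      by (rule eigenvector_exists[OF fd I(1) I(3) IA[OF x]])
    define z where "z = x - scl A \<mu> u"
    have z: "z \<in> I" "z \<in> elems A"
      using x u sub IA by (auto simp: z_def intro: subspace_diff subspace_scale)
    have "mul A u y = y" using comm[OF uA IA[OF y(1)]] unit[OF y(1)] by simp
    then have zy: "mul A z y = 0" using y x u uA IA by (simp add: z_def mul_diff_left mul_scl_left closed)
    obtain y' where y': "y' \<in> I" "u = mul A y y'" using simple[OF y(1,2)] u(1) by blast
    have "z = mul A z (mul A y y')" using unit[OF z(1)] y' by simp
    also have "\<dots> = 0" using zy z y y' IA by (simp add: mul_zero_left flip: mul_assoc)
    finally show ?thesis by (auto simp: z_def)
  qed
  define s where "s = mul A (adj A u) u"
  have uu: "mul A u u = u" using unit u by blast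
  have u0: "u \<noteq> 0" using u a mul_zero_right[OF IA[OF a(1)]] by auto
  have s: "s \<in> elems A" "adj A s = s" "s \<noteq> 0" "s \<in> I"
    using uA u0 u adj_mul_self_nonzero Im by (auto simp: s_def closed adj_mul adj_adj)
  obtain c where c: "s = scl A c u" using scalar[OF s(4)] by blast
  then have c0: "c \<noteq> 0" using s by auto
  have ss: "mul A s s = scl A c s" unfolding c using uA uu by (simp add: mul_scl_left mul_scl_right closed)
  have "scl A (cnj c) s = adj A (scl A c s)" using s by (simp add: adj_scl)
  also have "\<dots> = mul A s s" using s unfolding ss[symmetric] by (simp add: adj_mul)
  finally have "scl A (cnj c) s = scl A c s" unfolding ss .
  then have cr: "cnj c = c" using s(3) by simp
  have "u = scl A (1/c) s" using c c0 by simp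
  then have "adj A u = scl A (cnj (1/c)) s" using s by (simp add: adj_scl)
  then have adj: "adj A u = u" using \<open>u = scl A (1/c) s\<close> cr by simp
  have "\<exists>c. mul A m u = scl A c u" if "m \<in> elems A" for m using scalar[OF Im[OF that u(1)]] .
  then have "minimal_projection u" using uA u0 adj uu by (auto simp: minimal_projection_def)
  then show thesis using that u(1) I(2) by blast
qed

end

section \<open>Pinching a finite-dimensional C*-algebra\<close>

context cstar_algebra begin

text \<open>Let \<open>P\<close> be the set of minimal projections of \<open>M\<close>.  They are orthogonal, hence independent and
  at most as many as the dimension of \<open>M\<close>.  Their sum is a unit for \<open>M\<close>, because otherwise the
  ideal of all \<open>m - E m\<close> would contain a further minimal projection.  Maximality of \<open>M\<close>
  transfers both properties to the whole algebra: for self-adjoint \<open>b\<close> the element \<open>p b p\<close> commutes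
  with \<open>M\<close>, so it lies in \<open>M\<close> and is a multiple of \<open>p\<close>.\<close>

lemma masa_projections:
  assumes fd: "finite_dimensional A" and M: "maximal_abelian A M"
  obtains P where "finite P" "card P \<le> dim M"
    "\<And>p. p \<in> P \<Longrightarrow> p \<in> elems A \<and> p \<noteq> 0 \<and> adj A p = p \<and> mul A p p = p"
    "\<And>b. b \<in> elems A \<Longrightarrow> b = (\<Sum>p\<in>P. mul A b p)"
    "\<And>p b. \<lbrakk>p \<in> P; b \<in> elems A\<rbrakk> \<Longrightarrow> \<exists>c. mul A p (mul A b p) = scl A c p"
proof -
  have ab: "abelian_cstar_subalgebra A M" using M by (simp add: maximal_abelian_def)
  define N where "N = A\<lparr>elems := M\<rparr>"
  have N_simps: "elems N = M" "scl N = scl A" "mul N = mul A" "adj N = adj A" "nrm N = nrm A"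
    by (simp_all add: N_def)
  interpret N: cstar_algebra N using ab by (simp add: abelian_cstar_subalgebra_def N_def)
  have MA: "m \<in> elems A" if "m \<in> M" for m using ab that by (auto simp: abelian_cstar_subalgebra_def)
  have comm: "commute x y" if "x \<in> M" "y \<in> M" for x y
    using ab that unfolding abelian_cstar_subalgebra_def by blast
  have subM: "subspace M" using N.subspace_elems by (simp add: N_simps)
  have fdN: "finite_dimensional N"
    using fd ab by (auto simp: finite_dimensional_def N_simps abelian_cstar_subalgebra_def)
  have mulM: "mul A x y \<in> M" if "x \<in> M" "y \<in> M" for x y using N.mul_closed that by (simp add: N_simps)
  define P where "P = {p. N.minimal_projection p}"
  have P: "p \<in> M" "p \<noteq> 0" "adj A p = p" "mul A p p = p" if "p \<in> P" for p
    using that by (auto simp: P_def N.minimal_projection_def N_simps)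
  have Pmin: "\<exists>c. mul A m p = scl A c p" if "p \<in> P" "m \<in> M" for p m
    using that by (auto simp: P_def N.minimal_projection_def N_simps)
  note PA = MA[OF P(1)]
  have orth: "mul A p q = 0" if p: "p \<in> P" and q: "q \<in> P" and ne: "p \<noteq> q" for p q
  proof (rule ccontr)
    assume "mul A p q \<noteq> 0"
    obtain c d where cd: "mul A q p = scl A c p" "mul A p q = scl A d q"
      using Pmin p q P(1) by metis
    have e: "scl A c p = scl A d q" using cd comm[OF P(1)[OF p] P(1)[OF q]] by simp
    then have cd0: "c \<noteq> 0" "d \<noteq> 0" using \<open>mul A p q \<noteq> 0\<close> cd by auto
    define t where "t = d / c"
    have pt: "p = scl A t q"
    proof -
      have "scl A (1/c) (scl A c p) = scl A (1/c) (scl A d q)" by (simp only: e)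
      then show ?thesis using cd0 by (simp add: t_def)
    qed
    have t0: "t \<noteq> 0" using cd0 by (simp add: t_def)
    have "scl A (t * t) q = scl A t q"
      using P(4)[OF p] P(4)[OF q] PA[OF q] by (simp add: pt mul_scl_left mul_scl_right closed)
    then have "t = 1" using P(2)[OF q] t0 by simp
    then show False using pt ne by simp
  qed
  have indep: "independent P"
  proof
    assume "dependent P"
    then obtain T u where T: "finite T" "T \<subseteq> P" "(\<Sum>v\<in>T. scl A (u v) v) = 0" "\<exists>v\<in>T. u v \<noteq> 0"
      unfolding dependent_explicit by blast
    obtain v where v: "v \<in> T" "u v \<noteq> 0" using T(4) by blast
    have vP: "v \<in> P" using v T by blast
    have "0 = mul A (\<Sum>w\<in>T. scl A (u w) w) v" using T(3) mul_zero_left[OF PA[OF vP]] by simp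
    also have "\<dots> = (\<Sum>w\<in>T. mul A (scl A (u w) w) v)"
      using T(2) PA vP by (intro mul_sum_left) (auto simp: closed)
    also have "\<dots> = (\<Sum>w\<in>T. if w = v then scl A (u v) v else 0)"
      using T(2) PA vP P(4) orth by (intro sum.cong refl) (auto simp: mul_scl_left subset_iff)
    also have "\<dots> = scl A (u v) v" using T(1) v(1) by simp
    finally show False using v(2) P(2)[OF vP] by simp
  qed
  have "finite P \<and> card P \<le> dim M"
    using P(1) indep by (intro independent_card_le[OF fd]) (auto simp: MA)
  then have fin: "finite P" and card: "card P \<le> dim M" by auto
  define E where "E = \<Sum>P"
  have EM: "E \<in> M" unfolding E_def using P(1) by (intro subspace_sum[OF subM])
  note EA = MA[OF EM]
  have Ep: "mul A E p = p" if p: "p \<in> P" for p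
  proof -
    have "mul A E p = (\<Sum>q\<in>P. mul A q p)" unfolding E_def using PA p by (intro mul_sum_left) auto
    also have "\<dots> = (\<Sum>q\<in>P. if q = p then p else 0)"
      using p P(4) orth by (intro sum.cong refl) auto
    finally show ?thesis using fin p by simp
  qed
  have EE: "mul A E E = E"
  proof -
    have "mul A E (\<Sum>p\<in>P. p) = (\<Sum>p\<in>P. mul A E p)" using PA EA by (intro mul_sum_right)
    also have "\<dots> = (\<Sum>p\<in>P. p)" by (intro sum.cong refl Ep)
    finally show ?thesis by (simp add: E_def[symmetric])
  qed
  have adjE: "adj A E = E" unfolding E_def using P(3) PA by (simp add: adj_sum)
  have EMunit: "mul A E m = m" if m: "m \<in> M" for m
  proof (rule ccontr)
    assume ne: "mul A E m \<noteq> m"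
    define J where "J = (\<lambda>m. m - mul A E m) ` M"
    have idJ: "N.ideal J"
      unfolding N.ideal_def N_simps
    proof (intro conjI ballI)
      show "subspace J"
      proof (rule subspaceI)
        show "0 \<in> J" unfolding J_def using subspace_0[OF subM] mul_zero_right[OF EA] by (force intro: image_eqI[of _ _ 0])
        show "x + y \<in> J" if xy: "x \<in> J" "y \<in> J" for x y
        proof -
          obtain a b where "a \<in> M" "b \<in> M" "x = a - mul A E a" "y = b - mul A E b" using xy by (auto simp: J_def)
          then have "x + y = (a + b) - mul A E (a + b)" "a + b \<in> M"
            using MA EA subspace_add[OF subM] by (auto simp: mul_add_right)
          then show ?thesis by (auto simp: J_def)
        qed
        show "scl A c x \<in> J" if x: "x \<in> J" for c x
        proof -
          obtain a where "a \<in> M" "x = a - mul A E a" using x by (auto simp: J_def)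
          then have "scl A c x = scl A c a - mul A E (scl A c a)" "scl A c a \<in> M"
            using MA EA subspace_scale[OF subM] by (auto simp: mul_scl_right scale_right_diff_distrib)
          then show ?thesis by (auto simp: J_def)
        qed
      qed
      show "J \<subseteq> M" unfolding J_def using mulM EM subspace_diff[OF subM] by auto
      show "mul A m x \<in> J" if m: "m \<in> M" and x: "x \<in> J" for m x
      proof -
        obtain a where a: "a \<in> M" "x = a - mul A E a" using x by (auto simp: J_def)
        have "mul A m (mul A E a) = mul A E (mul A m a)"
          using MA m a EA comm[OF m EM] by (metis mul_assoc)
        then have "mul A m x = mul A m a - mul A E (mul A m a)"
          using a MA m EA by (simp add: mul_diff_right closed)
        then show ?thesis using mulM[OF m a(1)] by (auto simp: J_def)
      qed
    qed
    have "m - mul A E m \<in> J" unfolding J_def using m by blast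
    then have neJ: "J \<noteq> {0}" using ne by auto
    have commN: "mul N x y = mul N y x" if "x \<in> elems N" "y \<in> elems N" for x y
      using comm that by (simp only: N_simps)
    obtain p where p: "p \<in> J" "N.minimal_projection p"
      by (rule N.minimal_projection_exists[OF fdN commN idJ neJ])
    have pP: "p \<in> P" using p(2) by (simp add: P_def)
    obtain a where a: "a \<in> M" "p = a - mul A E a" using p(1) by (auto simp: J_def)
    have "mul A E p = mul A E a - mul A (mul A E E) a"
      using a MA EA by (simp add: mul_diff_right closed mul_assoc)
    then have "mul A E p = 0" by (simp add: EE)
    then show False using Ep[OF pP] P(2)[OF pP] by simp
  qed
  have unit: "mul A b E = b" if b: "b \<in> elems A" for b
  proof -
    \<comment> \<open>With \<open>x = b - b E\<close>, the element \<open>x\<^sup>* x\<close> annihilates \<open>M\<close>, so it lies in \<open>M\<close> and is zero.\<close>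
    define x where "x = b - mul A b E"
    have x: "x \<in> elems A" using b EA by (simp add: x_def closed)
    have xE: "mul A x E = 0" using b EA EE by (simp add: x_def mul_diff_left mul_assoc closed)
    define h where "h = mul A (adj A x) x"
    have h: "h \<in> elems A" "adj A h = h" using x by (simp_all add: h_def closed adj_mul adj_adj)
    have hE: "mul A h E = 0" using x EA xE by (simp add: h_def mul_assoc closed mul_zero_right)
    have "adj A (mul A h E) = 0" using hE adj_zero by simp
    then have Eh: "mul A E h = 0" using h EA adjE by (simp add: adj_mul)
    have "commute h m" if m: "m \<in> M" for m
    proof -
      have "mul A h m = mul A (mul A h E) m" using EMunit[OF m] h EA MA[OF m] by (simp add: mul_assoc)
      moreover have "mul A m h = mul A m (mul A E h)"
        using EMunit[OF m] comm[OF m EM] h EA MA[OF m] by (simp flip: mul_assoc)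
      ultimately show ?thesis using hE Eh MA[OF m] by (simp add: mul_zero_left mul_zero_right)
    qed
    then have "h \<in> M" using maximal_abelian_mem[OF M h] by blast
    then have "h = mul A h E" using EMunit[of h] comm[of h E] EM by simp
    then have "h = 0" using hE by simp
    then have "x = 0" using adj_mul_self_nonzero[OF x] by (auto simp: h_def)
    then show ?thesis by (simp add: x_def)
  qed
  show thesis
  proof (rule that[OF fin card])
    show "p \<in> elems A \<and> p \<noteq> 0 \<and> adj A p = p \<and> mul A p p = p" if "p \<in> P" for p
      using PA P that by blast
    show "b = (\<Sum>p\<in>P. mul A b p)" if "b \<in> elems A" for b
      using unit[OF that] PA that by (simp add: E_def mul_sum_right)
    show "\<exists>c. mul A p (mul A b p) = scl A c p" if p: "p \<in> P" and b: "b \<in> elems A" for p b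
    proof -
      have self: "\<exists>c. mul A p (mul A h p) = scl A c p" if h: "h \<in> elems A" "adj A h = h" for h
      proof -
        define k where "k = mul A p (mul A h p)"
        have k: "k \<in> elems A" "adj A k = k"
          using h PA[OF p] P(3)[OF p] by (simp_all add: k_def closed adj_mul mul_assoc)
        have "commute k m" if m: "m \<in> M" for m
        proof -
          obtain c where c: "mul A m p = scl A c p" using Pmin[OF p m] by blast
          have "mul A m k = mul A (mul A m p) (mul A h p)"
            using MA[OF m] h PA[OF p] by (simp add: k_def closed mul_assoc)
          also have "\<dots> = scl A c k" using h PA[OF p] by (simp add: c k_def mul_scl_left closed)
          finally have 1: "mul A m k = scl A c k" .
          have "mul A k m = mul A p (mul A h (mul A p m))"
            using MA[OF m] h PA[OF p] by (simp add: k_def closed mul_assoc)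
          also have "mul A p m = scl A c p" using c comm[OF m P(1)[OF p]] by simp
          also have "mul A p (mul A h (scl A c p)) = scl A c k"
            using h PA[OF p] by (simp add: k_def mul_scl_right closed)
          finally show ?thesis using 1 by simp
        qed
        then have "k \<in> M" using maximal_abelian_mem[OF M k] by blast
        moreover have "mul A k p = k" using h PA[OF p] P(4)[OF p] by (simp add: k_def mul_assoc closed)
        ultimately show ?thesis using Pmin[OF p, of k] by (simp add: k_def)
      qed
      define x where "x = scl A (1/2) (b + adj A b)"
      define y where "y = scl A (1/(2*\<i>)) (b - adj A b)"
      have x: "x \<in> elems A" "adj A x = x"
        using b by (simp_all add: x_def closed adj_scl adj_add adj_adj add.commute)
      have y: "y \<in> elems A" "adj A y = y"
      proof -
        show "y \<in> elems A" unfolding y_def using b by (intro closed)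
        have "adj A y = scl A (- (1/(2*\<i>))) (adj A b - b)"
          unfolding y_def using b by (subst adj_scl) (simp_all add: closed adj_diff adj_adj)
        also have "\<dots> = y" by (simp only: y_def scale_minus_left flip: scale_minus_right) simp
        finally show "adj A y = y" .
      qed
      have "x + scl A \<i> y = scl A (1/2) (b + adj A b) + scl A (1/2) (b - adj A b)"
        by (simp add: x_def y_def)
      also have "\<dots> = scl A (1/2) (b + b)" by (simp flip: scale_right_distrib)
      also have "b + b = scl A 2 b" using scale_left_distrib[of 1 1 b] by simp
      finally have b': "b = x + scl A \<i> y" by simp
      obtain c d where "mul A p (mul A x p) = scl A c p" "mul A p (mul A y p) = scl A d p"
        using self x y by blast
      then have "mul A p (mul A b p) = scl A (c + \<i> * d) p"
        unfolding b' using x y PA[OF p]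
        by (simp add: mul_add_left mul_add_right mul_scl_left mul_scl_right closed scale_left_distrib)
      then show ?thesis by blast
    qed
  qed
qed

text \<open>The functional \<open>g p\<close> is the real part of the coefficient \<open>f\<close> in \<open>p b p = f p\<close>.  In general
  the positivity of \<open>b\<^sup>* b\<close> is a theorem; here the coefficient \<open>c\<close> of \<open>w\<^sup>* w\<close> with \<open>w = b p\<close> is
  real of modulus \<open>\<parallel>w\<parallel>\<^sup>2\<close>, and it cannot be negative.  Otherwise
  \<open>(w + s p)\<^sup>* (w + s p)\<close>, whose coefficient is a real quadratic polynomial in \<open>s\<close> with constant
  term \<open>c\<close>, would vanish for some real \<open>s\<close>; then \<open>w = - s p\<close>, for which the coefficient is \<open>s\<^sup>2\<close>.\<close>

lemma pinching_functionals:
  assumes fd: "finite_dimensional A"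
  obtains P and g :: "'a \<Rightarrow> 'a \<Rightarrow> real" where "finite P" "card P \<le> cstar_rank A"
    "\<And>p. p \<in> P \<Longrightarrow> p \<in> elems A \<and> nrm A p \<le> 1"
    "\<And>b. b \<in> elems A \<Longrightarrow> b = (\<Sum>p\<in>P. mul A b p)"
    "\<And>p x y. \<lbrakk>p \<in> P; x \<in> elems A; y \<in> elems A\<rbrakk> \<Longrightarrow> g p (x + y) = g p x + g p y"
    "\<And>p r x. \<lbrakk>p \<in> P; x \<in> elems A\<rbrakk> \<Longrightarrow> g p (scl A (of_real r) x) = r * g p x"
    "\<And>p x. \<lbrakk>p \<in> P; x \<in> elems A\<rbrakk> \<Longrightarrow> \<bar>g p x\<bar> \<le> nrm A x"
    "\<And>p b. \<lbrakk>p \<in> P; b \<in> elems A\<rbrakk> \<Longrightarrow> (nrm A (mul A b p))\<^sup>2 \<le> g p (mul A (adj A b) (mul A b p))"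
proof -
  define M where "M = (SOME M. maximal_abelian A M)"
  have M: "maximal_abelian A M" unfolding M_def by (rule someI_ex[OF maximal_abelian_exists[OF fd]])
  obtain P where fin: "finite P" and card: "card P \<le> dim M" and
    P: "\<And>p. p \<in> P \<Longrightarrow> p \<in> elems A \<and> p \<noteq> 0 \<and> adj A p = p \<and> mul A p p = p" and
    sum: "\<And>b. b \<in> elems A \<Longrightarrow> b = (\<Sum>p\<in>P. mul A b p)" and
    sc: "\<And>p b. \<lbrakk>p \<in> P; b \<in> elems A\<rbrakk> \<Longrightarrow> \<exists>c. mul A p (mul A b p) = scl A c p"
    using masa_projections[OF fd M] by blast
  define f where "f p b = (SOME c. mul A p (mul A b p) = scl A c p)" for p b
  have f: "mul A p (mul A b p) = scl A (f p b) p" if "p \<in> P" "b \<in> elems A" for p b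
    unfolding f_def by (rule someI_ex[OF sc[OF that]])
  have f_eq: "f p b = c" if "p \<in> P" "b \<in> elems A" "mul A p (mul A b p) = scl A c p" for p b c
    using f[OF that(1,2)] that(3) P[OF that(1)] by simp
  have nP: "nrm A p = 1" if "p \<in> P" for p
  proof -
    have "(nrm A p)\<^sup>2 = nrm A p" using P[OF that] cstar_identity[of p] by simp
    moreover have "nrm A p \<noteq> 0" using P[OF that] nrm_eq_0 by blast
    ultimately show ?thesis by (simp add: power2_eq_square)
  qed
  have f_add: "f p (x + y) = f p x + f p y" if "p \<in> P" "x \<in> elems A" "y \<in> elems A" for p x y
    using that P[OF that(1)] by (intro f_eq) (simp_all add: closed mul_add_left mul_add_right f scale_left_distrib)
  have f_scl: "f p (scl A c x) = c * f p x" if "p \<in> P" "x \<in> elems A" for p c x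
    using that P[OF that(1)] by (intro f_eq) (simp_all add: closed mul_scl_left mul_scl_right f)
  have f_nrm: "cmod (f p x) = nrm A (mul A p (mul A x p))" if "p \<in> P" "x \<in> elems A" for p x
    using that P[OF that(1)] by (simp add: f nrm_scl nP)
  have f_le: "cmod (f p x) \<le> nrm A x" if "p \<in> P" "x \<in> elems A" for p x
  proof -
    have pA: "p \<in> elems A" using P that by blast
    have "nrm A (mul A p (mul A x p)) \<le> nrm A p * (nrm A x * nrm A p)"
      using nrm_mul[of p "mul A x p"] nrm_mul[of x p] that pA nP[OF that(1)] by (simp add: closed)
    then show ?thesis using f_nrm[OF that] nP[OF that(1)] by simp
  qed
  have f_pos: "f p (mul A (adj A b) (mul A b p)) = of_real ((nrm A (mul A b p))\<^sup>2)"
    if p: "p \<in> P" and b: "b \<in> elems A" for p b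
  proof -
    have pA: "p \<in> elems A" "p \<noteq> 0" "adj A p = p" "mul A p p = p" using P[OF p] by auto
    define w where "w = mul A b p"
    have w: "w \<in> elems A" "mul A w p = w" "mul A p (adj A w) = adj A w"
    proof -
      show "w \<in> elems A" "mul A w p = w" using b pA by (simp_all add: w_def closed mul_assoc)
      show "mul A p (adj A w) = adj A w"
        using b pA by (simp add: w_def closed adj_mul flip: mul_assoc)
    qed
    define c where "c = f p (mul A (adj A b) (mul A b p))"
    have ww: "mul A (adj A w) w = scl A c p"
      using f[OF p, of "mul A (adj A b) (mul A b p)"] b pA by (simp add: c_def w_def closed adj_mul mul_assoc)
    have cabs: "cmod c = (nrm A w)\<^sup>2"
      using arg_cong[OF ww, of "nrm A"] cstar_identity[OF w(1)] pA nP[OF p] by (simp add: nrm_scl)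
    have "adj A (mul A (adj A w) w) = mul A (adj A w) w" using w by (simp add: adj_mul adj_adj closed)
    then have "scl A (cnj c) p = scl A c p" unfolding ww using pA by (simp add: adj_scl)
    then have "cnj c = c" using pA(2) by simp
    then have cr: "c = of_real (Re c)" by (metis Reals_cnj_iff of_real_Re)
    have "Re c \<ge> 0"
    proof (rule ccontr)
      assume neg: "\<not> Re c \<ge> 0"
      define l where "l = f p b"
      have pw: "mul A p w = scl A l p" using f[OF p b] by (simp add: l_def w_def)
      have wp: "mul A (adj A w) p = scl A (cnj l) p"
      proof -
        have "mul A (adj A w) p = adj A (mul A p w)" using w pA by (simp add: adj_mul)
        then show ?thesis using pw pA by (simp add: adj_scl)
      qed
      \<comment> \<open>A real root of \<open>c + 2 s Re l + s\<^sup>2\<close>; it exists because \<open>c\<close> is negative.\<close>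
      define s where "s = - Re l + sqrt ((Re l)\<^sup>2 - Re c)"
      have "0 \<le> (Re l)\<^sup>2 - Re c" using neg zero_le_power2[of "Re l"] by linarith
      then have "(s + Re l)\<^sup>2 = (Re l)\<^sup>2 - Re c" by (simp add: s_def)
      then have root: "Re c + 2 * s * Re l + s\<^sup>2 = 0" by (simp add: power2_eq_square algebra_simps)
      define v where "v = w + scl A (of_real s) p"
      have v: "v \<in> elems A" using w pA by (simp add: v_def closed)
      have "mul A (adj A v) v = scl A (c + of_real s * l + of_real s * cnj l + of_real s * of_real s) p"
        unfolding v_def using w pA
        by (simp add: adj_add adj_scl mul_add_left mul_add_right mul_scl_left mul_scl_right closed ww pw wp
            scale_left_distrib algebra_simps)
      also have "c + of_real s * l + of_real s * cnj l + of_real s * of_real s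
          = of_real (Re c + 2 * s * Re l + s\<^sup>2)"
        by (subst cr) (simp add: complex_eq_iff power2_eq_square)
      finally have "mul A (adj A v) v = 0" by (simp add: root)
      then have "v = 0" using adj_mul_self_nonzero[OF v] by blast
      define r where "r = - s"
      have w': "w = scl A (of_real r) p" using \<open>v = 0\<close> by (simp add: v_def r_def eq_neg_iff_add_eq_0)
      have "mul A (adj A w) w = scl A (of_real r * of_real r) p"
        unfolding w' using pA by (simp add: adj_scl mul_scl_left mul_scl_right closed)
      then have "c = of_real r * of_real r" using ww pA(2) by simp
      then have "Re c = r * r" by simp
      then show False using neg by simp
    qed
    then have "c = of_real (cmod c)" using cr by (metis abs_of_nonneg norm_of_real)
    then show ?thesis using cabs by (simp add: c_def w_def)
  qed
  show thesis
  proof (rule that[of P "\<lambda>p x. Re (f p x)", OF fin])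
    show "card P \<le> cstar_rank A" using card by (simp add: cstar_rank_def M_def)
    show "p \<in> elems A \<and> nrm A p \<le> 1" if "p \<in> P" for p using P nP that by simp
    show "\<bar>Re (f p x)\<bar> \<le> nrm A x" if "p \<in> P" "x \<in> elems A" for p x
      using f_le[OF that] abs_Re_le_cmod order_trans by blast
  qed (use sum f_add f_scl f_pos in auto)
qed

end

section \<open>Rademacher averages in a C*-algebra of small rank\<close>

text \<open>The expectation of \<open>G\<close> over \<open>m\<close> independent signs.  The recursion over \<open>m\<close> is the form
  in which the guessing argument consumes it, one sign at a time; entries beyond \<open>m\<close> are zero.\<close>

fun sign_avg :: "nat \<Rightarrow> ((nat \<Rightarrow> real) \<Rightarrow> real) \<Rightarrow> real" where
  "sign_avg 0 G = G (\<lambda>_. 0)"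
| "sign_avg (Suc m) G = (sign_avg m (\<lambda>\<epsilon>. G (\<epsilon>(m := 1))) + sign_avg m (\<lambda>\<epsilon>. G (\<epsilon>(m := -1)))) / 2"

lemma sign_avg_mono:
  "(\<And>\<epsilon>. (\<And>i. i < m \<Longrightarrow> \<bar>\<epsilon> i\<bar> = 1) \<Longrightarrow> G \<epsilon> \<le> H \<epsilon>) \<Longrightarrow> sign_avg m G \<le> sign_avg m H"
proof (induction m arbitrary: G H)
  case (Suc m)
  have "G (\<epsilon>(m := s)) \<le> H (\<epsilon>(m := s))" if "\<And>i. i < m \<Longrightarrow> \<bar>\<epsilon> i\<bar> = 1" "\<bar>s\<bar> = 1" for \<epsilon> s
    using that by (intro Suc.prems) (auto simp: less_Suc_eq)
  then have "sign_avg m (\<lambda>\<epsilon>. G (\<epsilon>(m := s))) \<le> sign_avg m (\<lambda>\<epsilon>. H (\<epsilon>(m := s)))" if "\<bar>s\<bar> = 1" for s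
    using that by (intro Suc.IH) blast
  from this[of 1] this[of "-1"] show ?case by simp
qed simp

lemma sign_avg_add: "sign_avg m (\<lambda>\<epsilon>. G \<epsilon> + H \<epsilon>) = sign_avg m G + sign_avg m H"
  by (induction m arbitrary: G H) (simp_all add: add_divide_distrib)

lemma sign_avg_scale: "sign_avg m (\<lambda>\<epsilon>. c * G \<epsilon>) = c * sign_avg m G"
  by (induction m arbitrary: G) (simp_all add: algebra_simps)

lemma sign_avg_const: "sign_avg m (\<lambda>_. c) = c"
  by (induction m) simp_all

lemma sign_avg_sum: "sign_avg m (\<lambda>\<epsilon>. \<Sum>i\<in>I. G i \<epsilon>) = (\<Sum>i\<in>I. sign_avg m (G i))"
  by (induction I rule: infinite_finite_induct) (simp_all add: sign_avg_const sign_avg_add)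

definition sign_monomial :: "nat \<Rightarrow> (nat \<Rightarrow> nat) \<Rightarrow> (nat \<Rightarrow> real) \<Rightarrow> real" where
  "sign_monomial m k \<epsilon> = (\<Prod>j<m. \<epsilon> j ^ k j)"

text \<open>The average is 1 if all exponents are even and 0 otherwise.\<close>

lemma sign_avg_monomial_nonneg: "0 \<le> sign_avg m (sign_monomial m k)"
proof (induction m)
  case (Suc m)
  have "sign_monomial (Suc m) k (\<epsilon>(m := s)) = s ^ k m * sign_monomial m k \<epsilon>" for \<epsilon> s
    by (simp add: sign_monomial_def)
  then have eq: "sign_avg (Suc m) (sign_monomial (Suc m) k) = (1 + (-1) ^ k m) / 2 * sign_avg m (sign_monomial m k)"
    by (simp add: sign_avg_scale) (simp add: field_simps)
  moreover have "(0::real) \<le> 1 + (-1) ^ k m" by (cases "even (k m)") auto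
  ultimately show ?case using Suc unfolding eq by simp
qed (simp add: sign_monomial_def)

lemma sign_monomial_Suc:
  assumes "j < m" shows "sign_monomial m (k(j := Suc (k j))) \<epsilon> = \<epsilon> j * sign_monomial m k \<epsilon>"
proof -
  have "sign_monomial m f \<epsilon> = \<epsilon> j ^ f j * (\<Prod>i\<in>{..<m} - {j}. \<epsilon> i ^ f i)" for f
    unfolding sign_monomial_def using assms by (intro prod.remove) auto
  moreover have "(\<Prod>i\<in>{..<m} - {j}. \<epsilon> i ^ (k(j := Suc (k j))) i) = (\<Prod>i\<in>{..<m} - {j}. \<epsilon> i ^ k i)"
    by (intro prod.cong) auto
  ultimately show ?thesis by simp
qed

lemma power_le_fact_exp:
  fixes u :: real assumes "0 \<le> u" shows "u ^ n \<le> fact n * exp u"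
proof -
  have "(\<lambda>n. u ^ n /\<^sub>R fact n) sums exp u" by (rule exp_converges)
  then have "summable (\<lambda>n. u ^ n /\<^sub>R fact n)" "exp u = (\<Sum>n. u ^ n /\<^sub>R fact n)"
    by (auto simp: sums_iff)
  then have "sum (\<lambda>n. u ^ n /\<^sub>R fact n) {n} \<le> exp u"
    using assms sum_le_suminf[of "\<lambda>n. u ^ n /\<^sub>R fact n" "{n}"] by simp
  then show ?thesis by (simp add: field_simps)
qed

lemma cosh_bound:
  assumes "0 \<le> \<theta>" "\<theta> \<le> (1::real)" shows "(exp \<theta> + exp (- \<theta>)) / 2 \<le> exp (\<theta>\<^sup>2)"
proof -
  have "exp \<theta> \<le> 1 + \<theta> + \<theta>\<^sup>2" using assms by (rule exp_bound)
  moreover have "exp (- \<theta>) \<le> 1 - \<theta> + \<theta>\<^sup>2"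
  proof -
    have "1 \<le> (1 - \<theta> + \<theta>\<^sup>2) * (1 + \<theta>)" using assms by (simp add: power2_eq_square algebra_simps)
    also have "\<dots> \<le> (1 - \<theta> + \<theta>\<^sup>2) * exp \<theta>"
      using assms by (intro mult_left_mono exp_ge_add_one_self) (auto simp: add_nonneg_nonneg)
    finally show ?thesis by (simp add: exp_minus field_simps)
  qed
  ultimately have "(exp \<theta> + exp (- \<theta>)) / 2 \<le> 1 + \<theta>\<^sup>2" by simp
  also have "\<dots> \<le> exp (\<theta>\<^sup>2)" by (rule exp_ge_add_one_self)
  finally show ?thesis .
qed

lemma sign_avg_exp:
  "sign_avg m (\<lambda>\<epsilon>. exp (\<theta> * (\<Sum>j<m. \<epsilon> j))) = ((exp \<theta> + exp (- \<theta>)) / 2) ^ m"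
proof (induction m)
  case (Suc m)
  have "exp (\<theta> * (\<Sum>j<Suc m. (\<epsilon>(m := s)) j)) = exp (\<theta> * s) * exp (\<theta> * (\<Sum>j<m. \<epsilon> j))" for \<epsilon> s
    by (simp add: algebra_simps exp_add)
  then show ?case using Suc by (simp add: sign_avg_scale algebra_simps del: fun_upd_apply)
qed simp

text \<open>The bound \<open>u\<^sup>L \<le> L! e\<^sup>u\<close> for \<open>u \<ge> 0\<close> reduces moments to exponential moments, and these
  factor over the signs.\<close>

lemma sign_avg_sum_power:
  assumes \<theta>: "0 < \<theta>" "\<theta> \<le> 1" and L: "even L"
  shows "sign_avg m (\<lambda>\<epsilon>. (\<Sum>j<m. \<epsilon> j) ^ L) \<le> 2 * fact L / \<theta> ^ L * exp (m * \<theta>\<^sup>2)"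
proof -
  have "sign_avg m (\<lambda>\<epsilon>. (\<Sum>j<m. \<epsilon> j) ^ L)
      \<le> sign_avg m (\<lambda>\<epsilon>. fact L / \<theta> ^ L * (exp (\<theta> * (\<Sum>j<m. \<epsilon> j)) + exp (- \<theta> * (\<Sum>j<m. \<epsilon> j))))"
  proof (rule sign_avg_mono)
    fix \<epsilon> :: "nat \<Rightarrow> real"
    define S where "S = (\<Sum>j<m. \<epsilon> j)"
    have "\<theta> ^ L * S ^ L = \<bar>\<theta> * S\<bar> ^ L" using L by (simp add: power_mult_distrib power_even_abs)
    also have "\<dots> \<le> fact L * exp \<bar>\<theta> * S\<bar>" by (intro power_le_fact_exp) simp
    also have "\<dots> \<le> fact L * (exp (\<theta> * S) + exp (- \<theta> * S))"
      by (intro mult_left_mono) (auto simp: abs_if)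
    finally show "S ^ L \<le> fact L / \<theta> ^ L * (exp (\<theta> * S) + exp (- \<theta> * S))"
      using \<theta> by (simp add: field_simps)
  qed
  also have "\<dots> = fact L / \<theta> ^ L * (2 * ((exp \<theta> + exp (- \<theta>)) / 2) ^ m)"
    by (simp only: sign_avg_scale sign_avg_add sign_avg_exp) (simp add: add.commute)
  also have "\<dots> \<le> fact L / \<theta> ^ L * (2 * exp (\<theta>\<^sup>2) ^ m)"
    using \<theta> cosh_bound[of \<theta>] by (intro mult_left_mono power_mono) (auto simp: add_nonneg_nonneg)
  also have "exp (\<theta>\<^sup>2) ^ m = exp (m * \<theta>\<^sup>2)" by (simp add: exp_of_nat_mult)
  finally show ?thesis by (simp add: mult_ac)
qed

context cstar_algebra begin

text \<open>A product of \<open>L\<close> random sums \<open>\<Sum>\<^sub>j \<epsilon>\<^sub>j c\<^bsub>lj\<^esub>\<close> applied to \<open>q\<close>.  The coefficients depend on the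
  position \<open>l\<close> so that factors and their adjoints can alternate.\<close>

fun sign_word :: "nat \<Rightarrow> (nat \<Rightarrow> nat \<Rightarrow> 'a) \<Rightarrow> 'a \<Rightarrow> nat \<Rightarrow> (nat \<Rightarrow> real) \<Rightarrow> 'a" where
  "sign_word n c q 0 \<epsilon> = q"
| "sign_word n c q (Suc L) \<epsilon> = mul A (\<Sum>j<n. scl A (of_real (\<epsilon> j)) (c L j)) (sign_word n c q L \<epsilon>)"

lemma sign_word_closed:
  "\<lbrakk>\<And>l j. c l j \<in> elems A; q \<in> elems A\<rbrakk> \<Longrightarrow> sign_word n c q L \<epsilon> \<in> elems A"
  by (induction L) (auto intro!: closed)

text \<open>Expand the product into words.  The average of the accompanying monomial in the signs is
  nonnegative, so the value of each word may be replaced by its bound \<open>D K\<^sup>L\<close>, and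
  summing up again produces the scalar moment.  The induction peels off the leftmost factor: it turns
  \<open>g\<close> into the functionals \<open>x \<mapsto> g (c x)\<close> and raises one exponent of the monomial \<open>k\<close>.\<close>

lemma sign_word_moment:
  assumes c: "\<And>l j. c l j \<in> elems A" "\<And>l j. nrm A (c l j) \<le> K" and K: "0 \<le> K"
    and q: "q \<in> elems A" "nrm A q \<le> 1"
    and g: "\<And>x y. \<lbrakk>x \<in> elems A; y \<in> elems A\<rbrakk> \<Longrightarrow> g (x + y) = g x + g y"
      "\<And>r x. x \<in> elems A \<Longrightarrow> g (scl A (of_real r) x) = r * g x"
      "\<And>x. x \<in> elems A \<Longrightarrow> \<bar>g x\<bar> \<le> D * nrm A x" and D: "0 \<le> D"
  shows "\<bar>sign_avg n (\<lambda>\<epsilon>. sign_monomial n k \<epsilon> * g (sign_word n c q L \<epsilon>))\<bar>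
    \<le> D * K ^ L * sign_avg n (\<lambda>\<epsilon>. sign_monomial n k \<epsilon> * (\<Sum>j<n. \<epsilon> j) ^ L)"
  using g D
proof (induction L arbitrary: g k D)
  case 0
  have "\<bar>g q\<bar> \<le> D * 1" using 0(3)[OF q(1)] q(2) 0(4) by (meson mult_left_mono order_trans)
  then have "\<bar>sign_avg n (sign_monomial n k) * g q\<bar> \<le> sign_avg n (sign_monomial n k) * D"
    using sign_avg_monomial_nonneg[of n k] by (simp add: abs_mult mult_left_mono)
  then show ?case using sign_avg_scale[of n "g q" "sign_monomial n k"] by (simp add: mult.commute)
next
  case (Suc L)
  have w: "sign_word n c q L \<epsilon> \<in> elems A" for \<epsilon> using c q by (intro sign_word_closed)
  define h where "h j x = g (mul A (c L j) x)" for j x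
  have gsum: "g (sum f I) = (\<Sum>i\<in>I. g (f i))" if "\<And>i. f i \<in> elems A" for f and I :: "nat set"
    using that Suc.prems(1) Suc.prems(2)[of 0 0]
    by (induction I rule: infinite_finite_induct) (simp_all add: closed)
  have gw: "g (sign_word n c q (Suc L) \<epsilon>) = (\<Sum>j<n. \<epsilon> j * h j (sign_word n c q L \<epsilon>))" for \<epsilon>
    using c w by (simp add: mul_sum_left closed gsum mul_scl_left Suc.prems(2) h_def)
  have hb: "\<bar>h j x\<bar> \<le> (D * K) * nrm A x" if "x \<in> elems A" for j x
  proof -
    have "\<bar>h j x\<bar> \<le> D * nrm A (mul A (c L j) x)" unfolding h_def using that c by (intro Suc.prems) (auto simp: closed)
    also have "\<dots> \<le> D * (K * nrm A x)"
      using nrm_mul[OF c(1) that, of L j] mult_right_mono[OF c(2) nrm_nonneg[OF that], of L j] Suc.prems(4)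
      by (intro mult_left_mono) auto
    finally show ?thesis by (simp add: mult.assoc)
  qed
  let ?k = "\<lambda>j. k(j := Suc (k j))"
  have "sign_avg n (\<lambda>\<epsilon>. sign_monomial n k \<epsilon> * g (sign_word n c q (Suc L) \<epsilon>))
      = sign_avg n (\<lambda>\<epsilon>. \<Sum>j<n. sign_monomial n (?k j) \<epsilon> * h j (sign_word n c q L \<epsilon>))"
    unfolding gw sum_distrib_left
    by (intro arg_cong[where f = "sign_avg n"] ext sum.cong refl) (simp add: sign_monomial_Suc)
  also have "\<dots> = (\<Sum>j<n. sign_avg n (\<lambda>\<epsilon>. sign_monomial n (?k j) \<epsilon> * h j (sign_word n c q L \<epsilon>)))"
    by (rule sign_avg_sum)
  finally have "\<bar>sign_avg n (\<lambda>\<epsilon>. sign_monomial n k \<epsilon> * g (sign_word n c q (Suc L) \<epsilon>))\<bar>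
      \<le> (\<Sum>j<n. \<bar>sign_avg n (\<lambda>\<epsilon>. sign_monomial n (?k j) \<epsilon> * h j (sign_word n c q L \<epsilon>))\<bar>)"
    by (simp only: sum_abs)
  also have "\<dots> \<le> (\<Sum>j<n. D * K * K ^ L * sign_avg n (\<lambda>\<epsilon>. sign_monomial n (?k j) \<epsilon> * (\<Sum>j<n. \<epsilon> j) ^ L))"
  proof (rule sum_mono)
    fix j
    show "\<bar>sign_avg n (\<lambda>\<epsilon>. sign_monomial n (?k j) \<epsilon> * h j (sign_word n c q L \<epsilon>))\<bar>
        \<le> D * K * K ^ L * sign_avg n (\<lambda>\<epsilon>. sign_monomial n (?k j) \<epsilon> * (\<Sum>j<n. \<epsilon> j) ^ L)"
    proof (rule Suc.IH)
      show "\<bar>h j x\<bar> \<le> D * K * nrm A x" if "x \<in> elems A" for x by (rule hb[OF that])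
      show "0 \<le> D * K" using Suc.prems(4) K by simp
    qed (use c in \<open>simp_all add: h_def mul_add_right mul_scl_right closed Suc.prems(1,2)\<close>)
  qed
  also have "\<dots> = D * K ^ Suc L * sign_avg n (\<lambda>\<epsilon>. \<Sum>j<n. sign_monomial n (?k j) \<epsilon> * (\<Sum>j<n. \<epsilon> j) ^ L)"
    by (simp add: sign_avg_sum sum_distrib_left mult.assoc)
  also have "(\<lambda>\<epsilon>. \<Sum>j<n. sign_monomial n (?k j) \<epsilon> * (\<Sum>j<n. \<epsilon> j) ^ L)
      = (\<lambda>\<epsilon>. sign_monomial n k \<epsilon> * (\<Sum>j<n. \<epsilon> j) ^ Suc L)"
  proof
    fix \<epsilon>
    have "(\<Sum>j<n. sign_monomial n (?k j) \<epsilon> * (\<Sum>j<n. \<epsilon> j) ^ L)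
        = (\<Sum>j<n. \<epsilon> j * (sign_monomial n k \<epsilon> * (\<Sum>j<n. \<epsilon> j) ^ L))"
      by (intro sum.cong refl) (simp add: sign_monomial_Suc)
    then show "(\<Sum>j<n. sign_monomial n (?k j) \<epsilon> * (\<Sum>j<n. \<epsilon> j) ^ L) = sign_monomial n k \<epsilon> * (\<Sum>j<n. \<epsilon> j) ^ Suc L"
      by (simp add: sum_distrib_right[symmetric] algebra_simps)
  qed
  finally show ?case .
qed

text \<open>Powers with exponent \<open>2\<^sup>s\<close>; for these and self-adjoint \<open>z\<close> the C*-identity computes the norm.\<close>

fun repeated_square :: "'a \<Rightarrow> nat \<Rightarrow> 'a" where
  "repeated_square z 0 = z"
| "repeated_square z (Suc s) = mul A (repeated_square z s) (repeated_square z s)"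

lemma repeated_square:
  assumes z: "z \<in> elems A" "adj A z = z"
  shows "repeated_square z s \<in> elems A \<and> adj A (repeated_square z s) = repeated_square z s \<and>
    nrm A (repeated_square z s) = nrm A z ^ (2 ^ s)"
proof (induction s)
  case (Suc s)
  then show ?case
    using cstar_identity[of "repeated_square z s"] by (simp add: closed adj_mul power_mult[symmetric] mult.commute)
qed (use z in simp)

lemma repeated_square_apply:
  assumes z: "z \<in> elems A" "adj A z = z" and w: "w \<in> elems A"
  shows "mul A (repeated_square z s) w = (mul A z ^^ (2 ^ s)) w"
  using w
proof (induction s arbitrary: w)
  case (Suc s)
  have "mul A (repeated_square z (Suc s)) w = mul A (repeated_square z s) (mul A (repeated_square z s) w)"
    using repeated_square[OF z] Suc.prems by (simp add: mul_assoc)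
  also have "\<dots> = (mul A z ^^ (2 ^ s)) (mul A (repeated_square z s) w)"
    using repeated_square[OF z] Suc.prems by (intro Suc.IH) (simp add: closed)
  also have "\<dots> = (mul A z ^^ (2 ^ s)) ((mul A z ^^ (2 ^ s)) w)"
    unfolding Suc.IH[OF Suc.prems] ..
  finally show ?case by (simp add: mult_2 funpow_add)
qed simp

text \<open>With \<open>z = y\<^sup>* y\<close> and \<open>Y = z\<close> to the power \<open>2\<^sup>s\<close>, one has \<open>\<parallel>Y\<parallel>\<^sup>2 = \<parallel>y\<parallel>\<^sup>L\<close> for
  \<open>L = 4 \<cdot> 2\<^sup>s\<close>, and \<open>\<parallel>Y\<parallel> \<le> \<Sum>\<parallel>Y p\<parallel>\<close>.  The Cauchy--Schwarz inequality for this sum costs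
  the factor \<open>card P\<close>.\<close>

lemma nrm_power_le_pinching:
  assumes P: "finite P" "\<And>p. p \<in> P \<Longrightarrow> p \<in> elems A \<and> nrm A p \<le> 1"
    "\<And>b. b \<in> elems A \<Longrightarrow> b = (\<Sum>p\<in>P. mul A b p)"
    "\<And>p b. \<lbrakk>p \<in> P; b \<in> elems A\<rbrakk> \<Longrightarrow> (nrm A (mul A b p))\<^sup>2 \<le> g p (mul A (adj A b) (mul A b p))"
    and y: "y \<in> elems A"
  shows "nrm A y ^ (4 * 2 ^ s) \<le> real (card P) *
    (\<Sum>p\<in>P. g p (((\<lambda>w. mul A (adj A y) (mul A y w)) ^^ (2 * 2 ^ s)) p))"
proof -
  define z where "z = mul A (adj A y) y"
  have z: "z \<in> elems A" "adj A z = z" using y by (simp_all add: z_def closed adj_mul adj_adj)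
  define Y where "Y = repeated_square z s"
  have Y: "Y \<in> elems A" "adj A Y = Y" "nrm A Y = nrm A z ^ (2 ^ s)"
    using repeated_square[OF z] by (simp_all add: Y_def)
  have "nrm A y ^ (4 * 2 ^ s) = (nrm A Y)\<^sup>2"
    using cstar_identity[OF y] by (simp add: Y(3) z_def power_mult[symmetric] mult.commute)
  also have "nrm A Y \<le> (\<Sum>p\<in>P. nrm A (mul A Y p))"
    using P(3)[OF Y(1)] nrm_sum[of P "\<lambda>p. mul A Y p"] P(2) Y by (simp add: closed)
  then have "(nrm A Y)\<^sup>2 \<le> (\<Sum>p\<in>P. nrm A (mul A Y p))\<^sup>2"
    using nrm_nonneg[OF Y(1)] by (intro power_mono)
  also have "\<dots> \<le> real (card P) * (\<Sum>p\<in>P. (nrm A (mul A Y p))\<^sup>2)"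
    using sum_squared_le_sum_of_squares[of "\<lambda>p. nrm A (mul A Y p)" P] by (simp add: mult.commute)
  also have "\<dots> \<le> real (card P) * (\<Sum>p\<in>P. g p (((\<lambda>w. mul A (adj A y) (mul A y w)) ^^ (2 * 2 ^ s)) p))"
  proof (intro mult_left_mono sum_mono)
    fix p assume p: "p \<in> P"
    have pA: "p \<in> elems A" using P(2)[OF p] by blast
    have "(nrm A (mul A Y p))\<^sup>2 \<le> g p (mul A Y (mul A Y p))" using P(4)[OF p Y(1)] Y by simp
    also have "mul A Y (mul A Y p) = (mul A z ^^ (2 * 2 ^ s)) p"
      using repeated_square_apply[OF z, of "mul A Y p" s] repeated_square_apply[OF z pA, of s] Y pA
      by (simp add: Y_def[symmetric] closed mult_2 funpow_add)
    also have "(mul A z ^^ i) p = ((\<lambda>w. mul A (adj A y) (mul A y w)) ^^ i) p \<and> (mul A z ^^ i) p \<in> elems A" for i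
      by (induction i) (use y pA z in \<open>auto simp: z_def mul_assoc closed\<close>)
    then have "(mul A z ^^ (2 * 2 ^ s)) p = ((\<lambda>w. mul A (adj A y) (mul A y w)) ^^ (2 * 2 ^ s)) p" by blast
    finally show "(nrm A (mul A Y p))\<^sup>2 \<le> g p (((\<lambda>w. mul A (adj A y) (mul A y w)) ^^ (2 * 2 ^ s)) p)" .
  qed simp
  finally show ?thesis .
qed

lemma sign_avg_nrm_power:
  assumes fd: "finite_dimensional A" and b: "\<And>j. b j \<in> elems A" "\<And>j. nrm A (b j) \<le> K"
  shows "sign_avg n (\<lambda>\<epsilon>. nrm A (\<Sum>j<n. scl A (of_real (\<epsilon> j)) (b j)) ^ (4 * 2 ^ s))
    \<le> (real (cstar_rank A))\<^sup>2 * K ^ (4 * 2 ^ s) * sign_avg n (\<lambda>\<epsilon>. (\<Sum>j<n. \<epsilon> j) ^ (4 * 2 ^ s))"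
proof -
  have K: "0 \<le> K" using b nrm_nonneg order_trans by blast
  obtain P and g :: "'a \<Rightarrow> 'a \<Rightarrow> real" where P: "finite P" "card P \<le> cstar_rank A"
    "\<And>p. p \<in> P \<Longrightarrow> p \<in> elems A \<and> nrm A p \<le> 1"
    "\<And>b. b \<in> elems A \<Longrightarrow> b = (\<Sum>p\<in>P. mul A b p)"
    and g: "\<And>p x y. \<lbrakk>p \<in> P; x \<in> elems A; y \<in> elems A\<rbrakk> \<Longrightarrow> g p (x + y) = g p x + g p y"
    "\<And>p r x. \<lbrakk>p \<in> P; x \<in> elems A\<rbrakk> \<Longrightarrow> g p (scl A (of_real r) x) = r * g p x"
    "\<And>p x. \<lbrakk>p \<in> P; x \<in> elems A\<rbrakk> \<Longrightarrow> \<bar>g p x\<bar> \<le> nrm A x"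
    "\<And>p b. \<lbrakk>p \<in> P; b \<in> elems A\<rbrakk> \<Longrightarrow> (nrm A (mul A b p))\<^sup>2 \<le> g p (mul A (adj A b) (mul A b p))"
    by (rule pinching_functionals[OF fd], rule that; assumption)
  define y where "y \<epsilon> = (\<Sum>j<n. scl A (of_real (\<epsilon> j)) (b j))" for \<epsilon> :: "nat \<Rightarrow> real"
  have y: "y \<epsilon> \<in> elems A" for \<epsilon> unfolding y_def using b by (intro closed)
  define c where "c l j = (if even l then b j else adj A (b j))" for l :: nat and j
  have c: "c l j \<in> elems A" "nrm A (c l j) \<le> K" for l j
    using b by (simp_all add: c_def closed nrm_adj)
  have adjy: "adj A (y \<epsilon>) = (\<Sum>j<n. scl A (of_real (\<epsilon> j)) (adj A (b j)))" for \<epsilon>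
    using b by (simp add: y_def adj_sum closed adj_scl)
  have word: "((\<lambda>w. mul A (adj A (y \<epsilon>)) (mul A (y \<epsilon>) w)) ^^ r) p = sign_word n c p (2 * r) \<epsilon>" for \<epsilon> p r
    by (induction r) (simp_all add: adjy c_def, simp_all add: y_def)
  define S where "S = sign_avg n (\<lambda>\<epsilon>. (\<Sum>j<n. \<epsilon> j) ^ (4 * 2 ^ s))"
  have mom: "sign_avg n (\<lambda>\<epsilon>. g p (sign_word n c p (4 * 2 ^ s) \<epsilon>)) \<le> K ^ (4 * 2 ^ s) * S" if p: "p \<in> P" for p
  proof -
    have "\<bar>sign_avg n (\<lambda>\<epsilon>. sign_monomial n (\<lambda>_. 0) \<epsilon> * g p (sign_word n c p (4 * 2 ^ s) \<epsilon>))\<bar>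
      \<le> 1 * K ^ (4 * 2 ^ s) * sign_avg n (\<lambda>\<epsilon>. sign_monomial n (\<lambda>_. 0) \<epsilon> * (\<Sum>j<n. \<epsilon> j) ^ (4 * 2 ^ s))"
      using P(3)[OF p] p c K g by (intro sign_word_moment) auto
    then show ?thesis by (simp add: sign_monomial_def S_def)
  qed
  have S0: "0 \<le> S"
    unfolding S_def using sign_avg_mono[of n "\<lambda>_. 0" "\<lambda>\<epsilon>. (\<Sum>j<n. \<epsilon> j) ^ (4 * 2 ^ s)"]
    by (simp add: sign_avg_const zero_le_even_power)
  have "sign_avg n (\<lambda>\<epsilon>. nrm A (y \<epsilon>) ^ (4 * 2 ^ s))
      \<le> sign_avg n (\<lambda>\<epsilon>. real (card P) * (\<Sum>p\<in>P. g p (sign_word n c p (4 * 2 ^ s) \<epsilon>)))"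
    using nrm_power_le_pinching[OF P(1,3,4) g(4) y, of _ s]
    by (intro sign_avg_mono) (simp add: word)
  also have "\<dots> = real (card P) * (\<Sum>p\<in>P. sign_avg n (\<lambda>\<epsilon>. g p (sign_word n c p (4 * 2 ^ s) \<epsilon>)))"
    by (simp add: sign_avg_scale sign_avg_sum)
  also have "\<dots> \<le> real (card P) * (\<Sum>p\<in>P. K ^ (4 * 2 ^ s) * S)"
    by (intro mult_left_mono sum_mono mom) auto
  also have "\<dots> = (real (card P))\<^sup>2 * (K ^ (4 * 2 ^ s) * S)" by (simp add: power2_eq_square)
  also have "\<dots> \<le> (real (cstar_rank A))\<^sup>2 * (K ^ (4 * 2 ^ s) * S)"
    using P(2) K S0 by (intro mult_right_mono power_mono) auto
  finally show ?thesis by (simp add: y_def S_def mult.assoc)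
qed

text \<open>The moment bound with an exponent \<open>L\<close> between \<open>\<beta> n / 2\<close> and \<open>\<beta> n\<close>.  With \<open>\<theta> = e K \<beta> / \<kappa>\<close> the
  moments contribute \<open>(K L / (\<theta> \<kappa> n))\<^sup>L \<le> e\<^bsup>-L\<^esup> \<le> e\<^bsup>-\<beta> n / 2\<^esup>\<close>.  The constant \<open>\<beta>\<close> is chosen such
  that \<open>\<theta>\<^sup>2 = \<beta>/8\<close>; then the exponential moment and the squared rank contribute at most
  \<open>e\<^bsup>\<beta> n / 8\<^esup>\<close> each, and their product with the moment factor is at most 1.\<close>

lemma sign_avg_nrm_le:
  assumes fd: "finite_dimensional A" and b: "\<And>j. b j \<in> elems A" "\<And>j. nrm A (b j) \<le> K"
    and \<kappa>: "0 < \<kappa>" "\<kappa> \<le> K" and \<beta>: "\<beta> = \<kappa>\<^sup>2 / (8 * (exp 1)\<^sup>2 * K\<^sup>2)"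
    and n: "4 \<le> \<beta> * real n" and rank: "real (cstar_rank A) \<le> exp (\<beta> / 16 * real n)"
  shows "sign_avg n (\<lambda>\<epsilon>. nrm A (\<Sum>j<n. scl A (of_real (\<epsilon> j)) (b j))) \<le> 3 * (\<kappa> * real n)"
proof -
  have K: "K > 0" using \<kappa> by simp
  have \<beta>0: "\<beta> > 0" using \<kappa> K by (simp add: \<beta>)
  have n0: "real n > 0" using n by (cases "n = 0") auto
  have "\<exists>s. \<beta> * real n < 8 * 2 ^ s"
  proof -
    obtain s where "\<beta> * real n < 2 ^ s" using real_arch_pow[of 2 "\<beta> * real n"] by auto
    also have "(2::real) ^ s \<le> 8 * 2 ^ s" by simp
    finally show ?thesis by blast
  qed
  \<comment> \<open>Only exponents of the form \<open>4 \<cdot> 2\<^sup>s\<close> are available, whence the factor two between the bounds on \<open>L\<close>.\<close>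
  define s where "s = (LEAST s. \<beta> * real n < 8 * 2 ^ s)"
  have s1: "\<beta> * real n < 8 * 2 ^ s" unfolding s_def by (rule LeastI_ex) fact
  have s2: "4 * 2 ^ s \<le> \<beta> * real n"
  proof (cases s)
    case (Suc r)
    then have "\<not> \<beta> * real n < 8 * 2 ^ r" using not_less_Least[of r "\<lambda>s. \<beta> * real n < 8 * 2 ^ s"] s_def by simp
    then show ?thesis using Suc by simp
  qed (use n in simp)
  define L :: nat where "L = 4 * 2 ^ s"
  have L: "even L" "real L \<le> \<beta> * real n" "\<beta> * real n / 2 \<le> real L" "L > 0"
    using s1 s2 by (simp_all add: L_def)
  define \<theta> where "\<theta> = exp 1 * K * \<beta> / \<kappa>"
  have \<theta>': "\<theta> = \<kappa> / (8 * exp 1 * K)"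
    using \<kappa> K by (simp add: \<theta>_def \<beta> power2_eq_square field_simps)
  have e1: "exp 1 \<ge> (1::real)" by simp
  have \<theta>: "0 < \<theta>" "\<theta> \<le> 1"
  proof -
    show "0 < \<theta>" using \<kappa> K by (simp add: \<theta>')
    have "1 * K \<le> (8 * exp 1) * K" using K e1 by (intro mult_right_mono) linarith+
    then have "\<kappa> \<le> 8 * exp 1 * K" using \<kappa>(2) by linarith
    then show "\<theta> \<le> 1" using K by (simp add: \<theta>' divide_le_eq)
  qed
  have \<theta>2: "\<theta>\<^sup>2 = \<beta> / 8" using \<kappa> K by (simp add: \<theta>' \<beta> power2_eq_square field_simps)
  define t where "t = \<kappa> * real n"
  have t: "t > 0" using \<kappa> n0 by (simp add: t_def)
  define N where "N \<epsilon> = nrm A (\<Sum>j<n. scl A (of_real (\<epsilon> j)) (b j))" for \<epsilon> :: "nat \<Rightarrow> real"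
  have N0: "0 \<le> N \<epsilon>" for \<epsilon> unfolding N_def using b by (intro nrm_nonneg closed)
  \<comment> \<open>Values above the threshold \<open>t\<close> are dominated by their \<open>L\<close>-th power.\<close>
  have ptw: "N \<epsilon> \<le> t + t / t ^ L * N \<epsilon> ^ L" for \<epsilon>
  proof (cases "N \<epsilon> \<le> t")
    case True
    moreover have "0 \<le> t / t ^ L * N \<epsilon> ^ L" using t N0[of \<epsilon>] by simp
    ultimately show ?thesis by linarith
  next
    case False
    then have "N \<epsilon> / t \<le> (N \<epsilon> / t) ^ L" using t L(4) by (intro self_le_power) auto
    then have "t * (N \<epsilon> / t) \<le> t * (N \<epsilon> / t) ^ L" using t by (intro mult_left_mono) auto
    then show ?thesis using t by (simp add: power_divide)
  qed
  have "sign_avg n N \<le> sign_avg n (\<lambda>\<epsilon>. t + t / t ^ L * N \<epsilon> ^ L)" using ptw by (intro sign_avg_mono)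
  also have "\<dots> = t + t / t ^ L * sign_avg n (\<lambda>\<epsilon>. N \<epsilon> ^ L)"
    by (simp only: sign_avg_add sign_avg_scale sign_avg_const)
  also have "sign_avg n (\<lambda>\<epsilon>. N \<epsilon> ^ L)
      \<le> (real (cstar_rank A))\<^sup>2 * K ^ L * sign_avg n (\<lambda>\<epsilon>. (\<Sum>j<n. \<epsilon> j) ^ L)"
    unfolding N_def L_def by (rule sign_avg_nrm_power[OF fd b])
  also have "sign_avg n (\<lambda>\<epsilon>. (\<Sum>j<n. \<epsilon> j) ^ L) \<le> 2 * fact L / \<theta> ^ L * exp (n * \<theta>\<^sup>2)"
    by (rule sign_avg_sum_power[OF \<theta> L(1)])
  also have "fact L \<le> real L ^ L" using fact_le_power[of L, where 'a = real] by simp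
  also have "(real (cstar_rank A))\<^sup>2 \<le> (exp (\<beta> / 16 * real n))\<^sup>2" using rank by (intro power_mono) auto
  finally have "sign_avg n N \<le> t + t / t ^ L * ((exp (\<beta> / 16 * real n))\<^sup>2 * K ^ L *
      (2 * real L ^ L / \<theta> ^ L * exp (n * \<theta>\<^sup>2)))"
    using t K \<theta> by (simp add: mult_left_mono mult_right_mono divide_right_mono)
  also have "t / t ^ L * ((exp (\<beta> / 16 * real n))\<^sup>2 * K ^ L * (2 * real L ^ L / \<theta> ^ L * exp (n * \<theta>\<^sup>2)))
      = 2 * t * ((K * real L / (\<theta> * t)) ^ L * exp (\<beta> * real n / 8) * exp (\<beta> * real n / 8))"
  proof -
    have 1: "(exp (\<beta> / 16 * real n))\<^sup>2 = exp (\<beta> * real n / 8)"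
      by (simp add: power2_eq_square flip: exp_add)
    have 2: "exp (n * \<theta>\<^sup>2) = exp (\<beta> * real n / 8)" by (simp add: \<theta>2 mult.commute)
    show ?thesis unfolding 1 2 by (simp add: power_mult_distrib power_divide mult_ac)
  qed
  also have "\<dots> \<le> 2 * t * 1"
  proof (rule mult_left_mono)
    have "(K * real L / (\<theta> * t)) ^ L \<le> exp (- 1) ^ L"
    proof (rule power_mono)
      have "K * real L / (\<theta> * t) \<le> K * (\<beta> * real n) / (\<theta> * t)"
        using L(2) K \<theta> t by (intro divide_right_mono mult_left_mono) auto
      also have "\<dots> = exp (- 1)" using K \<kappa> n0 \<beta>0 by (simp add: \<theta>_def t_def exp_minus field_simps)
      finally show "K * real L / (\<theta> * t) \<le> exp (- 1)" .
    qed (use K \<theta> t in auto)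
    also have "exp (- 1) ^ L = exp (- real L)" by (simp flip: exp_of_nat_mult)
    also have "\<dots> \<le> exp (- (\<beta> * real n / 2))" using L(3) by simp
    finally have "(K * real L / (\<theta> * t)) ^ L * exp (\<beta> * real n / 8) * exp (\<beta> * real n / 8)
        \<le> exp (- (\<beta> * real n / 2)) * exp (\<beta> * real n / 8) * exp (\<beta> * real n / 8)"
      by (intro mult_right_mono) auto
    also have "\<dots> \<le> 1" using \<beta>0 n0 by (simp flip: exp_add)
    finally show "(K * real L / (\<theta> * t)) ^ L * exp (\<beta> * real n / 8) * exp (\<beta> * real n / 8) \<le> 1" .
  qed (use t in simp)
  finally show ?thesis using t by (simp add: N_def t_def)
qed

end

section \<open>Coding dual sequences with few mistakes\<close>

context cstar_algebra begin

text \<open>The expected norm of \<open>x\<close> plus the random signed sum of the first \<open>m\<close> elements.  For \<open>x = 0\<close>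
  it is the Rademacher average; as a function of \<open>x\<close> it serves as the potential of the guesser.\<close>

definition rademacher :: "(nat \<Rightarrow> 'a) \<Rightarrow> nat \<Rightarrow> 'a \<Rightarrow> real" where
  "rademacher b m x = sign_avg m (\<lambda>\<epsilon>. nrm A (x + (\<Sum>j<m. scl A (of_real (\<epsilon> j)) (b j))))"

lemma rademacher_Suc: "rademacher b (Suc m) x = (rademacher b m (x + b m) + rademacher b m (x - b m)) / 2"
proof -
  have eq: "x + (\<Sum>j<Suc m. scl A (of_real ((\<epsilon>(m := s)) j)) (b j))
      = (x + scl A (of_real s) (b m)) + (\<Sum>j<m. scl A (of_real (\<epsilon> j)) (b j))" for \<epsilon> s
    by (simp add: algebra_simps)
  show ?thesis unfolding rademacher_def sign_avg.simps eq by (simp add: scl_m1)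
qed

text \<open>By convexity of the norm, averaging over one more sign increases the potential.\<close>

lemma rademacher_le_Suc:
  assumes b: "\<And>i. b i \<in> elems A" and x: "x \<in> elems A"
  shows "rademacher b m x \<le> rademacher b (Suc m) x"
proof -
  let ?z = "\<lambda>\<epsilon>. \<Sum>j<m. scl A (of_real (\<epsilon> j)) (b j)"
  have "rademacher b m x \<le> sign_avg m (\<lambda>\<epsilon>. 1/2 * (nrm A (x + b m + ?z \<epsilon>) + nrm A (x - b m + ?z \<epsilon>)))"
    unfolding rademacher_def
  proof (rule sign_avg_mono)
    fix \<epsilon> :: "nat \<Rightarrow> real"
    have z: "?z \<epsilon> \<in> elems A" using b by (intro closed)
    have "nrm A (scl A 2 (x + ?z \<epsilon>)) = 2 * nrm A (x + ?z \<epsilon>)" using x z by (subst nrm_scl) (auto simp: closed)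
    moreover have "scl A 2 (x + ?z \<epsilon>) = (x + b m + ?z \<epsilon>) + (x - b m + ?z \<epsilon>)"
      using scale_left_distrib[of 1 1 "x + ?z \<epsilon>"] by (simp add: algebra_simps)
    ultimately show "nrm A (x + ?z \<epsilon>) \<le> 1/2 * (nrm A (x + b m + ?z \<epsilon>) + nrm A (x - b m + ?z \<epsilon>))"
      using nrm_triangle[of "x + b m + ?z \<epsilon>" "x - b m + ?z \<epsilon>"] x z b by (simp add: closed)
  qed
  also have "\<dots> = rademacher b (Suc m) x"
    unfolding rademacher_Suc by (simp only: sign_avg_scale sign_avg_add rademacher_def)
  finally show ?thesis .
qed

lemma rademacher_diff_le:
  assumes b: "\<And>i. b i \<in> elems A" and x: "x \<in> elems A" "y \<in> elems A"
  shows "rademacher b m x - rademacher b m y \<le> nrm A (x - y)"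
proof -
  let ?z = "\<lambda>\<epsilon>. \<Sum>j<m. scl A (of_real (\<epsilon> j)) (b j)"
  have "rademacher b m x \<le> sign_avg m (\<lambda>\<epsilon>. nrm A (x - y) + nrm A (y + ?z \<epsilon>))"
    unfolding rademacher_def
  proof (rule sign_avg_mono)
    fix \<epsilon> :: "nat \<Rightarrow> real"
    have z: "?z \<epsilon> \<in> elems A" using b by (intro closed)
    show "nrm A (x + ?z \<epsilon>) \<le> nrm A (x - y) + nrm A (y + ?z \<epsilon>)"
      using nrm_triangle[of "x - y" "y + ?z \<epsilon>"] x z by (simp add: closed algebra_simps)
  qed
  then show ?thesis by (simp add: sign_avg_add sign_avg_const rademacher_def)
qed

text \<open>The guess for coordinate \<open>m\<close> in state \<open>x\<close> is the slope that makes the potential, after a move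
  by \<open>\<plusminus> b m\<close>, equal to the potential before the move plus or minus the guess.\<close>

definition guess :: "(nat \<Rightarrow> 'a) \<Rightarrow> nat \<Rightarrow> 'a \<Rightarrow> real" where
  "guess b m x = (rademacher b m (x + b m) - rademacher b m (x - b m)) / 2"

definition move :: "'a \<Rightarrow> int \<Rightarrow> 'a \<Rightarrow> 'a" where
  "move x p v = (if p > 0 then x + v else if p < 0 then x - v else x)"

text \<open>Coordinates are processed downwards, from \<open>m - 1\<close> to 0, because the potential that remains
  after coordinate \<open>m\<close> averages over the signs below \<open>m\<close>.  Letter \<open>j\<close> is the residual of the guess
  in units of \<open>\<gamma>\<close>, rounded; a letter is zero if the guess was good, and then the state is kept.
  The default value makes the word extensional.\<close>

fun residual_code :: "(nat \<Rightarrow> 'a) \<Rightarrow> real \<Rightarrow> (nat \<Rightarrow> real) \<Rightarrow> nat \<Rightarrow> 'a \<Rightarrow> nat \<Rightarrow> int" where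
  "residual_code b \<gamma> y 0 x = (\<lambda>_. undefined)"
| "residual_code b \<gamma> y (Suc m) x = (let p = round ((y m - guess b m x) / \<gamma>)
     in (residual_code b \<gamma> y m (move x p (b m)))(m := p))"

lemma move_closed: "\<lbrakk>x \<in> elems A; v \<in> elems A\<rbrakk> \<Longrightarrow> move x p v \<in> elems A"
  by (simp add: move_def closed)

lemma guess_bound:
  assumes b: "\<And>i. b i \<in> elems A" and x: "x \<in> elems A"
  shows "\<bar>guess b m x\<bar> \<le> nrm A (b m)"
proof -
  have bm: "b m \<in> elems A" by (rule b)
  have "nrm A (x + b m - (x - b m)) \<le> 2 * nrm A (b m)" "nrm A (x - b m - (x + b m)) \<le> 2 * nrm A (b m)"
    using nrm_triangle[OF bm bm] nrm_diff[of "- b m" "b m"] nrm_uminus[OF bm] uminus_closed[OF bm] bm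
    by (simp_all add: algebra_simps)
  then show ?thesis
    using rademacher_diff_le[of b "x + b m" "x - b m" m, OF b] rademacher_diff_le[of b "x - b m" "x + b m" m, OF b] x bm
    by (simp add: guess_def closed abs_le_iff)
qed

lemma residual_code_range:
  assumes b: "\<And>i. b i \<in> elems A" "\<And>i. nrm A (b i) \<le> K" and y: "\<And>i. \<bar>y i\<bar> \<le> K" and \<gamma>: "\<gamma> > 0"
    and Q: "2 * K / \<gamma> + 1 \<le> of_int Q" and x: "x \<in> elems A"
  shows "residual_code b \<gamma> y m x \<in> Pi\<^sub>E {..<m} (\<lambda>_. {-Q..Q})"
  using x
proof (induction m arbitrary: x)
  case (Suc m)
  define p where "p = round ((y m - guess b m x) / \<gamma>)"
  have "\<bar>y m - guess b m x\<bar> \<le> 2 * K"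
    using guess_bound[of b x m, OF b(1) Suc.prems] b(2)[of m] y[of m] by linarith
  then have "\<bar>(y m - guess b m x) / \<gamma>\<bar> \<le> 2 * K / \<gamma>" using \<gamma> by (simp add: divide_right_mono)
  then have "\<bar>real_of_int p\<bar> \<le> of_int Q"
    using of_int_round_abs_le[of "(y m - guess b m x) / \<gamma>"] Q unfolding p_def by linarith
  then have "p \<in> {-Q..Q}" by auto
  moreover have "residual_code b \<gamma> y m (move x p (b m)) \<in> Pi\<^sub>E {..<m} (\<lambda>_. {-Q..Q})"
    using Suc.IH[OF move_closed[OF Suc.prems b(1)]] .
  ultimately have "(residual_code b \<gamma> y m (move x p (b m)))(m := p) \<in> Pi\<^sub>E (insert m {..<m}) (\<lambda>_. {-Q..Q})"
    by (intro PiE_fun_upd)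
  then show ?case unfolding residual_code.simps Let_def p_def lessThan_Suc .
qed simp

lemma residual_code_undefined: "m \<le> i \<Longrightarrow> residual_code b \<gamma> y m x i = undefined"
  by (induction m arbitrary: x) (simp_all add: Let_def)

text \<open>The state of the guesser depends only on the letters produced so far, so equal words come from
  equal guesses; residuals that round to the same letter differ by at most one unit.\<close>

lemma residual_code_determines:
  assumes \<gamma>: "\<gamma> > 0" and "residual_code b \<gamma> y m x = residual_code b \<gamma> y' m x" and "j < m"
  shows "\<bar>y j - y' j\<bar> \<le> \<gamma>"
  using assms(2,3)
proof (induction m arbitrary: x)
  case (Suc m)
  define p where "p = round ((y m - guess b m x) / \<gamma>)"
  define p' where "p' = round ((y' m - guess b m x) / \<gamma>)"
  have eq: "(residual_code b \<gamma> y m (move x p (b m)))(m := p) = (residual_code b \<gamma> y' m (move x p' (b m)))(m := p')"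
    using Suc.prems(1) unfolding p_def p'_def residual_code.simps Let_def .
  then have pp: "p = p'" by (metis fun_upd_same)
  have "residual_code b \<gamma> y m (move x p (b m)) = residual_code b \<gamma> y' m (move x p (b m))"
  proof
    fix i
    show "residual_code b \<gamma> y m (move x p (b m)) i = residual_code b \<gamma> y' m (move x p (b m)) i"
      using fun_cong[OF eq, of i] pp by (cases "i = m") (simp_all add: residual_code_undefined)
  qed
  then have IH: "\<bar>y j - y' j\<bar> \<le> \<gamma>" if "j < m" using Suc.IH that by blast
  have "\<bar>of_int p - (y m - guess b m x) / \<gamma>\<bar> \<le> 1/2" "\<bar>of_int p - (y' m - guess b m x) / \<gamma>\<bar> \<le> 1/2"
    using of_int_round_abs_le[of "(y m - guess b m x) / \<gamma>"] of_int_round_abs_le[of "(y' m - guess b m x) / \<gamma>"]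
    by (simp_all only: p_def[symmetric] p'_def[symmetric] pp)
  moreover have "(y m - y' m) / \<gamma> = (y m - guess b m x) / \<gamma> - (y' m - guess b m x) / \<gamma>"
    by (simp add: diff_divide_distrib)
  ultimately have "\<bar>(y m - y' m) / \<gamma>\<bar> \<le> 1" by linarith
  then have "\<bar>y m - y' m\<bar> \<le> \<gamma>" using \<gamma> by simp
  then show ?case using IH Suc.prems(2) less_Suc_eq by blast
qed simp

text \<open>The potential bounds the value \<open>v\<close> accumulated along the moves plus \<open>\<gamma>/2\<close> for every miss still
  to come.  After a good guess \<open>v\<close> and the state are kept, and the potential does not
  increase, by convexity.  After a miss with
  sign \<open>e\<close> the potential changes by \<open>e\<close> times the guess, while \<open>v\<close> changes by \<open>e\<close> times the
  coordinate; the difference is at least \<open>\<gamma>/2\<close>.\<close>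

lemma residual_code_nonzero_bound:
  assumes b: "\<And>i. b i \<in> elems A" and \<gamma>: "\<gamma> > 0" and x: "x \<in> elems A"
    and dom: "\<And>c::nat \<Rightarrow> real. v + (\<Sum>i<m. c i * y i) \<le> nrm A (x + (\<Sum>i<m. scl A (of_real (c i)) (b i)))"
  shows "v + \<gamma> / 2 * real (card {j. j < m \<and> residual_code b \<gamma> y m x j \<noteq> 0}) \<le> rademacher b m x"
  using x dom
proof (induction m arbitrary: x v)
  case 0
  then show ?case using "0.prems"(2)[of "\<lambda>_. 0"] by (simp add: rademacher_def)
next
  case (Suc m)
  define p where "p = round ((y m - guess b m x) / \<gamma>)"
  define e :: real where "e = of_int (sgn p)"
  define x' where "x' = move x p (b m)"
  have x': "x' = x + scl A (of_real e) (b m)"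
    by (auto simp: x'_def move_def e_def scl_m1)
  have x'A: "x' \<in> elems A" unfolding x'_def using Suc.prems(1) b by (intro move_closed)
  have "v + e * y m + (\<Sum>i<m. c i * y i) \<le> nrm A (x' + (\<Sum>i<m. scl A (of_real (c i)) (b i)))" for c :: "nat \<Rightarrow> real"
    using Suc.prems(2)[of "c(m := e)"] by (simp add: x' algebra_simps cong: sum.cong_simp)
  from Suc.IH[OF x'A this]
  have IH: "v + e * y m + \<gamma> / 2 * real (card {j. j < m \<and> residual_code b \<gamma> y m x' j \<noteq> 0}) \<le> rademacher b m x'" .
  have codeS: "residual_code b \<gamma> y (Suc m) x = (residual_code b \<gamma> y m x')(m := p)" by (simp add: p_def x'_def Let_def)
  show ?case
  proof (cases "p = 0")
    case True
    then have "{j. j < Suc m \<and> residual_code b \<gamma> y (Suc m) x j \<noteq> 0} = {j. j < m \<and> residual_code b \<gamma> y m x' j \<noteq> 0}"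
      by (auto simp: codeS less_Suc_eq simp del: residual_code.simps)
    moreover have "x' = x" "e = 0" using True by (simp_all add: x'_def move_def e_def)
    ultimately show ?thesis using IH rademacher_le_Suc[of b x m, OF b Suc.prems(1)] by simp
  next
    case False
    then have "{j. j < Suc m \<and> residual_code b \<gamma> y (Suc m) x j \<noteq> 0} = insert m {j. j < m \<and> residual_code b \<gamma> y m x' j \<noteq> 0}"
      by (auto simp: codeS less_Suc_eq simp del: residual_code.simps)
    then have card: "real (card {j. j < Suc m \<and> residual_code b \<gamma> y (Suc m) x j \<noteq> 0})
        = 1 + real (card {j. j < m \<and> residual_code b \<gamma> y m x' j \<noteq> 0})" by simp
    have "rademacher b m x' = rademacher b (Suc m) x + e * guess b m x"
      using False by (auto simp: x'_def move_def e_def rademacher_Suc guess_def field_simps)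
    moreover have "\<gamma> / 2 \<le> e * (y m - guess b m x)"
    proof -
      have r: "\<bar>of_int p - (y m - guess b m x) / \<gamma>\<bar> \<le> 1 / 2"
        unfolding p_def by (rule of_int_round_abs_le)
      define q where "q = (y m - guess b m x) / \<gamma>"
      have r': "\<bar>of_int p - q\<bar> \<le> 1 / 2" using r by (simp add: q_def)
      have "1 / 2 \<le> e * q"
      proof (cases "p > 0")
        case True
        then have "real_of_int p \<ge> 1" by simp
        then have "1 / 2 \<le> q" using r' by linarith
        then show ?thesis using True by (simp add: e_def)
      next
        case neg: False
        then have "p \<le> -1" using False by simp
        then have "real_of_int p \<le> -1" by simp
        then have "1 / 2 \<le> - q" using r' by linarith
        then show ?thesis using neg False by (simp add: e_def)
      qed
      then show ?thesis using \<gamma> by (simp add: q_def field_simps)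
    qed
    ultimately show ?thesis using IH by (simp only: card) (simp add: algebra_simps)
  qed
qed

end

text \<open>Weigh a word by \<open>\<theta>\<close> to the number of its nonzero letters.  The total weight of all words
  factorises over the positions, and each sparse word has weight at least \<open>\<theta>\<^sup>D\<close>.\<close>

lemma sparse_codes_card:
  fixes Q :: int and D \<theta> :: real and m :: nat
  assumes Q: "0 \<le> Q" and \<theta>: "0 < \<theta>" "\<theta> \<le> 1"
  defines "C \<equiv> {p \<in> Pi\<^sub>E {..<m} (\<lambda>_. {-Q..Q}). real (card {j. j < m \<and> p j \<noteq> 0}) \<le> D}"
  shows "finite C" "real (card C) \<le> \<theta> powr (- D) * (1 + 2 * of_int Q * \<theta>) ^ m"
proof -
  let ?F = "Pi\<^sub>E {..<m} (\<lambda>_. {-Q..Q})"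
  have finF: "finite ?F" by (intro finite_PiE) auto
  then show "finite C" by (simp add: C_def)
  have w: "(\<Prod>j<m. if p j = 0 then 1 else \<theta>) = \<theta> ^ card {j. j < m \<and> p j \<noteq> 0}" for p :: "nat \<Rightarrow> int"
  proof -
    have "{..<m} \<inter> - {j. p j = 0} = {j. j < m \<and> p j \<noteq> 0}" by auto
    then show ?thesis by (simp add: prod.If_cases)
  qed
  have "(\<Sum>q\<in>{-Q..Q}. if q = 0 then 1 else \<theta>) = 1 + 2 * of_int Q * \<theta>"
  proof -
    have "(\<Sum>q\<in>{-Q..Q}. if q = 0 then 1 else \<theta>) = (1 :: real) + (\<Sum>q\<in>{-Q..Q} - {0}. if q = 0 then 1 else \<theta>)"
      using Q by (subst sum.remove[of _ 0]) auto
    also have "(\<Sum>q\<in>{-Q..Q} - {0}. if q = 0 then 1 else \<theta>) = (\<Sum>q\<in>{-Q..Q} - {0}. \<theta>)"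
      by (intro sum.cong) auto
    also have "\<dots> = 2 * of_int Q * \<theta>" using Q by simp
    finally show ?thesis .
  qed
  then have total: "(\<Sum>p\<in>?F. \<theta> ^ card {j. j < m \<and> p j \<noteq> 0}) = (1 + 2 * of_int Q * \<theta>) ^ m"
    using prod_sum_PiE[of "{..<m}" "\<lambda>_. {-Q..Q}" "\<lambda>_ q. if q = 0 then 1 else \<theta>"] by (simp add: w)
  have "\<theta> powr D * real (card C) = (\<Sum>p\<in>C. \<theta> powr D)" by simp
  also have "\<dots> \<le> (\<Sum>p\<in>C. \<theta> ^ card {j. j < m \<and> p j \<noteq> 0})"
  proof (rule sum_mono)
    fix p assume "p \<in> C"
    then have "\<theta> powr D \<le> \<theta> powr real (card {j. j < m \<and> p j \<noteq> 0})"
      using \<theta> by (intro powr_mono') (auto simp: C_def)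
    then show "\<theta> powr D \<le> \<theta> ^ card {j. j < m \<and> p j \<noteq> 0}" using \<theta> by (simp add: powr_realpow)
  qed
  also have "\<dots> \<le> (\<Sum>p\<in>?F. \<theta> ^ card {j. j < m \<and> p j \<noteq> 0})"
    using finF \<theta> by (intro sum_mono2) (auto simp: C_def)
  finally have "\<theta> powr D * real (card C) \<le> (1 + 2 * of_int Q * \<theta>) ^ m" using total by simp
  then show "real (card C) \<le> \<theta> powr (- D) * (1 + 2 * of_int Q * \<theta>) ^ m"
    using \<theta> by (simp add: powr_minus field_simps)
qed

section \<open>Entropy of the shift on dual sequences\<close>

abbreviation shift :: "(nat \<Rightarrow> complex) \<Rightarrow> nat \<Rightarrow> complex" where
  "shift s \<equiv> \<lambda>n. s (Suc n)"

lemma shift_funpow: "(shift ^^ n) s i = s (i + n)"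
  by (induction n arbitrary: s i) (simp_all add: funpow_Suc_right del: funpow.simps)

text \<open>The Lebesgue number lemma, transferred from the product metric to finitely many coordinates.\<close>

lemma Lebesgue_number_coordinates:
  fixes K :: "(nat \<Rightarrow> complex) set"
  assumes K: "compact K" and U: "open_cover (top_of_set K) \<U>"
  obtains M \<gamma> where "\<gamma> > 0"
    "\<And>x. x \<in> K \<Longrightarrow> \<exists>U\<in>\<U>. \<forall>z\<in>K. (\<forall>j<M. cmod (x j - z j) \<le> \<gamma>) \<longrightarrow> z \<in> U"
proof -
  define \<G> where "\<G> = {G. open G \<and> K \<inter> G \<in> \<U>}"
  have cover: "K \<subseteq> \<Union>\<G>"
  proof
    fix x assume "x \<in> K"
    then obtain U where "U \<in> \<U>" "x \<in> U" using U by (auto simp: open_cover_def)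
    moreover have "openin (top_of_set K) U" using U \<open>U \<in> \<U>\<close> by (auto simp: open_cover_def)
    then obtain G where "open G" "U = K \<inter> G" by (auto simp: openin_open)
    ultimately show "x \<in> \<Union>\<G>" by (auto simp: \<G>_def)
  qed
  have "open G" if "G \<in> \<G>" for G using that by (simp add: \<G>_def)
  then obtain e where e: "0 < e" "\<And>x. x \<in> K \<Longrightarrow> \<exists>G\<in>\<G>. ball x e \<subseteq> G"
    using Heine_Borel_lemma[OF K cover] by blast
  obtain N where N: "(1/2) ^ N < e / 2" using e(1) real_arch_pow_inv[of "e / 2" "1/2"] by auto
  define M where "M = Suc (Max (from_nat ` {..N}))"
  have M: "from_nat n < M" if "n \<le> N" for n
    using that by (auto simp: M_def less_Suc_eq_le)
  show thesis
  proof (rule that[of "e / 8" M])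
    fix x assume x: "x \<in> K"
    then obtain G where G: "G \<in> \<G>" "ball x e \<subseteq> G" using e(2) by blast
    have "z \<in> K \<inter> G" if z: "z \<in> K" "\<forall>j<M. cmod (x j - z j) \<le> e / 8" for z
    proof -
      have "Max {dist (x (from_nat n)) (z (from_nat n)) |n. n \<le> N} \<le> e / 8"
      proof (subst Max_le_iff)
        have "{dist (x (from_nat n)) (z (from_nat n)) |n. n \<le> N}
            = (\<lambda>n. dist (x (from_nat n)) (z (from_nat n))) ` {..N}" by auto
        then show "finite {dist (x (from_nat n)) (z (from_nat n)) |n. n \<le> N}" by simp
      qed (use z(2) M in \<open>auto simp: dist_norm\<close>)
      then have "dist x z < e" using dist_fun_le_dist_first_terms[of x z N] N e(1) by linarith
      then show ?thesis using G z by auto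
    qed
    then show "\<exists>U\<in>\<U>. \<forall>z\<in>K. (\<forall>j<M. cmod (x j - z j) \<le> e / 8) \<longrightarrow> z \<in> U"
      using G(1) unfolding \<G>_def by blast
  qed (use e(1) in simp)
qed

text \<open>Choose a representative of each label class.  The members of the cover around the first \<open>n\<close>
  shifts of the representative form a member of the join, and it contains the whole class.\<close>

lemma subcover_number_le_labels:
  fixes K :: "(nat \<Rightarrow> complex) set" and label :: "(nat \<Rightarrow> complex) \<Rightarrow> 'c"
  assumes K: "\<And>x. x \<in> K \<Longrightarrow> shift x \<in> K"
    and leb: "\<And>x. x \<in> K \<Longrightarrow> \<exists>U\<in>\<U>. \<forall>z\<in>K. (\<forall>j<M. cmod (x j - z j) \<le> \<gamma>) \<longrightarrow> z \<in> U"
    and label: "\<And>x z j. \<lbrakk>x \<in> K; z \<in> K; label x = label z; j < n + M\<rbrakk> \<Longrightarrow> cmod (x j - z j) \<le> \<gamma>"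
    and C: "label ` K \<subseteq> C" "finite C"
  shows "subcover_number (top_of_set K) (iterated_join (top_of_set K) shift \<U> n) \<le> card C"
proof -
  have Kn: "(shift ^^ i) x \<in> K" if "x \<in> K" for i x
    using that K by (induction i) auto
  have "\<exists>u. \<forall>x\<in>K. u x \<in> \<U> \<and> (\<forall>z\<in>K. (\<forall>j<M. cmod (x j - z j) \<le> \<gamma>) \<longrightarrow> z \<in> u x)"
    using leb by (intro bchoice) blast
  then obtain u where u': "\<forall>x\<in>K. u x \<in> \<U> \<and> (\<forall>z\<in>K. (\<forall>j<M. cmod (x j - z j) \<le> \<gamma>) \<longrightarrow> z \<in> u x)" ..
  then have u: "u x \<in> \<U>" "\<And>z. \<lbrakk>z \<in> K; \<forall>j<M. cmod (x j - z j) \<le> \<gamma>\<rbrakk> \<Longrightarrow> z \<in> u x" if "x \<in> K" for x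
    using that by blast+
  define r where "r c = (SOME x. x \<in> K \<and> label x = c)" for c
  have r: "r (label x) \<in> K \<and> label (r (label x)) = label x" if "x \<in> K" for x
    unfolding r_def by (rule someI[where P = "\<lambda>y. y \<in> K \<and> label y = label x"]) (use that in simp)
  define W where "W c = {x \<in> topspace (top_of_set K). \<forall>i<n. (shift ^^ i) x \<in> u ((shift ^^ i) (r c))}" for c
  have "subcover_number (top_of_set K) (iterated_join (top_of_set K) shift \<U> n) \<le> card (W ` label ` K)"
  proof (rule subcover_number_le)
    show "W ` label ` K \<subseteq> iterated_join (top_of_set K) shift \<U> n"
    proof
      fix w assume "w \<in> W ` label ` K"
      then obtain x where x: "x \<in> K" "w = W (label x)" by auto
      have "\<forall>i<n. u ((shift ^^ i) (r (label x))) \<in> \<U>" using u(1) Kn r x(1) by blast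
      then show "w \<in> iterated_join (top_of_set K) shift \<U> n"
        unfolding x(2) W_def iterated_join_def by (intro CollectI exI[of _ "\<lambda>i. u ((shift ^^ i) (r (label x)))"]) simp
    qed
    show "finite (W ` label ` K)" using C finite_subset by blast
    show "topspace (top_of_set K) \<subseteq> \<Union> (W ` label ` K)"
    proof
      fix x assume "x \<in> topspace (top_of_set K)"
      then have x: "x \<in> K" by simp
      have "(shift ^^ i) x \<in> u ((shift ^^ i) (r (label x)))" if i: "i < n" for i
      proof (rule u(2))
        show "(shift ^^ i) (r (label x)) \<in> K" "(shift ^^ i) x \<in> K" using Kn r x by blast+
        show "\<forall>j<M. cmod ((shift ^^ i) (r (label x)) j - (shift ^^ i) x j) \<le> \<gamma>"
          using label[of "r (label x)" x] r[OF x] x i by (auto simp: shift_funpow)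
      qed
      then have "x \<in> W (label x)" using x by (simp add: W_def)
      then show "x \<in> \<Union> (W ` label ` K)" using x by blast
    qed
  qed
  also have "\<dots> \<le> card (label ` K)" using C finite_subset by (intro card_image_le) blast
  also have "\<dots> \<le> card C" using C by (intro card_mono)
  finally show ?thesis .
qed

context cstar_algebra begin

text \<open>The sequences induced on \<open>b\<close> by the functionals of norm at most one, described without
  extending functionals.\<close>

definition dual_seqs :: "(nat \<Rightarrow> 'a) \<Rightarrow> (nat \<Rightarrow> complex) set" where
  "dual_seqs b = {s. \<forall>n c. cmod (\<Sum>i<n. c i * s i) \<le> nrm A (\<Sum>i<n. scl A (c i) (b i))}"

lemma dual_seqs_coordinate:
  assumes "s \<in> dual_seqs b" shows "cmod (s i) \<le> nrm A (b i)"
proof -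
  have "cmod (\<Sum>j<Suc i. (if j = i then 1 else 0) * s j) \<le> nrm A (\<Sum>j<Suc i. scl A (if j = i then 1 else 0) (b j))"
    using assms by (simp add: dual_seqs_def del: sum.lessThan_Suc)
  then show ?thesis by (simp add: sum.neutral)
qed

lemma compact_dual_seqs: "compact (dual_seqs b)"
proof -
  have closed: "closed (dual_seqs b)"
    unfolding dual_seqs_def
    by (intro closed_Collect_all closed_Collect_le continuous_intros continuous_on_product_coordinates)
  have "compactin (product_topology (\<lambda>i. euclidean) UNIV) (Pi\<^sub>E UNIV (\<lambda>i. cball 0 (nrm A (b i)) :: complex set))"
    by (subst compactin_PiE) auto
  then have "compact (Pi\<^sub>E UNIV (\<lambda>i. cball 0 (nrm A (b i)) :: complex set))"
    by (simp add: euclidean_product_topology)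
  moreover have "dual_seqs b = Pi\<^sub>E UNIV (\<lambda>i. cball 0 (nrm A (b i))) \<inter> dual_seqs b"
    using dual_seqs_coordinate by auto
  ultimately show ?thesis using closed compact_Int_closed by metis
qed

text \<open>The assumption says that \<open>b i \<mapsto> b (Suc i)\<close> extends to a contraction; the shift on the dual
  side is its transpose.\<close>

lemma shift_dual_seqs:
  assumes sh: "\<And>n c. nrm A (\<Sum>i<n. scl A (c i) (b (Suc i))) \<le> nrm A (\<Sum>i<n. scl A (c i) (b i))"
    and s: "s \<in> dual_seqs b"
  shows "shift s \<in> dual_seqs b"
  unfolding dual_seqs_def
proof (intro CollectI allI)
  fix n c
  have "cmod (\<Sum>i<Suc n. (case i of 0 \<Rightarrow> 0 | Suc j \<Rightarrow> c j) * s i)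
      \<le> nrm A (\<Sum>i<Suc n. scl A (case i of 0 \<Rightarrow> 0 | Suc j \<Rightarrow> c j) (b i))"
    using s unfolding dual_seqs_def by blast
  then have "cmod (\<Sum>i<n. c i * s (Suc i)) \<le> nrm A (\<Sum>i<n. scl A (c i) (b (Suc i)))"
    by (simp only: sum.lessThan_Suc_shift) simp
  then show "cmod (\<Sum>i<n. c i * shift s i) \<le> nrm A (\<Sum>i<n. scl A (c i) (b i))"
    using sh[where n = n and c = c] by simp
qed

lemma dual_seqs_real_parts:
  fixes c :: "nat \<Rightarrow> real"
  assumes s: "s \<in> dual_seqs b"
  shows "(\<Sum>i<n. c i * Re (s i)) \<le> nrm A (\<Sum>i<n. scl A (of_real (c i)) (b i))"
    and "(\<Sum>i<n. c i * Im (s i)) \<le> nrm A (\<Sum>i<n. scl A (of_real (c i)) (b i))"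
proof -
  have "cmod (\<Sum>i<n. of_real (c i) * s i) \<le> nrm A (\<Sum>i<n. scl A (of_real (c i)) (b i))"
    using s[unfolded dual_seqs_def, simplified, rule_format, of "\<lambda>i. of_real (c i)" n] by simp
  moreover have "(\<Sum>i<n. c i * Re (s i)) = Re (\<Sum>i<n. of_real (c i) * s i)"
    "(\<Sum>i<n. c i * Im (s i)) = Im (\<Sum>i<n. of_real (c i) * s i)" by simp_all
  ultimately show "(\<Sum>i<n. c i * Re (s i)) \<le> nrm A (\<Sum>i<n. scl A (of_real (c i)) (b i))"
    "(\<Sum>i<n. c i * Im (s i)) \<le> nrm A (\<Sum>i<n. scl A (of_real (c i)) (b i))"
    using complex_Re_le_cmod[of "\<Sum>i<n. of_real (c i) * s i"] abs_Im_le_cmod[of "\<Sum>i<n. of_real (c i) * s i"]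
    by linarith+
qed

text \<open>The label of a point is the pair of residual words of its real and imaginary parts, whence the
  square and the tolerance \<open>2 \<gamma>\<close>.  The \<open>M\<close> additional coordinates account for the cover
  being controlled by \<open>M\<close> coordinates of each shift.\<close>

lemma subcover_number_dual_seqs:
  assumes b: "\<And>i. b i \<in> elems A" "\<And>i. nrm A (b i) \<le> K"
    and sh: "\<And>n c. nrm A (\<Sum>i<n. scl A (c i) (b (Suc i))) \<le> nrm A (\<Sum>i<n. scl A (c i) (b i))"
    and \<gamma>: "\<gamma> > 0"
    and leb: "\<And>x. x \<in> dual_seqs b \<Longrightarrow>
      \<exists>U\<in>\<U>. \<forall>z\<in>dual_seqs b. (\<forall>j<M. cmod (x j - z j) \<le> 2 * \<gamma>) \<longrightarrow> z \<in> U"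
    and Q: "0 \<le> Q" "2 * K / \<gamma> + 1 \<le> of_int Q" and \<theta>: "0 < \<theta>" "\<theta> \<le> 1"
  shows "real (subcover_number (top_of_set (dual_seqs b))
      (iterated_join (top_of_set (dual_seqs b)) shift \<U> n))
    \<le> (\<theta> powr (- (2 * rademacher b (n + M) 0 / \<gamma>)) * (1 + 2 * of_int Q * \<theta>) ^ (n + M))\<^sup>2"
proof -
  let ?N = "n + M"
  let ?X = "dual_seqs b"
  define D where "D = 2 * rademacher b ?N 0 / \<gamma>"
  define C where "C = {p \<in> Pi\<^sub>E {..<?N} (\<lambda>_. {-Q..Q}). real (card {j. j < ?N \<and> p j \<noteq> 0}) \<le> D}"
  have C: "finite C" "real (card C) \<le> \<theta> powr (- D) * (1 + 2 * of_int Q * \<theta>) ^ ?N"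
    unfolding C_def by (rule sparse_codes_card[OF Q(1) \<theta>])+
  have mem: "residual_code b \<gamma> y ?N 0 \<in> C" if y: "\<And>i. \<bar>y i\<bar> \<le> K"
    "\<And>c::nat \<Rightarrow> real. (\<Sum>i<?N. c i * y i) \<le> nrm A (\<Sum>i<?N. scl A (of_real (c i)) (b i))" for y
  proof -
    have "0 + \<gamma> / 2 * real (card {j. j < ?N \<and> residual_code b \<gamma> y ?N 0 j \<noteq> 0}) \<le> rademacher b ?N 0"
      by (rule residual_code_nonzero_bound[OF b(1) \<gamma> zero_closed]) (use y(2) in simp)
    then have "real (card {j. j < ?N \<and> residual_code b \<gamma> y ?N 0 j \<noteq> 0}) \<le> D"
      using \<gamma> by (simp add: D_def field_simps)
    moreover have "residual_code b \<gamma> y ?N 0 \<in> Pi\<^sub>E {..<?N} (\<lambda>_. {-Q..Q})"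
      by (rule residual_code_range[OF b y(1) \<gamma> Q(2) zero_closed])
    ultimately show ?thesis by (simp add: C_def)
  qed
  define F where "F s = (residual_code b \<gamma> (\<lambda>i. Re (s i)) ?N 0, residual_code b \<gamma> (\<lambda>i. Im (s i)) ?N 0)" for s :: "nat \<Rightarrow> complex"
  have "subcover_number (top_of_set ?X) (iterated_join (top_of_set ?X) shift \<U> n) \<le> card (C \<times> C)"
  proof (rule subcover_number_le_labels[where label = F and M = M and \<gamma> = "2 * \<gamma>"])
    show "F ` ?X \<subseteq> C \<times> C"
    proof
      fix w assume "w \<in> F ` ?X"
      then obtain s where s: "s \<in> ?X" "w = F s" by blast
      have "cmod (s i) \<le> K" for i using dual_seqs_coordinate[OF s(1), of i] b(2)[of i] by linarith
      then have "\<bar>Re (s i)\<bar> \<le> K" "\<bar>Im (s i)\<bar> \<le> K" for i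
        using abs_Re_le_cmod abs_Im_le_cmod order_trans by blast+
      then show "w \<in> C \<times> C" unfolding s(2) F_def using dual_seqs_real_parts[OF s(1)] by (intro SigmaI mem) auto
    qed
    show "cmod (x j - z j) \<le> 2 * \<gamma>" if "F x = F z" "j < ?N" for x z j
    proof -
      have "\<bar>Re (x j) - Re (z j)\<bar> \<le> \<gamma>" "\<bar>Im (x j) - Im (z j)\<bar> \<le> \<gamma>"
        using that residual_code_determines[OF \<gamma>, of b "\<lambda>i. Re (x i)" ?N 0 "\<lambda>i. Re (z i)"]
          residual_code_determines[OF \<gamma>, of b "\<lambda>i. Im (x i)" ?N 0 "\<lambda>i. Im (z i)"] by (auto simp: F_def)
      then show ?thesis using cmod_le[of "x j - z j"] by simp
    qed
    show "shift x \<in> ?X" if "x \<in> ?X" for x by (rule shift_dual_seqs[OF sh that])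
  qed (use leb C in auto)
  then have "real (subcover_number (top_of_set ?X) (iterated_join (top_of_set ?X) shift \<U> n)) \<le> (real (card C))\<^sup>2"
    by (simp add: card_cartesian_product power2_eq_square flip: of_nat_mult)
  also have "\<dots> \<le> (\<theta> powr (- D) * (1 + 2 * of_int Q * \<theta>) ^ ?N)\<^sup>2" using C(2) by (intro power_mono) auto
  finally show ?thesis by (simp add: D_def)
qed

text \<open>Given \<open>e > 0\<close>, first \<open>\<theta>\<close> is taken so small that the letters of the words contribute at most \<open>e/8\<close>
  per coordinate, then \<open>\<kappa>\<close> so small that the number \<open>2 \<kappa> N / \<gamma>\<close> of misses, each of cost
  \<open>- ln \<theta>\<close>, does the same.  Two words of length \<open>N \<le> 2 n\<close> then cost at most \<open>e n\<close>.\<close>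

lemma entropy_dual_seqs:
  assumes b: "\<And>i. b i \<in> elems A" "\<And>i. nrm A (b i) \<le> K"
    and sh: "\<And>n c. nrm A (\<Sum>i<n. scl A (c i) (b (Suc i))) \<le> nrm A (\<Sum>i<n. scl A (c i) (b i))"
    and small: "\<And>\<kappa>. \<kappa> > 0 \<Longrightarrow> \<forall>\<^sub>F n in sequentially. rademacher b n 0 \<le> \<kappa> * real n"
  shows "topological_entropy (top_of_set (dual_seqs b)) shift = 0"
proof -
  let ?X = "top_of_set (dual_seqs b)"
  have "limsup (\<lambda>n. ereal (ln (real (subcover_number ?X (iterated_join ?X shift \<U> n))) / real n)) \<le> 0"
    if U: "open_cover ?X \<U>" for \<U>
  proof (rule ereal_le_epsilon2)
    fix e :: real assume e: "e > 0"
    obtain M \<gamma>' where \<gamma>': "\<gamma>' > 0" and leb': "\<And>x. x \<in> dual_seqs b \<Longrightarrow>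
        \<exists>U\<in>\<U>. \<forall>z\<in>dual_seqs b. (\<forall>j<M. cmod (x j - z j) \<le> \<gamma>') \<longrightarrow> z \<in> U"
      by (rule Lebesgue_number_coordinates[OF compact_dual_seqs U], rule that; assumption)
    define \<gamma> where "\<gamma> = \<gamma>' / 2"
    have \<gamma>: "\<gamma> > 0" using \<gamma>' by (simp add: \<gamma>_def)
    have leb: "\<exists>U\<in>\<U>. \<forall>z\<in>dual_seqs b. (\<forall>j<M. cmod (x j - z j) \<le> 2 * \<gamma>) \<longrightarrow> z \<in> U" if "x \<in> dual_seqs b" for x
      using leb'[OF that] by (simp add: \<gamma>_def)
    have K0: "0 \<le> K" using b nrm_nonneg order_trans by blast
    define Q where "Q = \<lceil>2 * K / \<gamma> + 1\<rceil>"
    have Q: "2 * K / \<gamma> + 1 \<le> of_int Q" unfolding Q_def by (rule le_of_int_ceiling)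
    have "0 \<le> 2 * K / \<gamma>" using K0 \<gamma> by simp
    then have Q0: "Q > 0" using Q by linarith
    define \<theta> where "\<theta> = min (1/2) (e / (16 * of_int Q))"
    have \<theta>: "0 < \<theta>" "\<theta> \<le> 1/2" "16 * of_int Q * \<theta> \<le> e"
      using e Q0 by (auto simp: \<theta>_def min_def field_simps)
    define l where "l = - ln \<theta>"
    have l: "l > 0" using \<theta> by (simp add: l_def)
    define \<kappa> where "\<kappa> = e * \<gamma> / (16 * l)"
    have \<kappa>: "\<kappa> > 0" using e \<gamma> l by (simp add: \<kappa>_def)
    have ev: "\<forall>\<^sub>F n in sequentially. rademacher b (n + M) 0 \<le> \<kappa> * real (n + M)"
      using small[OF \<kappa>] by (subst eventually_sequentially_seg[where k = M])
    have "\<forall>\<^sub>F n in sequentially. ln (real (subcover_number ?X (iterated_join ?X shift \<U> n))) / real n \<le> e"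
      using ev eventually_ge_at_top[of "Suc M"]
    proof eventually_elim
      case (elim n)
      let ?k = "real (subcover_number ?X (iterated_join ?X shift \<U> n))"
      define N where "N = n + M"
      have N: "real N \<le> 2 * real n" "n > 0" using elim(2) by (auto simp: N_def)
      define B where "B = \<theta> powr (- (2 * rademacher b N 0 / \<gamma>)) * (1 + 2 * of_int Q * \<theta>) ^ N"
      have pos: "1 + 2 * of_int Q * \<theta> > 0" using Q0 \<theta> by (intro add_pos_nonneg) auto
      then have B: "B > 0" using \<theta> by (simp add: B_def)
      have le: "?k \<le> B\<^sup>2"
        unfolding B_def N_def using \<theta> Q0 by (intro subcover_number_dual_seqs[OF b sh \<gamma> leb _ Q]) auto
      have lnB: "ln B = 2 * rademacher b N 0 / \<gamma> * l + real N * ln (1 + 2 * of_int Q * \<theta>)"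
        using \<theta> pos by (simp add: B_def ln_mult ln_powr ln_realpow l_def)
      have r: "rademacher b N 0 \<le> \<kappa> * real N" using elim(1) by (simp add: N_def)
      have "2 * rademacher b N 0 / \<gamma> * l \<le> 2 * (\<kappa> * real N) / \<gamma> * l"
        using r \<gamma> l by (intro mult_right_mono divide_right_mono mult_left_mono) auto
      also have "\<dots> = real N * (e / 8)" using \<gamma> l by (simp add: \<kappa>_def field_simps)
      finally have 1: "2 * rademacher b N 0 / \<gamma> * l \<le> real N * (e / 8)" .
      have "ln (1 + 2 * of_int Q * \<theta>) \<le> 2 * of_int Q * \<theta>"
        using Q0 \<theta> by (intro ln_add_one_self_le_self) auto
      also have "\<dots> \<le> e / 8" using \<theta>(3) by simp
      finally have "real N * ln (1 + 2 * of_int Q * \<theta>) \<le> real N * (e / 8)" by (intro mult_left_mono) auto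
      then have "ln B \<le> real N * (e / 4)" using 1 lnB by simp
      also have "\<dots> \<le> 2 * real n * (e / 4)" using N e by (intro mult_right_mono) auto
      finally have lnB': "2 * ln B \<le> real n * e" by (simp add: mult.commute)
      have "ln ?k \<le> real n * e"
      proof (cases "?k = 0")
        case True
        then show ?thesis using e by simp
      next
        case False
        then have "ln ?k \<le> ln (B\<^sup>2)" using le B by (subst ln_le_cancel_iff) auto
        also have "\<dots> = 2 * ln B" using B by (simp add: ln_realpow)
        finally show ?thesis using lnB' by simp
      qed
      then show ?case using N(2) by (simp add: divide_le_eq mult.commute)
    qed
    then have "limsup (\<lambda>n. ereal (ln (real (subcover_number ?X (iterated_join ?X shift \<U> n))) / real n)) \<le> ereal e"
      by (intro Limsup_bounded) (auto elim: eventually_mono)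
    then show "limsup (\<lambda>n. ereal (ln (real (subcover_number ?X (iterated_join ?X shift \<U> n))) / real n)) \<le> 0 + ereal e"
      by simp
  qed
  then have "topological_entropy ?X shift \<le> 0"
    unfolding topological_entropy_def by (intro SUP_least) auto
  then show ?thesis using topological_entropy_nonneg by (rule antisym)
qed

end

section \<open>Moebius disjointness for endomorphisms of zero entropy\<close>

lemma linear_map_on_sum:
  assumes A: "cstar_algebra A" and f: "linear_map_on A s f" and x: "\<And>j. j \<in> J \<Longrightarrow> x j \<in> elems A"
  shows "f (\<Sum>j\<in>J. scl A (c j) (x j)) = (\<Sum>j\<in>J. s (c j) (f (x j)))"
proof -
  interpret A: cstar_algebra A by fact
  have add: "f (x + y) = f x + f y" if "x \<in> elems A" "y \<in> elems A" for x y
    using f that by (auto simp: linear_map_on_def)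
  have scl: "f (scl A c x) = s c (f x)" if "x \<in> elems A" for c x
    using f that by (auto simp: linear_map_on_def)
  have "f 0 = 0" using add[of 0 0] A.zero_closed by simp
  with x show ?thesis
    by (induction J rule: infinite_finite_induct) (auto simp: add scl A.closed)
qed

lemma sum_apply:
  fixes f :: "'j \<Rightarrow> 'x \<Rightarrow> 'b::comm_monoid_add"
  shows "(\<Sum>j\<in>J. f j) x = (\<Sum>j\<in>J. f j x)"
  by (induction J rule: infinite_finite_induct) simp_all

text \<open>A finite infimum of extended naturals is a minimum.\<close>

lemma rcp_attained:
  assumes "rcp A \<pi> \<Omega> \<delta> \<noteq> \<infinity>"
  obtains \<phi> \<psi> B where "(\<phi>, \<psi>, B) \<in> CPA A \<pi> \<Omega> \<delta>" "rcp A \<pi> \<Omega> \<delta> = enat (cstar_rank B)"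
proof -
  let ?S = "(\<lambda>(\<phi>, \<psi>, B). enat (cstar_rank B)) ` CPA A \<pi> \<Omega> \<delta>"
  have "?S \<noteq> {}" using assms by (auto simp: rcp_def top_enat_def)
  then have "Inf ?S \<in> ?S"
    using LeastI_ex[of "\<lambda>x. x \<in> ?S"] by (simp only: Inf_enat_def if_False ex_in_conv simp_thms)
  then show thesis using that unfolding rcp_def by force
qed

text \<open>The error of the approximate factorisation through \<open>B\<close> is less than \<open>\<delta>\<close> at each of the \<open>n\<close>
  elements, hence at most \<open>n \<delta>\<close> at a combination with coefficients of modulus at most one.\<close>

lemma onorm_le_factorisation:
  fixes \<pi> :: "'a::ab_group_add \<Rightarrow> 'h::complex_hilbert_space \<Rightarrow> 'h"
  assumes A: "cstar_algebra A" and hom: "star_hom A bounded_operators \<pi>"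
    and cpa: "(\<phi>, \<psi>, B) \<in> CPA A \<pi> \<Omega> \<delta>" and x: "\<And>j. j < n \<Longrightarrow> x j \<in> elems A \<and> x j \<in> \<Omega>"
    and c: "\<And>j. j < n \<Longrightarrow> \<bar>c j\<bar> \<le> 1"
  shows "onorm (\<pi> (\<Sum>j<n. scl A (of_real (c j)) (x j)))
    \<le> nrm B (\<Sum>j<n. scl B (of_real (c j)) (\<phi> (x j))) + real n * \<delta>"
proof -
  interpret A: cstar_algebra A by fact
  have B: "cstar_algebra B" and \<phi>: "\<phi> ` elems A \<subseteq> elems B" "linear_map_on A (scl B) \<phi>"
    and \<psi>: "\<psi> ` elems B \<subseteq> elems bounded_operators" "linear_map_on B (scl bounded_operators) \<psi>"
      "\<And>b. b \<in> elems B \<Longrightarrow> nrm bounded_operators (\<psi> b) \<le> nrm B b"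
    and \<delta>: "\<And>a. a \<in> \<Omega> \<Longrightarrow> nrm bounded_operators (\<psi> (\<phi> a) - \<pi> a) < \<delta>"
    using cpa by (auto simp: CPA_def completely_positive_def contractive_def)
  interpret B: cstar_algebra B by fact
  have \<pi>: "linear_map_on A (scl bounded_operators) \<pi>" "\<pi> ` elems A \<subseteq> elems bounded_operators"
    using hom by (auto simp: star_hom_def)
  have bl: "bounded_linear S" if "S \<in> elems bounded_operators" for S :: "'h \<Rightarrow> 'h"
    using that by (simp add: bounded_operators_def)
  have xA: "x j \<in> elems A" "x j \<in> \<Omega>" "\<phi> (x j) \<in> elems B" if "j < n" for j using x[OF that] \<phi>(1) by auto
  define X where "X = (\<Sum>j<n. scl A (of_real (c j)) (x j))"
  define Y where "Y = (\<Sum>j<n. scl B (of_real (c j)) (\<phi> (x j)))"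
  have Y: "Y \<in> elems B" unfolding Y_def using xA by (intro B.closed) auto
  have \<pi>X: "\<pi> X \<xi> = (\<Sum>j<n. scaleR (c j) (\<pi> (x j) \<xi>))" for \<xi>
  proof -
    have "\<pi> X = (\<Sum>j<n. scl bounded_operators (of_real (c j)) (\<pi> (x j)))"
      unfolding X_def using xA by (intro linear_map_on_sum[OF A \<pi>(1)]) auto
    then show ?thesis by (simp add: sum_apply bounded_operators_def scaleC_of_real)
  qed
  have \<psi>Y: "\<psi> Y \<xi> = (\<Sum>j<n. scaleR (c j) (\<psi> (\<phi> (x j)) \<xi>))" for \<xi>
  proof -
    have "\<psi> Y = (\<Sum>j<n. scl bounded_operators (of_real (c j)) (\<psi> (\<phi> (x j))))"
      unfolding Y_def using xA by (intro linear_map_on_sum[OF B \<psi>(2)]) auto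
    then show ?thesis by (simp add: sum_apply bounded_operators_def scaleC_of_real)
  qed
  have "norm (\<pi> X \<xi>) \<le> (nrm B Y + real n * \<delta>) * norm \<xi>" for \<xi>
  proof -
    have err: "norm (scaleR (c j) (\<psi> (\<phi> (x j)) \<xi> - \<pi> (x j) \<xi>)) \<le> \<delta> * norm \<xi>" if j: "j < n" for j
    proof -
      have "bounded_linear (\<psi> (\<phi> (x j)))" "bounded_linear (\<pi> (x j))"
        using bl \<psi>(1) \<pi>(2) xA[OF j] by blast+
      then have d: "bounded_linear (\<psi> (\<phi> (x j)) - \<pi> (x j))"
        using bounded_linear_sub[of "\<psi> (\<phi> (x j))" "\<pi> (x j)"] by (simp add: fun_diff_def)
      have "norm ((\<psi> (\<phi> (x j)) - \<pi> (x j)) \<xi>) \<le> onorm (\<psi> (\<phi> (x j)) - \<pi> (x j)) * norm \<xi>" by (rule onorm[OF d])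
      also have "\<dots> \<le> \<delta> * norm \<xi>"
        using \<delta>[OF xA(2)[OF j]] by (intro mult_right_mono) (auto simp: bounded_operators_def)
      finally have "norm (\<psi> (\<phi> (x j)) \<xi> - \<pi> (x j) \<xi>) \<le> \<delta> * norm \<xi>" by simp
      moreover have "\<bar>c j\<bar> * norm (\<psi> (\<phi> (x j)) \<xi> - \<pi> (x j) \<xi>) \<le> 1 * norm (\<psi> (\<phi> (x j)) \<xi> - \<pi> (x j) \<xi>)"
        using c[OF j] by (intro mult_right_mono) auto
      ultimately show ?thesis by simp
    qed
    have "norm (\<psi> Y \<xi> - \<pi> X \<xi>) = norm (\<Sum>j<n. scaleR (c j) (\<psi> (\<phi> (x j)) \<xi> - \<pi> (x j) \<xi>))"
      by (simp add: \<pi>X \<psi>Y sum_subtractf scaleR_diff_right)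
    also have "\<dots> \<le> (\<Sum>j<n. \<delta> * norm \<xi>)" using err by (intro sum_norm_le) auto
    finally have 1: "norm (\<psi> Y \<xi> - \<pi> X \<xi>) \<le> real n * \<delta> * norm \<xi>" by simp
    have "norm (\<psi> Y \<xi>) \<le> onorm (\<psi> Y) * norm \<xi>" using onorm bl \<psi>(1) Y by blast
    also have "\<dots> \<le> nrm B Y * norm \<xi>" using \<psi>(3)[OF Y] by (intro mult_right_mono) (auto simp: bounded_operators_def)
    finally have 2: "norm (\<psi> Y \<xi>) \<le> nrm B Y * norm \<xi>" .
    have "norm (\<pi> X \<xi>) \<le> norm (\<psi> Y \<xi>) + norm (\<psi> Y \<xi> - \<pi> X \<xi>)" by norm
    then show ?thesis using 1 2 by (simp add: algebra_simps)
  qed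
  moreover have "0 \<le> nrm B Y + real n * \<delta>"
  proof (cases "n = 0")
    case False
    have "bounded_linear (\<psi> (\<phi> (x 0)))" "bounded_linear (\<pi> (x 0))"
      using bl \<psi>(1) \<pi>(2) xA[of 0] False by blast+
    then have "bounded_linear (\<psi> (\<phi> (x 0)) - \<pi> (x 0))"
      using bounded_linear_sub[of "\<psi> (\<phi> (x 0))" "\<pi> (x 0)"] by (simp add: fun_diff_def)
    then have "0 \<le> onorm (\<psi> (\<phi> (x 0)) - \<pi> (x 0))" by (rule onorm_pos_le)
    then have "0 \<le> \<delta>" using \<delta>[OF xA(2)[of 0]] False by (simp add: bounded_operators_def)
    then show ?thesis using B.nrm_nonneg[OF Y] by simp
  qed (use B.nrm_nonneg[OF Y] in simp)
  ultimately show ?thesis unfolding X_def[symmetric] Y_def[symmetric] by (intro onorm_bound) auto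
qed

lemma star_hom_orbit:
  assumes A: "cstar_algebra A" "is_unit_of A e" and \<alpha>: "star_hom A A \<alpha>" and a: "a \<in> elems A"
  shows "(\<alpha> ^^ i) a \<in> elems A \<and> nrm A ((\<alpha> ^^ i) a) \<le> nrm A a"
proof (induction i)
  case (Suc i)
  then show ?case
    using star_homD(1)[OF \<alpha>] star_hom_contractive[OF A(1) A(1) A(2) \<alpha>, of "(\<alpha> ^^ i) a"] by auto
qed (simp add: a)

text \<open>Of the bound \<open>\<kappa> n\<close>, three quarters are spent on the average in the finite-dimensional algebra
  and one quarter on the approximation error.\<close>

lemma rademacher_averages_of_orbit:
  fixes \<pi> :: "'a::ab_group_add \<Rightarrow> 'h::complex_hilbert_space \<Rightarrow> 'h"
  assumes A: "cstar_algebra A" "is_unit_of A e" and \<alpha>: "star_hom A A \<alpha>"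
    and \<pi>: "faithful_representation A \<pi>" and ent: "voiculescu_brown_entropy A \<pi> \<alpha> = 0"
    and a: "a \<in> elems A" and \<kappa>: "\<kappa> > 0"
  shows "\<forall>\<^sub>F n in sequentially. cstar_algebra.rademacher A (\<lambda>i. (\<alpha> ^^ i) a) n 0 \<le> \<kappa> * real n"
proof -
  interpret A: cstar_algebra A by fact
  define b where "b i = (\<alpha> ^^ i) a" for i
  have b: "b i \<in> elems A \<and> nrm A (b i) \<le> nrm A a" for i
    unfolding b_def by (rule star_hom_orbit[OF A \<alpha> a])
  define K where "K = nrm A a + 1"
  have K: "K > 0" using A.nrm_nonneg[OF a] by (simp add: K_def)
  define \<kappa>' where "\<kappa>' = min (\<kappa> / 4) K"
  have \<kappa>': "0 < \<kappa>'" "\<kappa>' \<le> K" "4 * \<kappa>' \<le> \<kappa>" using \<kappa> K by (auto simp: \<kappa>'_def)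
  define \<beta> where "\<beta> = \<kappa>'\<^sup>2 / (8 * (exp 1)\<^sup>2 * K\<^sup>2)"
  have \<beta>: "\<beta> > 0" using \<kappa>' K by (simp add: \<beta>_def)
  define \<Omega> where "\<Omega> n = (\<Union>i<n. (\<alpha> ^^ i) ` {a})" for n
  have "limsup (\<lambda>n. ln_enat (rcp A \<pi> (\<Omega> n) \<kappa>') / ereal (real n)) \<le> voiculescu_brown_entropy A \<pi> \<alpha>"
    unfolding voiculescu_brown_entropy_def \<Omega>_def
    by (rule SUP_upper2[of "{a}"], use a in simp, rule SUP_upper, use \<kappa>' in simp)
  also have "\<dots> < ereal (\<beta> / 16)" using ent \<beta> by simp
  finally have "\<forall>\<^sub>F n in sequentially. ln_enat (rcp A \<pi> (\<Omega> n) \<kappa>') / ereal (real n) < ereal (\<beta> / 16)"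
    by (rule Limsup_lessD)
  moreover have "\<forall>\<^sub>F n in sequentially. real n \<ge> max 1 (4 / \<beta>)"
    by (metis eventually_sequentiallyI nat_ceiling_le_eq)
  ultimately show ?thesis
    unfolding b_def[symmetric]
  proof eventually_elim
    case (elim n)
    have n: "real n > 0" "4 \<le> \<beta> * real n" using elim(2) \<beta> by (auto simp: field_simps)
    have fin: "rcp A \<pi> (\<Omega> n) \<kappa>' \<noteq> \<infinity>"
    proof
      assume "rcp A \<pi> (\<Omega> n) \<kappa>' = \<infinity>"
      then show False using elim(1) n(1) by (simp add: ln_enat_def)
    qed
    obtain \<phi> \<psi> B where cpa: "(\<phi>, \<psi>, B) \<in> CPA A \<pi> (\<Omega> n) \<kappa>'"
      and rank: "rcp A \<pi> (\<Omega> n) \<kappa>' = enat (cstar_rank B)"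
      by (rule rcp_attained[OF fin])
    have B: "cstar_algebra B" "finite_dimensional B" and \<phi>: "\<phi> ` elems A \<subseteq> elems B"
      "\<And>x. x \<in> elems A \<Longrightarrow> nrm B (\<phi> x) \<le> nrm A x"
      using cpa by (auto simp: CPA_def completely_positive_def contractive_def)
    interpret B: cstar_algebra B by fact
    have "real (cstar_rank B) \<le> exp (\<beta> / 16 * real n)"
    proof (cases "cstar_rank B = 0")
      case False
      then have "ln (real (cstar_rank B)) / real n < \<beta> / 16" using elim(1) n(1) by (simp add: rank ln_enat_def)
      then have "ln (real (cstar_rank B)) \<le> \<beta> / 16 * real n" using n(1) by (simp add: field_simps)
      then show ?thesis using False by (metis exp_le_cancel_iff exp_ln of_nat_0_less_iff gr0I)
    qed simp
    then have S: "sign_avg n (\<lambda>\<epsilon>. nrm B (\<Sum>j<n. scl B (of_real (\<epsilon> j)) (\<phi> (b j)))) \<le> 3 * (\<kappa>' * real n)"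
    proof (intro B.sign_avg_nrm_le[OF B(2) _ _ \<kappa>'(1,2) \<beta>_def n(2)])
      show "\<phi> (b j) \<in> elems B" for j using \<phi>(1) b by blast
      show "nrm B (\<phi> (b j)) \<le> K" for j using \<phi>(2)[of "b j"] b[of j] by (simp add: K_def)
    qed
    have "A.rademacher b n 0 \<le> sign_avg n (\<lambda>\<epsilon>. nrm B (\<Sum>j<n. scl B (of_real (\<epsilon> j)) (\<phi> (b j))) + real n * \<kappa>')"
      unfolding A.rademacher_def
    proof (rule sign_avg_mono)
      fix \<epsilon> :: "nat \<Rightarrow> real" assume \<epsilon>: "\<And>i. i < n \<Longrightarrow> \<bar>\<epsilon> i\<bar> = 1"
      let ?x = "\<Sum>j<n. scl A (of_real (\<epsilon> j)) (b j)"
      have "nrm A ?x \<le> onorm (\<pi> ?x)"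
        using b by (intro faithful_representation_isometric[OF A(1) A(2) \<pi>] A.closed) auto
      also have "\<dots> \<le> nrm B (\<Sum>j<n. scl B (of_real (\<epsilon> j)) (\<phi> (b j))) + real n * \<kappa>'"
      proof (rule onorm_le_factorisation[OF A(1) _ cpa])
        show "star_hom A bounded_operators \<pi>" using \<pi> by (simp add: faithful_representation_def)
        show "b j \<in> elems A \<and> b j \<in> \<Omega> n" if "j < n" for j using b that by (auto simp: \<Omega>_def b_def)
        show "\<bar>\<epsilon> j\<bar> \<le> 1" if "j < n" for j using \<epsilon>[OF that] by simp
      qed
      finally show "nrm A (0 + ?x) \<le> nrm B (\<Sum>j<n. scl B (of_real (\<epsilon> j)) (\<phi> (b j))) + real n * \<kappa>'" by simp
    qed
    also have "\<dots> = sign_avg n (\<lambda>\<epsilon>. nrm B (\<Sum>j<n. scl B (of_real (\<epsilon> j)) (\<phi> (b j)))) + real n * \<kappa>'"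
      by (simp only: sign_avg_add sign_avg_const)
    also have "\<dots> \<le> 4 * \<kappa>' * real n" using S by simp
    also have "\<dots> \<le> \<kappa> * real n" using \<kappa>'(3) by (intro mult_right_mono) auto
    finally show ?case .
  qed
qed

theorem proposition2p3:
  fixes A :: "'a::ab_group_add star_struct"
    and \<alpha> :: "'a \<Rightarrow> 'a"
    and \<pi> :: "'a \<Rightarrow> 'h::complex_hilbert_space \<Rightarrow> 'h"
  assumes conjecture: "moebius_disjointness_conjecture TYPE(nat \<Rightarrow> complex)"
    and algebra: "cstar_algebra A" "unital A"
    and exact: "exact_via TYPE('k::complex_hilbert_space) A"
    and endomorphism: "star_hom A A \<alpha>" "inj_on \<alpha> (elems A)"
    and representation: "faithful_representation A \<pi>"
    and entropy: "voiculescu_brown_entropy A \<pi> \<alpha> = 0"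
  shows "mu_linearly_disjoint A \<alpha>"
  unfolding mu_linearly_disjoint_def
proof (intro allI impI, elim conjE)
  fix \<rho> a assume \<rho>: "state A \<rho>" and a: "a \<in> elems A"
  interpret A: cstar_algebra A by fact
  obtain e where e: "is_unit_of A e" using algebra(2) by (auto simp: unital_def)
  define b where "b i = (\<alpha> ^^ i) a" for i
  note contr = star_hom_contractive[OF algebra(1) algebra(1) e endomorphism(1)]
  have b: "b i \<in> elems A \<and> nrm A (b i) \<le> nrm A a" for i
    unfolding b_def by (rule star_hom_orbit[OF algebra(1) e endomorphism(1) a])
  have lin: "linear_map_on A (scl A) \<alpha>" using endomorphism(1) by (simp add: star_hom_def)
  have sh: "nrm A (\<Sum>i<n. scl A (c i) (b (Suc i))) \<le> nrm A (\<Sum>i<n. scl A (c i) (b i))" for n c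
  proof -
    have "\<alpha> (\<Sum>i<n. scl A (c i) (b i)) = (\<Sum>i<n. scl A (c i) (\<alpha> (b i)))"
      using b by (intro linear_map_on_sum[OF algebra(1) lin]) auto
    then show ?thesis
      using contr[of "\<Sum>i<n. scl A (c i) (b i)"] b by (simp add: A.closed b_def)
  qed
  let ?X = "top_of_set (A.dual_seqs b)"
  have compact: "compact_space ?X"
    using A.compact_dual_seqs by (simp add: compact_space_subtopology)
  have coord: "continuous_on S (\<lambda>s :: nat \<Rightarrow> complex. s i)" for S i
    by (rule continuous_on_subset[OF continuous_on_product_coordinates]) simp
  have "continuous_on (A.dual_seqs b) shift"
    by (intro continuous_on_coordinatewise_then_product coord)
  then have cont: "continuous_map ?X ?X shift"
    using A.shift_dual_seqs[OF sh] by (auto simp: continuous_map_in_subtopology)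
  have ent: "topological_entropy ?X shift = 0"
  proof (rule A.entropy_dual_seqs)
    show "b i \<in> elems A" "nrm A (b i) \<le> nrm A a" for i using b by auto
    show "\<forall>\<^sub>F n in sequentially. A.rademacher b n 0 \<le> \<kappa> * real n" if "\<kappa> > 0" for \<kappa>
      unfolding b_def
      by (rule rademacher_averages_of_orbit[OF algebra(1) e endomorphism(1) representation entropy a that])
  qed (rule sh)
  have "(\<lambda>n. \<rho> (b n)) \<in> A.dual_seqs b"
    unfolding A.dual_seqs_def
  proof (intro CollectI allI)
    fix n c
    have "linear_map_on A (*) \<rho>" using \<rho> by (simp add: state_def)
    then have "\<rho> (\<Sum>i<n. scl A (c i) (b i)) = (\<Sum>i<n. c i * \<rho> (b i))"
      using b by (intro linear_map_on_sum[OF algebra(1)]) auto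
    then show "cmod (\<Sum>i<n. c i * \<rho> (b i)) \<le> nrm A (\<Sum>i<n. scl A (c i) (b i))"
      using state_bounded[OF algebra(1) \<rho>, of "\<Sum>i<n. scl A (c i) (b i)"] b by (simp add: A.closed)
  qed
  then have x: "(\<lambda>n. \<rho> (b n)) \<in> topspace ?X" by simp
  have f: "continuous_map ?X euclidean (\<lambda>s. s 0)" using coord by simp
  have "(\<lambda>N. (\<Sum>n=1..N. of_int (moebius_mu n) * (shift ^^ n) (\<lambda>n. \<rho> (b n)) 0) / of_nat N) \<longlonglongrightarrow> 0"
    using conjecture[unfolded moebius_disjointness_conjecture_def, rule_format, of ?X shift "\<lambda>s. s 0" "\<lambda>n. \<rho> (b n)"]
      compact cont ent f x by blast
  then show "(\<lambda>N. (\<Sum>n=1..N. of_int (moebius_mu n) * \<rho> ((\<alpha> ^^ n) a)) / of_nat N) \<longlonglongrightarrow> 0"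
    by (simp add: shift_funpow b_def)
qed

end
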